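(* Let $A\subseteq\mathbb R^n$ and $B\subseteq\mathbb R^m$ be semi-algebraic sets, and let $\psi:A\to B$ be a semi-algebraic isomorphism. Then $\chi(A)=\chi(B)$, where $\chi$ denotes the Schanuel--Euler characteristic.
   Context: A semi-algebraic isomorphism $\psi:A\to B$ is a bijection whose graph $\{(x,\psi(x)):x\in A\}\subseteq\mathbb R^n\times\mathbb R^m$ is a semi-algebraic set (continuity is not required). Schanuel integral. A function $f:\mathbb R\to\mathbb R$ is called Schanuel integrable if (i) $f$ is discontinuous at only finitely many points; (ii) $f$ has (finite) left and right limits $f(x-),f(x+)$ at every $x\in\mathbb R$; (iii) the (finite) limits $f(\pm\infty)=\lim_{x\to\pm\infty}f(x)$ exist. Its Schanuel integral is $$\int_\varepsilon f=\sum_{x\in\mathbb R}\Big(f(x)-\tfrac12 f(x-)-\tfrac12 f(x+)\Big)-\tfrac12 f(+\infty)-\tfrac12 f(-\infty).$$ For $f:\mathbb R^n\to\mathbb R$, put $I_n^f=f$ and $I_{k-1}^f(a_1,\dots,a_{k-1})=\int_\varepsilon I_k^f(a_1,\dots,a_{k-1},x_k)\,dx_k$ for $1\le k\le n$; $f$ is Schanuel integrable (with respect to the standard ordered basis) if each of these one-variable integrals is defined, and then $\int_\varepsilon f:=I_0^f$. With respect to another ordered basis $(v_n,\dots,v_1)$ the integral is $\int_\varepsilon (f\circ T_v)$, where $T_v$ is linear with $T_v(e_i)=v_i$. For a semi-algebraic set $A\subseteq\mathbb R^n$, $\mathbf 1_A$ is Schanuel integrable with respect to every ordered basis and the value does not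 depend on the ordered basis; the Schanuel--Euler characteristic of $A$ is $\chi(A)=\int_\varepsilon\mathbf 1_A$. *)

theory Defs
  imports Complex_Main "HOL-Library.Groups_Big_Fun" "HOL-Library.Indicator_Function"
begin

text \<open>
  The space of real \<open>n\<close>-tuples is the set of real lists of length \<open>n\<close>, so that the dimension is an
  ordinary natural number (possibly \<open>0\<close>) and products of spaces are given by list append.
\<close>

definition Rn :: "nat \<Rightarrow> real list set" where
  "Rn n = {x. length x = n}"


subsection \<open>Semi-algebraic sets and isomorphisms\<close>

text \<open>
  Polynomial functions in \<open>n\<close> real variables: the algebra generated by the constants and the
  coordinates, as in \<open>real_polynomial_function\<close> of HOL-Analysis. Only values on \<^term>\<open>Rn n\<close> matter.
\<close>

inductive poly_fun :: "nat \<Rightarrow> (real list \<Rightarrow> real) \<Rightarrow> bool" for n where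
  const: "poly_fun n (\<lambda>x. c)"
| coord: "i < n \<Longrightarrow> poly_fun n (\<lambda>x. x ! i)"
| add: "poly_fun n p \<Longrightarrow> poly_fun n q \<Longrightarrow> poly_fun n (\<lambda>x. p x + q x)"
| mult: "poly_fun n p \<Longrightarrow> poly_fun n q \<Longrightarrow> poly_fun n (\<lambda>x. p x * q x)"

text \<open>
  Semi-algebraic subsets of \<^term>\<open>Rn n\<close>: the Boolean algebra generated by the sets \<open>{p > 0}\<close>.
  It contains the sets \<open>{p = 0}\<close>, being the complements of \<open>{p > 0} \<union> {- p > 0}\<close>.
\<close>

inductive semialgebraic :: "nat \<Rightarrow> real list set \<Rightarrow> bool" for n where
  pos: "poly_fun n p \<Longrightarrow> semialgebraic n {x \<in> Rn n. p x > 0}"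
| compl: "semialgebraic n A \<Longrightarrow> semialgebraic n (Rn n - A)"
| union: "semialgebraic n A \<Longrightarrow> semialgebraic n B \<Longrightarrow> semialgebraic n (A \<union> B)"
| inter: "semialgebraic n A \<Longrightarrow> semialgebraic n B \<Longrightarrow> semialgebraic n (A \<inter> B)"

definition semialgebraic_iso ::
    "nat \<Rightarrow> nat \<Rightarrow> real list set \<Rightarrow> real list set \<Rightarrow> (real list \<Rightarrow> real list) \<Rightarrow> bool" where
  "semialgebraic_iso n m A B \<psi> \<longleftrightarrow>
     bij_betw \<psi> A B \<and> semialgebraic (n + m) {x @ \<psi> x | x. x \<in> A}"


subsection \<open>The Schanuel integral\<close>

definition schanuel_integrable1 :: "(real \<Rightarrow> real) \<Rightarrow> bool" where
  "schanuel_integrable1 f \<longleftrightarrow>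
     finite {x. \<not> isCont f x} \<and>
     (\<forall>x. (\<exists>l. (f \<longlongrightarrow> l) (at_left x)) \<and> (\<exists>l. (f \<longlongrightarrow> l) (at_right x))) \<and>
     (\<exists>l. (f \<longlongrightarrow> l) at_top) \<and> (\<exists>l. (f \<longlongrightarrow> l) at_bot)"

text \<open>
  \<open>Sum_any\<close> sums over all reals at which the summand is nonzero; for an integrable \<open>f\<close> these are
  among the finitely many points of discontinuity.
\<close>

definition schanuel_integral1 :: "(real \<Rightarrow> real) \<Rightarrow> real" where
  "schanuel_integral1 f =
     Sum_any (\<lambda>x. f x - 1/2 * Lim (at_left x) f - 1/2 * Lim (at_right x) f)
       - 1/2 * Lim at_top f - 1/2 * Lim at_bot f"

text \<open>
  Integration with respect to the standard ordered basis; the last variable is integrated first.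
  As with other totalised integrals, the value \<open>schanuel_integral n f\<close> is only meaningful if
  \<open>schanuel_integrable n f\<close> holds.
\<close>

primrec schanuel_integrable :: "nat \<Rightarrow> (real list \<Rightarrow> real) \<Rightarrow> bool" where
  "schanuel_integrable 0 f \<longleftrightarrow> True"
| "schanuel_integrable (Suc n) f \<longleftrightarrow>
     (\<forall>a \<in> Rn n. schanuel_integrable1 (\<lambda>x. f (a @ [x]))) \<and>
     schanuel_integrable n (\<lambda>a. schanuel_integral1 (\<lambda>x. f (a @ [x])))"

primrec schanuel_integral :: "nat \<Rightarrow> (real list \<Rightarrow> real) \<Rightarrow> real" where
  "schanuel_integral 0 f = f []"
| "schanuel_integral (Suc n) f =
     schanuel_integral n (\<lambda>a. schanuel_integral1 (\<lambda>x. f (a @ [x])))"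

definition schanuel_euler :: "nat \<Rightarrow> real list set \<Rightarrow> real" where
  "schanuel_euler n A = schanuel_integral n (indicator A)"

end

(* Integrating the indicator of the graph of psi over the last m variables first gives chi(A),
   because every nonempty fibre is a point, and integrating over the first n variables first gives chi(B).
   It remains to exchange the order of integration, one pair of variables at a time.

   Sums of sgn(q) over the roots of p are Cauchy indices, which the Euclidean algorithm computes from the
   coefficients of p and q. Counting roots in this way shows that projections of semi-algebraic sets are
   semi-algebraic and that fibre integrals again have finitely many values and semi-algebraic level sets.

   In the plane, such a function is a combination of indicators of graphs and subgraphs of functions xi of
   one variable with semi-algebraic graph. The sign of xi(t) - xi(s) for t near s is a function of s with
   semi-algebraic level sets, hence constant on each of finitely many open intervals. Strict local extrema
   are countable, so on such an interval xi is constant or strictly monotone, and for those xi both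
   iterated integrals are computed directly. *)

theory Submission
  imports Defs "HOL-Analysis.Analysis"
begin

text \<open>The obstacle is the exchange of two integrals. The Schanuel integral only adds up jumps,
  so the integrands must form a class that is stable under integration and small enough to control.
  This class is \<open>cfun\<close>: finitely many values of any type, semi-algebraic level sets. It
  holds predicates, signs, one-sided limits and fibre integrals alike, and its real members are
  linear combinations of signs of polynomials, so linear statements need only be checked for one
  sign. Euclidean division has to work with parameters, hence without denominators; multiplying by
  the square of a leading coefficient preserves Cauchy indices. In one variable every nonempty open
  interval, bounded or not, has integral -1. A continuous strictly monotone function maps open
  intervals to open intervals, which makes the iterated integrals of its graph agree. Continuity
  comes for free: it is a semi-algebraic condition, so it holds everywhere or nowhere on each of the
  finitely many intervals, while a monotone function has only countably many
  discontinuities.\<close>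

subsection \<open>Cauchy indices of real polynomials\<close>

text \<open>
  For nonzero \<open>p\<close>, the sign of \<open>p\<close> immediately to the right of \<open>t\<close>. Below, \<open>jump t p\<close> is half of the change of sign of
  \<open>p\<close> across \<open>t\<close>, and \<open>index p q\<close> is the Cauchy index of \<open>q / p\<close>.
\<close>

definition lsgn :: "real \<Rightarrow> real poly \<Rightarrow> real" where
  "lsgn t p = sgn (poly (p div [:- t, 1:] ^ order t p) t)"

lemma order_lsgnI:
  assumes "p = [:- t, 1:] ^ m * q" "poly q t \<noteq> 0"
  shows "p \<noteq> 0" "order t p = m" "lsgn t p = sgn (poly q t)"
proof -
  have q: "q \<noteq> 0" using assms by auto
  show "p \<noteq> 0" using assms q by simp
  then have "order t p = order t ([:- t, 1:] ^ m) + order t q"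
    using assms(1) by (metis order_mult)
  then show o: "order t p = m" using assms(2) by (simp add: order_power_n_n order_0I)
  have "p div [:- t, 1:] ^ m = q" using assms(1) by simp
  then show "lsgn t p = sgn (poly q t)" by (simp add: lsgn_def o)
qed

lemma order_lsgnE:
  assumes "p \<noteq> 0"
  obtains q where "p = [:- t, 1:] ^ order t p * q" "poly q t \<noteq> 0" "lsgn t p = sgn (poly q t)"
proof -
  obtain q where q: "p = [:- t, 1:] ^ order t p * q" "\<not> [:- t, 1:] dvd q"
    using order_decomp[OF assms] by blast
  then have "poly q t \<noteq> 0" by (simp add: poly_eq_0_iff_dvd)
  with q(1) that order_lsgnI show thesis by metis
qed

lemma lsgn_mult: "p \<noteq> 0 \<Longrightarrow> q \<noteq> 0 \<Longrightarrow> lsgn t (p * q) = lsgn t p * lsgn t q"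
proof -
  assume "p \<noteq> 0" "q \<noteq> 0"
  then obtain p1 q1 where *: "p = [:- t, 1:] ^ order t p * p1" "poly p1 t \<noteq> 0" "lsgn t p = sgn (poly p1 t)"
      "q = [:- t, 1:] ^ order t q * q1" "poly q1 t \<noteq> 0" "lsgn t q = sgn (poly q1 t)"
    by (metis order_lsgnE)
  have "p * q = [:- t, 1:] ^ (order t p + order t q) * (p1 * q1)"
    by (subst *(1), subst *(4)) (simp add: power_add algebra_simps)
  from order_lsgnI(3)[OF this] * show ?thesis by (simp add: sgn_mult)
qed

lemma lsgn_nonroot: "poly p t \<noteq> 0 \<Longrightarrow> lsgn t p = sgn (poly p t)"
  using order_lsgnI(3)[of p t 0 p] by simp

lemma lsgn_square: "p \<noteq> 0 \<Longrightarrow> lsgn t p * lsgn t p = 1"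
  using order_lsgnE[of p t] by (metis sgn_eq_0_iff real_sgn_eq abs_sgn_eq_1 abs_mult_self_eq mult_1)

definition jump :: "real \<Rightarrow> real poly \<Rightarrow> real" where
  "jump t p = (if odd (order t p) then lsgn t p else 0)"

section \<open>Signs at infinity and the sum of all jumps\<close>

definition sgn_top :: "real poly \<Rightarrow> real" where
  "sgn_top p = sgn (lead_coeff p)"

definition sgn_bot :: "real poly \<Rightarrow> real" where
  "sgn_bot p = (-1) ^ degree p * sgn (lead_coeff p)"

lemma sgn_poly_const_on:
  fixes p :: "real poly"
  assumes "u \<le> v" "\<And>t. u \<le> t \<Longrightarrow> t \<le> v \<Longrightarrow> poly p t \<noteq> 0"
  shows "sgn (poly p u) = sgn (poly p v)"
proof (cases "u = v")
  case False
  then have uv: "u < v" using assms by simp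
  have nz: "poly p u \<noteq> 0" "poly p v \<noteq> 0" using assms by auto
  have "\<not> poly p u * poly p v < 0"
    using poly_IVT[OF uv, of p] assms(2) by (meson less_imp_le)
  then show ?thesis using nz
    by (metis linorder_neqE_linordered_idom mult_neg_pos mult_pos_neg sgn_neg sgn_pos)
qed simp

lemma sgn_poly_eq_sgn_top:
  assumes "\<And>t. a \<le> t \<Longrightarrow> poly p t \<noteq> 0"
  shows "sgn (poly p a) = sgn_top p"
proof -
  have aux: "sgn (poly p a) = sgn_top p" if pos: "\<forall>t\<ge>a. poly p t \<noteq> 0" "lead_coeff p > 0" for p
  proof -
    obtain n where n: "\<forall>x\<ge>n. lead_coeff p \<le> poly p x"
      using poly_pinfty_gt_lc[OF pos(2)] by blast
    
    have "sgn (poly p a) = sgn (poly p (max a n))"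
      using pos(1) by (intro sgn_poly_const_on) auto
    moreover have "poly p (max a n) > 0" using n pos(2) by (meson less_le_trans max.cobounded2)
    ultimately show ?thesis using pos(2) by (simp add: sgn_top_def)
  qed
  have "lead_coeff p \<noteq> 0" using assms[of a] by auto
  then consider "lead_coeff p > 0" | "lead_coeff (- p) > 0" by fastforce
  then show ?thesis
  proof cases
    case 2
    then have "sgn (poly (- p) a) = sgn_top (- p)" using assms by (intro aux) auto
    then show ?thesis by (simp add: sgn_top_def sgn_minus)
  qed (use aux assms in auto)
qed

lemma sgn_poly_eq_sgn_bot:
  assumes "\<And>t. t \<le> a \<Longrightarrow> poly p t \<noteq> 0"
  shows "sgn (poly p a) = sgn_bot p"
proof -
  \<comment> \<open>The reflection from t to -t reduces the claim to the one at +infinity; the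
    leading coefficient picks up the factor (-1)^degree.\<close>
  define q where "q = pcompose p [:0, -1:]"
  have q: "poly q t = poly p (- t)" for t by (simp add: q_def poly_pcompose)
  have "sgn (poly q (- a)) = sgn_top q"
    using assms by (intro sgn_poly_eq_sgn_top) (auto simp: q)
  moreover have "lead_coeff q = lead_coeff p * (-1) ^ degree p"
    unfolding q_def by (subst lead_coeff_comp) auto
  ultimately show ?thesis by (simp add: q sgn_top_def sgn_bot_def sgn_mult)
qed

lemma sgn_top_bot_mult:
  "sgn_top (p * q) = sgn_top p * sgn_top q"
  "p \<noteq> 0 \<Longrightarrow> q \<noteq> 0 \<Longrightarrow> sgn_bot (p * q) = sgn_bot p * sgn_bot q"
  by (auto simp: sgn_top_def sgn_bot_def lead_coeff_mult sgn_mult power_add)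
    (simp add: degree_mult_eq power_add coeff_mult_degree_sum sgn_mult)

text \<open>The sum telescopes, each jump being half a change of sign and the sign being constant
  between roots. Formally the largest root \<open>a\<close> is split off with its full multiplicity
  \<open>m\<close>: left of \<open>a\<close> the factor (X - a)^m has sign (-1)^m, so it multiplies
  all other jumps by this constant.\<close>

lemma sum_jump:
  assumes "p \<noteq> 0"
  shows "(\<Sum>t | poly p t = 0. jump t p) = (sgn_top p - sgn_bot p) / 2"
  using assms
proof (induction "card {t. poly p t = 0}" arbitrary: p rule: less_induct)
  case less
  let ?R = "{t. poly p t = 0}"
  have fin: "finite ?R" using less.prems by (rule poly_roots_finite)
  show ?case
  proof (cases "?R = {}")
    case True
    then have "sgn_top p = sgn_bot p"
      using sgn_poly_eq_sgn_bot[of 0 p] sgn_poly_eq_sgn_top[of 0 p] by auto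
    then show ?thesis using True by (simp add: Collect_empty_eq)
  next
    case False
    define a where "a = Max ?R"
    have a: "a \<in> ?R" "\<And>t. t \<in> ?R \<Longrightarrow> t \<le> a"
      using Max_in[OF fin False] Max_ge[OF fin] unfolding a_def by auto
    define m where "m = order a p"
    obtain q where q: "p = [:- a, 1:] ^ m * q" "poly q a \<noteq> 0" "lsgn a p = sgn (poly q a)"
      unfolding m_def by (rule order_lsgnE[OF less.prems])
    have q0: "q \<noteq> 0" using q by auto
    have m0: "m \<noteq> 0" using a(1) less.prems by (simp add: m_def order_root)
    have R: "{t. poly q t = 0} = ?R - {a}"
      using q(2) by (auto simp: q(1) m0 poly_power)
    have "card {t. poly q t = 0} < card ?R"
      unfolding R using fin a(1) by (rule card_Diff1_less)
    note IH = less.hyps[OF this q0]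
    have ord: "order t p = order t q" "lsgn t p = (-1) ^ m * lsgn t q" if "poly q t = 0" for t
    proof -
      from that have "t \<in> ?R - {a}" using R by blast
      then have "t < a" using a(2)[of t] by auto
      then have nz: "poly ([:- a, 1:] ^ m) t \<noteq> 0" by (simp add: poly_power)
      have lin: "[:- a, 1:] ^ m \<noteq> 0" by simp
      show "order t p = order t q"
        unfolding q(1) using lin q0 nz by (subst order_mult) (auto simp: order_0I)
      have "lsgn t ([:- a, 1:] ^ m) = (-1) ^ m"
        using nz \<open>t < a\<close> by (subst lsgn_nonroot) (auto simp: poly_power power_sgn[symmetric])
      then show "lsgn t p = (-1) ^ m * lsgn t q"
        unfolding q(1) using lin q0 by (subst lsgn_mult) auto
    qed
    have jt: "jump t p = (-1) ^ m * jump t q" if "poly q t = 0" for t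
      using ord[OF that] by (simp add: jump_def)
    have "(\<Sum>t\<in>?R. jump t p) = jump a p + (\<Sum>t\<in>?R - {a}. jump t p)"
      using fin a(1) by (simp add: sum.remove)
    also have "(\<Sum>t\<in>?R - {a}. jump t p) = (-1) ^ m * (\<Sum>t | poly q t = 0. jump t q)"
      unfolding R[symmetric] sum_distrib_left using jt by (intro sum.cong) auto
    also have "\<dots> = (-1) ^ m * ((sgn_top q - sgn_bot q) / 2)" using IH by simp
    finally have S: "(\<Sum>t\<in>?R. jump t p) = jump a p + (-1) ^ m * ((sgn_top q - sgn_bot q) / 2)" .
    \<comment> \<open>No root lies beyond \<open>a\<close>, so the sign of \<open>q\<close> at
      \<open>a\<close> is already its sign at +infinity.\<close>
    have "poly q t \<noteq> 0" if "a \<le> t" for t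
      using a(2)[of t] that q(2) R by fastforce
    then have "sgn (poly q a) = sgn_top q" by (rule sgn_poly_eq_sgn_top)
    then have ja: "jump a p = (if odd m then sgn_top q else 0)"
      using q(3) by (simp add: jump_def m_def)
    have lc: "degree ([:- a, 1:] ^ m) = m" "lead_coeff ([:- a, 1:] ^ m) = 1"
      by (simp_all add: degree_linear_power coeff_linear_power)
    have tp: "sgn_top p = sgn_top q" "sgn_bot p = (-1) ^ m * sgn_bot q"
      unfolding q(1) using q0
      by (auto simp: sgn_top_bot_mult) (use lc in \<open>auto simp: sgn_top_def sgn_bot_def\<close>)
    show ?thesis unfolding S ja tp by (auto simp: field_simps)
  qed
qed

section \<open>Cauchy indices: reciprocity, division step, root counting\<close>

definition index :: "real poly \<Rightarrow> real poly \<Rightarrow> real" where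
  "index p q = (if p = 0 \<or> q = 0 then 0
     else \<Sum>t | poly p t = 0 \<and> order t q < order t p. jump t (p * q))"

text \<open>Reciprocity. Near a root, both q / p and p / q have the sign of p * q, so the two
  indices sum the jumps of p * q over the roots where \<open>p\<close>, respectively
  \<open>q\<close>, has the larger order. A root of equal orders has even order in p * q and
  contributes nothing. Together this is the sum of all jumps of p * q.\<close>

lemma index_add_swap:
  assumes "p \<noteq> 0" "q \<noteq> 0"
  shows "index p q + index q p = (sgn_top p * sgn_top q - sgn_bot p * sgn_bot q) / 2"
proof -
  let ?R = "{t. poly (p * q) t = 0}"
  have fin: "finite ?R" using assms by (intro poly_roots_finite) simp
  have *: "index a b = (\<Sum>t\<in>?R. if order t b < order t a then jump t (p * q) else 0)"
    if "a * b = p * q" "a \<noteq> 0" "b \<noteq> 0" for a b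
  proof -
    have "index a b = (\<Sum>t | poly a t = 0 \<and> order t b < order t a. jump t (p * q))"
      using that by (simp add: index_def)
    also have "{t. poly a t = 0 \<and> order t b < order t a} = {t\<in>?R. order t b < order t a}"
      using that by (auto simp: that(1)[symmetric] order_root)
    finally show ?thesis using fin by (subst sum.inter_filter[symmetric]) auto
  qed
  have "index p q + index q p = (\<Sum>t\<in>?R. jump t (p * q))"
  proof -
    have "even (order t (p * q))" if "order t p = order t q" for t
      using that assms by (simp add: order_mult)
    then show ?thesis
      using assms by (subst (1 2) *)
        (auto simp: mult.commute sum.distrib[symmetric] jump_def intro!: sum.cong)
  qed
  also have "\<dots> = (sgn_top (p * q) - sgn_bot (p * q)) / 2"
    using assms by (intro sum_jump) simp
  finally show ?thesis using assms by (simp add: sgn_top_bot_mult)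
qed

text \<open>One step of the Euclidean algorithm: near a pole of \<open>q / p\<close> the term \<open>a * p\<close> is negligible.\<close>

lemma lsgn_euclid:
  assumes "p \<noteq> 0" "q \<noteq> 0" "order t q < order t p" "c > 0"
  shows "smult c q - a * p \<noteq> 0" "order t (smult c q - a * p) = order t q"
    "lsgn t (smult c q - a * p) = lsgn t q"
proof -
  obtain p1 where p1: "p = [:- t, 1:] ^ order t p * p1" using order_lsgnE[OF assms(1)] by metis
  obtain q1 where q1: "q = [:- t, 1:] ^ order t q * q1" "poly q1 t \<noteq> 0" "lsgn t q = sgn (poly q1 t)"
    using order_lsgnE[OF assms(2)] by metis
  define k where "k = order t p - order t q"
  have k: "order t p = order t q + k" "k > 0" using assms(3) by (auto simp: k_def)
  have "smult c q - a * p = [:- t, 1:] ^ order t q * (smult c q1 - a * [:- t, 1:] ^ k * p1)"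
    by (subst p1, subst q1(1)) (simp add: k(1) power_add algebra_simps)
  note * = order_lsgnI[OF this]
  have "poly (smult c q1 - a * [:- t, 1:] ^ k * p1) t = c * poly q1 t"
    using k(2) by (simp add: power_0_left)
  with * assms(4) q1(2,3) k(2) show "smult c q - a * p \<noteq> 0" "order t (smult c q - a * p) = order t q"
    "lsgn t (smult c q - a * p) = lsgn t q" by (auto simp: sgn_mult power_0_left)
qed

text \<open>The index sees \<open>q\<close> only modulo \<open>p\<close>. The positive factor
  \<open>c\<close> makes room for division without denominators: it will be the square of a leading
  coefficient.\<close>

lemma index_euclid:
  assumes "c > 0"
  shows "index p (smult c q - a * p) = index p q"
proof (cases "p = 0")
  case False
  define q' where "q' = smult c q - a * p"
  define T where "T r = (if r = 0 then {} else {t. poly p t = 0 \<and> order t r < order t p})" for r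
  \<comment> \<open>Undoing the step is a step of the same form, so no new poles over
    \<open>p\<close> can appear either.\<close>
  have inv: "smult (1 / c) q' - smult (- 1 / c) a * p = q"
    using assms by (simp add: q'_def smult_diff_right)
  have sub: "T q \<subseteq> T q'"
    using lsgn_euclid[OF False _ _ assms, of q _ a] by (auto simp: T_def q'_def)
  have sub': "T q' \<subseteq> T q"
    using lsgn_euclid[OF False, of q' _ "1 / c" "smult (- 1 / c) a", unfolded inv] assms
    by (auto simp: T_def)
  have I: "index p r = (\<Sum>t\<in>T r. jump t (p * r))" for r
    using False by (simp add: index_def T_def)
  have "jump t (p * q') = jump t (p * q)" if "t \<in> T q" for t
  proof -
    have q: "q \<noteq> 0" "order t q < order t p" using that by (auto simp: T_def split: if_splits)
    note * = lsgn_euclid[OF False q assms, of a, folded q'_def]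
    show ?thesis using * q False by (simp add: jump_def lsgn_mult order_mult)
  qed
  then show ?thesis using sub sub' unfolding q'_def[symmetric] I
    by (intro sum.cong) auto
qed (simp add: index_def)

text \<open>The quotient p' / p passes from minus to plus at every root of \<open>p\<close>,
  whatever its multiplicity, so p' q / p jumps there by the sign of \<open>q\<close>. Where
  \<open>q\<close> vanishes as well, p' q has at least the order of \<open>p\<close> and there is no
  pole.\<close>

lemma sum_sgn_roots:
  assumes "p \<noteq> 0"
  shows "(\<Sum>t | poly p t = 0. sgn (poly q t)) = index p (pderiv p * q)"
proof (cases "q = 0 \<or> pderiv p = 0")
  case True
  have "{t. poly p t = 0} = {}" if "pderiv p = 0"
    using that assms by (auto simp: pderiv_eq_0_iff elim!: degree_eq_zeroE)
  with True show ?thesis by (auto simp: index_def)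
next
  case False
  then have nz: "q \<noteq> 0" "pderiv p \<noteq> 0" by auto
  have ord: "order t p = Suc (order t (pderiv p))" "lsgn t (pderiv p) = lsgn t p"
    if t: "poly p t = 0" for t
  proof -
    have "order t p \<noteq> 0" using t assms by (simp add: order_root)
    then obtain m where m: "order t p = Suc m" using not0_implies_Suc by blast
    obtain p1 where p1: "p = [:- t, 1:] ^ Suc m * p1" "poly p1 t \<noteq> 0" "lsgn t p = sgn (poly p1 t)"
      using order_lsgnE[OF assms] m by metis
    have "pderiv p = [:- t, 1:] ^ m * (smult (Suc m) p1 + [:- t, 1:] * pderiv p1)"
      by (subst p1(1)) (simp only: pderiv_mult pderiv_power_Suc, simp add: pderiv_pCons algebra_simps)
    note * = order_lsgnI[OF this]
    have "poly (smult (Suc m) p1 + [:- t, 1:] * pderiv p1) t = Suc m * poly p1 t" by simp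
    with * p1 m show "order t p = Suc (order t (pderiv p))" "lsgn t (pderiv p) = lsgn t p"
      by (auto simp: sgn_mult)
  qed
  have "index p (pderiv p * q) =
      (\<Sum>t\<in>{t\<in>{t. poly p t = 0}. order t (pderiv p * q) < order t p}. jump t (p * (pderiv p * q)))"
    using nz assms by (simp add: index_def)
  also have "\<dots> = (\<Sum>t | poly p t = 0.
      if order t (pderiv p * q) < order t p then jump t (p * (pderiv p * q)) else 0)"
    using poly_roots_finite[OF assms] by (subst sum.inter_filter[symmetric]) auto
  also have "\<dots> = (\<Sum>t | poly p t = 0. sgn (poly q t))"
  proof (rule sum.cong, simp)
    fix t assume "t \<in> {t. poly p t = 0}"
    then have t: "poly p t = 0" by simp
    show "(if order t (pderiv p * q) < order t p then jump t (p * (pderiv p * q)) else 0)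
        = sgn (poly q t)"
    proof (cases "poly q t = 0")
      case True
      then have "order t q \<noteq> 0" using nz by (simp add: order_root)
      then show ?thesis using True ord[OF t] nz by (simp add: order_mult)
    next
      case False
      then have "order t q = 0" by (rule order_0I)
      moreover have "lsgn t (p * (pderiv p * q)) = lsgn t p * lsgn t p * sgn (poly q t)"
        using nz assms False ord[OF t] by (simp add: lsgn_mult lsgn_nonroot)
      ultimately show ?thesis using ord[OF t] nz assms lsgn_square[OF assms, of t]
        by (simp add: order_mult jump_def)
    qed
  qed
  finally show ?thesis by simp
qed

subsection \<open>Functions with finitely many values and semi-algebraic level sets\<close>

lemma poly_fun_uminus: "poly_fun n p \<Longrightarrow> poly_fun n (\<lambda>x. - p x)"
  using poly_fun.mult[OF poly_fun.const[of n "-1"], of p] by simp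

lemma poly_fun_diff: "poly_fun n p \<Longrightarrow> poly_fun n q \<Longrightarrow> poly_fun n (\<lambda>x. p x - q x)"
  using poly_fun.add[OF _ poly_fun_uminus, of n p q] by simp

lemma poly_fun_compose:
  assumes "poly_fun m p" "length fs = m" "\<And>f. f \<in> set fs \<Longrightarrow> poly_fun n f"
  shows "poly_fun n (\<lambda>x. p (map (\<lambda>f. f x) fs))"
  using assms(1)
proof induction
  case (coord i)
  then show ?case using assms by simp
qed (auto intro: poly_fun.intros)

lemma semialgebraic_subset: "semialgebraic n A \<Longrightarrow> A \<subseteq> Rn n"
  by (induction rule: semialgebraic.induct) auto

lemma semialgebraic_empty: "semialgebraic n {}"
  using semialgebraic.pos[OF poly_fun.const[of n 0]] by simp

lemma semialgebraic_Rn: "semialgebraic n (Rn n)"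
  using semialgebraic.compl[OF semialgebraic_empty] by simp

lemma semialgebraic_UN:
  "finite I \<Longrightarrow> (\<And>i. i \<in> I \<Longrightarrow> semialgebraic n (A i)) \<Longrightarrow> semialgebraic n (\<Union>i\<in>I. A i)"
  by (induction rule: finite_induct) (auto intro: semialgebraic_empty semialgebraic.union)

lemma semialgebraic_zero: "poly_fun n p \<Longrightarrow> semialgebraic n {x \<in> Rn n. p x = 0}"
proof -
  assume p: "poly_fun n p"
  have "{x \<in> Rn n. p x = 0} = Rn n - ({x \<in> Rn n. p x > 0} \<union> {x \<in> Rn n. - p x > 0})" by auto
  also have "semialgebraic n \<dots>" using p
    by (intro semialgebraic.compl semialgebraic.union semialgebraic.pos poly_fun_uminus)
  finally show ?thesis .
qed

lemma semialgebraic_preimage: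
  assumes "semialgebraic m A" "length fs = m" "\<And>f. f \<in> set fs \<Longrightarrow> poly_fun n f"
  shows "semialgebraic n {x \<in> Rn n. map (\<lambda>f. f x) fs \<in> A}"
  using assms(1)
proof induction
  case (pos p)
  then have "semialgebraic n {x \<in> Rn n. p (map (\<lambda>f. f x) fs) > 0}"
    using assms by (intro semialgebraic.pos poly_fun_compose) auto
  then show ?case using assms(2) by (simp add: Rn_def)
next
  case (compl A)
  have "{x \<in> Rn n. map (\<lambda>f. f x) fs \<in> Rn m - A} = Rn n - {x \<in> Rn n. map (\<lambda>f. f x) fs \<in> A}"
    using assms(2) by (auto simp: Rn_def)
  then show ?case using semialgebraic.compl[OF compl.IH] by simp
next
  case (union A B)
  have "{x \<in> Rn n. map (\<lambda>f. f x) fs \<in> A \<union> B} =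
    {x \<in> Rn n. map (\<lambda>f. f x) fs \<in> A} \<union> {x \<in> Rn n. map (\<lambda>f. f x) fs \<in> B}" by auto
  then show ?case using semialgebraic.union[OF union.IH] by simp
next
  case (inter A B)
  have "{x \<in> Rn n. map (\<lambda>f. f x) fs \<in> A \<inter> B} =
    {x \<in> Rn n. map (\<lambda>f. f x) fs \<in> A} \<inter> {x \<in> Rn n. map (\<lambda>f. f x) fs \<in> B}" by auto
  then show ?case using semialgebraic.inter[OF inter.IH] by simp
qed

text \<open>The value type is arbitrary, so predicates, real functions and tuples fall under one
  notion, and sets enter as predicates. The finite range gives closure under every pointwise
  operation: a level set of a combination is a finite union of intersections of level sets.\<close>

definition cfun :: "nat \<Rightarrow> (real list \<Rightarrow> 'a) \<Rightarrow> bool" where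
  "cfun n f \<longleftrightarrow> finite (f ` Rn n) \<and> (\<forall>c. semialgebraic n {x \<in> Rn n. f x = c})"

lemma cfun_level: "cfun n f \<Longrightarrow> semialgebraic n {x \<in> Rn n. f x = c}"
  by (simp add: cfun_def)

lemma cfun_cong: "cfun n f \<Longrightarrow> (\<And>x. x \<in> Rn n \<Longrightarrow> f x = g x) \<Longrightarrow> cfun n g"
proof -
  assume f: "cfun n f" and eq: "\<And>x. x \<in> Rn n \<Longrightarrow> f x = g x"
  then have "g ` Rn n = f ` Rn n" "{x \<in> Rn n. g x = c} = {x \<in> Rn n. f x = c}" for c by auto
  with f show ?thesis by (simp add: cfun_def)
qed

lemma cfun_const: "cfun n (\<lambda>x. c)"
proof -
  have "{x \<in> Rn n. c = d} = (if c = d then Rn n else {})" for d by auto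
  moreover have "finite ((\<lambda>x. c) ` Rn n)" by (rule finite_subset[of _ "{c}"]) auto
  ultimately show ?thesis by (simp add: cfun_def semialgebraic_empty semialgebraic_Rn)
qed

lemma cfun_map2:
  assumes "cfun n f" "cfun n g"
  shows "cfun n (\<lambda>x. F (f x) (g x))"
  unfolding cfun_def
proof safe
  let ?A = "f ` Rn n" and ?B = "g ` Rn n"
  have fin: "finite (?A \<times> ?B)" using assms by (auto simp: cfun_def)
  then have "finite ((\<lambda>(a, b). F a b) ` (?A \<times> ?B))" by simp
  moreover have "(\<lambda>x. F (f x) (g x)) ` Rn n \<subseteq> (\<lambda>(a, b). F a b) ` (?A \<times> ?B)" by auto
  ultimately show "finite ((\<lambda>x. F (f x) (g x)) ` Rn n)" by (rule rev_finite_subset)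
  fix c
  let ?I = "{(a, b) \<in> ?A \<times> ?B. F a b = c}"
  have "finite ?I" using fin by (rule rev_finite_subset) auto
  then have "semialgebraic n (\<Union>i\<in>?I. {x \<in> Rn n. f x = fst i} \<inter> {x \<in> Rn n. g x = snd i})"
    using assms by (intro semialgebraic_UN semialgebraic.inter cfun_level) auto
  also have "(\<Union>i\<in>?I. {x \<in> Rn n. f x = fst i} \<inter> {x \<in> Rn n. g x = snd i})
      = {x \<in> Rn n. F (f x) (g x) = c}" by fastforce
  finally show "semialgebraic n {x \<in> Rn n. F (f x) (g x) = c}" .
qed

lemma cfun_map: "cfun n f \<Longrightarrow> cfun n (\<lambda>x. F (f x))"
  using cfun_map2[of n f f "\<lambda>a b. F a"] .

lemma cfun_if: "cfun n P \<Longrightarrow> cfun n f \<Longrightarrow> cfun n g \<Longrightarrow> cfun n (\<lambda>x. if P x then f x else g x)"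
  using cfun_map2[OF _ cfun_map2[of n f g Pair], of P "\<lambda>b (u, v). if b then u else v"] by simp

lemma cfun_conj: "cfun n P \<Longrightarrow> cfun n Q \<Longrightarrow> cfun n (\<lambda>x. P x \<and> Q x)"
  using cfun_map2[of n P Q "(\<and>)"] .

lemma cfun_disj: "cfun n P \<Longrightarrow> cfun n Q \<Longrightarrow> cfun n (\<lambda>x. P x \<or> Q x)"
  using cfun_map2[of n P Q "(\<or>)"] .

lemma cfun_imp: "cfun n P \<Longrightarrow> cfun n Q \<Longrightarrow> cfun n (\<lambda>x. P x \<longrightarrow> Q x)"
  using cfun_map2[of n P Q "(\<longrightarrow>)"] .

lemma cfun_not: "cfun n P \<Longrightarrow> cfun n (\<lambda>x. \<not> P x)"
  using cfun_map[of n P Not] .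

lemma cfun_eq: "cfun n P \<Longrightarrow> cfun n Q \<Longrightarrow> cfun n (\<lambda>x. P x = Q x)"
  using cfun_map2[of n P Q "(=)"] .

lemma cfun_add: "cfun n P \<Longrightarrow> cfun n Q \<Longrightarrow> cfun n (\<lambda>x. P x + Q x :: real)"
  using cfun_map2[of n P Q "(+)"] .

lemma cfun_diff: "cfun n P \<Longrightarrow> cfun n Q \<Longrightarrow> cfun n (\<lambda>x. P x - Q x :: real)"
  using cfun_map2[of n P Q "(-)"] .

lemma cfun_mult: "cfun n P \<Longrightarrow> cfun n Q \<Longrightarrow> cfun n (\<lambda>x. P x * Q x :: real)"
  using cfun_map2[of n P Q "(*)"] .

lemma cfun_sum_list:
  "(\<And>i. i \<in> set xs \<Longrightarrow> cfun n (f i)) \<Longrightarrow> cfun n (\<lambda>x. \<Sum>i\<leftarrow>xs. f i x :: real)"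
  by (induction xs) (auto intro: cfun_const cfun_add)

lemma cfun_Bex: "finite I \<Longrightarrow> (\<And>i. i \<in> I \<Longrightarrow> cfun n (P i)) \<Longrightarrow> cfun n (\<lambda>x. \<exists>i\<in>I. P i x)"
  by (induction rule: finite_induct) (auto intro: cfun_const cfun_disj)

lemma cfun_pred:
  assumes "semialgebraic n {x \<in> Rn n. P x}" shows "cfun n P"
  unfolding cfun_def
proof safe
  show "finite (P ` Rn n)" by (rule finite_subset[of _ UNIV]) auto
  fix c
  have "{x \<in> Rn n. P x = c} = (if c then {x \<in> Rn n. P x} else Rn n - {x \<in> Rn n. P x})" by auto
  then show "semialgebraic n {x \<in> Rn n. P x = c}" using assms semialgebraic.compl by simp
qed

lemma cfun_iff_pred: "cfun n P \<longleftrightarrow> semialgebraic n {x \<in> Rn n. P x}"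
  using cfun_pred cfun_level[of n P True] by auto

lemma cfun_mem: "semialgebraic n A \<Longrightarrow> cfun n (\<lambda>x. x \<in> A)"
proof -
  assume A: "semialgebraic n A"
  have "{x \<in> Rn n. x \<in> A} = A" using semialgebraic_subset[OF A] by auto
  then show ?thesis using A by (simp add: cfun_iff_pred)
qed

lemma cfun_sgn: assumes "poly_fun n p" shows "cfun n (\<lambda>x. sgn (p x))"
proof -
  have *: "cfun n (\<lambda>x. p x > 0)" "cfun n (\<lambda>x. p x = 0)"
    using assms by (auto intro!: cfun_pred semialgebraic.pos semialgebraic_zero)
  have "cfun n (\<lambda>x. if p x > 0 then 1 else if p x = 0 then 0 else - 1 :: real)"
    by (intro cfun_if cfun_const *)
  then show ?thesis by (rule cfun_cong) (auto simp: sgn_if)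
qed

lemma cfun_less: assumes "poly_fun n p" "poly_fun n q" shows "cfun n (\<lambda>x. p x < q x)"
proof -
  have "cfun n (\<lambda>x. sgn (q x - p x) = 1)"
    by (intro cfun_eq cfun_const cfun_sgn poly_fun_diff assms)
  then show ?thesis by (rule cfun_cong) (auto simp: sgn_if)
qed

lemma cfun_preimage:
  assumes "cfun m f" "length fs = m" "\<And>g. g \<in> set fs \<Longrightarrow> poly_fun n g"
  shows "cfun n (\<lambda>x. f (map (\<lambda>g. g x) fs))"
  unfolding cfun_def
proof safe
  have *: "map (\<lambda>g. g x) fs \<in> Rn m" for x using assms(2) by (simp add: Rn_def)
  then have "(\<lambda>x. f (map (\<lambda>g. g x) fs)) ` Rn n \<subseteq> f ` Rn m" by auto
  then show "finite ((\<lambda>x. f (map (\<lambda>g. g x) fs)) ` Rn n)"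
    using assms(1) finite_subset unfolding cfun_def by blast
  fix c
  show "semialgebraic n {x \<in> Rn n. f (map (\<lambda>g. g x) fs) = c}"
    using semialgebraic_preimage[OF cfun_level[OF assms(1), of c] assms(2,3)] * by simp
qed

text \<open>Combinations of signs form an algebra because \<open>sgn\<close> is multiplicative. They
  contain the indicator of {p > 0}, which is (sgn p + sgn (p^2)) / 2, hence by induction all
  indicators of semi-algebraic sets, and \<open>f\<close> is a finite combination of indicators of
  its level sets.\<close>

lemma cfun_real_representation:
  fixes f :: "real list \<Rightarrow> real"
  assumes "cfun n f"
  shows "\<exists>L. (\<forall>(c, q)\<in>set L. poly_fun n q) \<and>
    (\<forall>x\<in>Rn n. f x = (\<Sum>(c, q)\<leftarrow>L. c * sgn (q x)))"
proof -
  define R where "R f \<longleftrightarrow> (\<exists>L. (\<forall>(c, q)\<in>set L. poly_fun n q) \<and>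
      (\<forall>x\<in>Rn n. f x = (\<Sum>(c, q)\<leftarrow>L. c * sgn (q x))))" for f :: "real list \<Rightarrow> real"
  have cong: "R g" if "R f" "\<And>x. x \<in> Rn n \<Longrightarrow> g x = f x" for f g
    using that unfolding R_def by auto
  have sgn: "R (\<lambda>x. c * sgn (p x))" if "poly_fun n p" for p c
    unfolding R_def using that by (intro exI[of _ "[(c, p)]"]) simp
  have const: "R (\<lambda>x. c)" for c
    using sgn[OF poly_fun.const[of n 1], of c] by simp
  have add: "R (\<lambda>x. f x + g x)" if "R f" "R g" for f g
  proof -
    from that obtain L M where "\<forall>(c, q)\<in>set L. poly_fun n q" "\<forall>x\<in>Rn n. f x = (\<Sum>(c, q)\<leftarrow>L. c * sgn (q x))"
      "\<forall>(c, q)\<in>set M. poly_fun n q" "\<forall>x\<in>Rn n. g x = (\<Sum>(c, q)\<leftarrow>M. c * sgn (q x))"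
      unfolding R_def by blast
    then show ?thesis unfolding R_def by (intro exI[of _ "L @ M"]) auto
  qed
  have mult: "R (\<lambda>x. f x * g x)" if "R f" "R g" for f g
  proof -
    from that(2) obtain M where M: "\<forall>(c, q)\<in>set M. poly_fun n q" "\<forall>x\<in>Rn n. g x = (\<Sum>(c, q)\<leftarrow>M. c * sgn (q x))"
      unfolding R_def by blast
    have mono: "R (\<lambda>x. d * sgn (p x) * (\<Sum>(c, q)\<leftarrow>M. c * sgn (q x)))" if "poly_fun n p" for d p
      using M(1)
    proof (induction M)
      case (Cons a M)
      obtain c q where a: "a = (c, q)" by fastforce
      have "R (\<lambda>x. (d * c) * sgn (p x * q x))"
        using Cons.prems a that by (intro sgn poly_fun.mult) auto
      from add[OF this Cons.IH] Cons.prems show ?case by (simp add: a sgn_mult algebra_simps)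
    qed (simp add: const)
    from that(1) obtain L where L: "\<forall>(c, q)\<in>set L. poly_fun n q" "\<forall>x\<in>Rn n. f x = (\<Sum>(c, q)\<leftarrow>L. c * sgn (q x))"
      unfolding R_def by blast
    have "R (\<lambda>x. (\<Sum>(c, q)\<leftarrow>L. c * sgn (q x)) * (\<Sum>(c, q)\<leftarrow>M. c * sgn (q x)))"
      using L(1)
    proof (induction L)
      case (Cons a L)
      obtain c q where a: "a = (c, q)" by fastforce
      have "R (\<lambda>x. c * sgn (q x) * (\<Sum>(c, q)\<leftarrow>M. c * sgn (q x)))"
        using Cons.prems a by (intro mono) auto
      from add[OF this Cons.IH] Cons.prems show ?case by (simp add: a algebra_simps)
    qed (simp add: const)
    then show ?thesis by (rule cong) (use L M in auto)
  qed
  have ind: "R (indicator A)" if "semialgebraic n A" for A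
    using that
  proof induction
    case (pos p)
    have "R (\<lambda>x. 1 / 2 * sgn (p x) + 1 / 2 * sgn (p x * p x))"
      using pos by (intro add sgn poly_fun.mult)
    moreover have "(indicator {x \<in> Rn n. p x > 0} x :: real) = 1 / 2 * sgn (p x) + 1 / 2 * sgn (p x * p x)"
      if "x \<in> Rn n" for x using that by (auto simp: indicator_def sgn_if)
    ultimately show ?case by (rule cong)
  next
    case (compl A)
    have "R (\<lambda>x. 1 + (- 1) * indicator A x)" by (intro add mult const compl.IH)
    moreover have "(indicator (Rn n - A) x :: real) = 1 + (- 1) * indicator A x"
      if "x \<in> Rn n" for x using that by (auto simp: indicator_def)
    ultimately show ?case by (rule cong)
  next
    case (union A B)
    have "R (\<lambda>x. indicator A x + indicator B x + (- 1) * (indicator A x * indicator B x))"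
      by (intro add mult const union.IH)
    moreover have "(indicator (A \<union> B) x :: real) =
        indicator A x + indicator B x + (- 1) * (indicator A x * indicator B x)" for x
      by (auto simp: indicator_def)
    ultimately show ?case by (rule cong)
  next
    case (inter A B)
    have "R (\<lambda>x. indicator A x * indicator B x)" by (intro mult inter.IH)
    then show ?case by (rule cong) (simp add: indicator_inter_arith)
  qed
  have "R (\<lambda>x. \<Sum>c\<in>I. c * indicator {x \<in> Rn n. f x = c} x)" if "finite I" for I
    using that
  proof (induction rule: finite_induct)
    case (insert c I)
    have "R (\<lambda>x. c * indicator {x \<in> Rn n. f x = c} x)"
      by (intro mult const ind cfun_level assms)
    from add[OF this insert.IH] show ?case
      by (simp only: sum.insert[OF insert.hyps] not_False_eq_True)
  qed (simp add: const)
  then have sum: "R (\<lambda>x. \<Sum>c\<in>f ` Rn n. c * indicator {x \<in> Rn n. f x = c} x)"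
    using assms by (simp add: cfun_def)
  have "(\<Sum>c\<in>f ` Rn n. c * indicator {x \<in> Rn n. f x = c} x) = f x" if "x \<in> Rn n" for x
  proof -
    have "(\<Sum>c\<in>f ` Rn n. c * indicator {x \<in> Rn n. f x = c} x) = (\<Sum>c\<in>f ` Rn n. if c = f x then c else 0)"
      using that by (intro sum.cong) (auto simp: indicator_def)
    then show ?thesis using that assms by (simp add: cfun_def)
  qed
  then have "R f" by (intro cong[OF sum]) simp
  then show ?thesis unfolding R_def .
qed

subsection \<open>Families of univariate polynomials\<close>

text \<open>The number of coefficients is fixed, but the top ones may vanish at some
  \<open>x\<close>, so the degree varies with the parameter.\<close>

inductive pfam :: "nat \<Rightarrow> (real list \<Rightarrow> real poly) \<Rightarrow> bool" for n where
  zero: "pfam n (\<lambda>x. 0)"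
| pCons: "poly_fun n c \<Longrightarrow> pfam n P \<Longrightarrow> pfam n (\<lambda>x. pCons (c x) (P x))"

lemma pfam_const: "poly_fun n c \<Longrightarrow> pfam n (\<lambda>x. [:c x:])"
  by (intro pfam.intros)

lemma pfam_add: "pfam n P \<Longrightarrow> pfam n Q \<Longrightarrow> pfam n (\<lambda>x. P x + Q x)"
proof (induction P arbitrary: Q rule: pfam.induct)
  case (pCons c P)
  from pCons.prems show ?case
  proof cases
    case zero
    then show ?thesis using pCons.hyps by (simp add: pfam.pCons)
  next
    case (pCons d R)
    then show ?thesis using \<open>poly_fun n c\<close> pCons.IH
      by (simp add: pfam.pCons poly_fun.add)
  qed
qed simp

lemma pfam_smult: "pfam n P \<Longrightarrow> poly_fun n c \<Longrightarrow> pfam n (\<lambda>x. smult (c x) (P x))"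
proof (induction P rule: pfam.induct)
  case (pCons d P)
  then show ?case by (simp add: pfam.pCons poly_fun.mult)
qed (simp add: pfam.zero)

lemma pfam_mult: "pfam n P \<Longrightarrow> pfam n Q \<Longrightarrow> pfam n (\<lambda>x. P x * Q x)"
proof (induction P rule: pfam.induct)
  case (pCons c P)
  have "pfam n (\<lambda>x. smult (c x) (Q x) + pCons 0 (P x * Q x))"
    using pCons by (intro pfam_add pfam_smult pfam.pCons poly_fun.const)
  then show ?case by simp
qed (simp add: pfam.zero)

lemma pfam_pderiv: "pfam n P \<Longrightarrow> pfam n (\<lambda>x. pderiv (P x))"
proof (induction P rule: pfam.induct)
  case (pCons c P)
  have "pfam n (\<lambda>x. P x + pCons 0 (pderiv (P x)))"
    using pCons by (intro pfam_add pfam.pCons poly_fun.const)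
  then show ?case by (simp add: pderiv_pCons)
qed (simp add: pfam.zero)

lemma poly_fun_pfam:
  assumes "poly_fun (Suc n) p"
  shows "\<exists>P. pfam n P \<and> (\<forall>x\<in>Rn n. \<forall>t. p (x @ [t]) = poly (P x) t)"
  using assms
proof induction
    case (const c)
    show ?case by (rule exI[of _ "\<lambda>x. [:c:]"]) (auto intro: pfam_const poly_fun.const)
  next
    case (coord i)
    show ?case
    proof (cases "i = n")
      case True
      then show ?thesis
        by (intro exI[of _ "\<lambda>x. [:0, 1:]"]) (auto simp: Rn_def nth_append intro!: pfam.intros poly_fun.const)
    next
      case False
      with coord have "i < n" by simp
      then show ?thesis
        by (intro exI[of _ "\<lambda>x. [:x ! i:]"]) (auto simp: Rn_def nth_append intro!: pfam_const poly_fun.coord)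
    qed
  next
    case (add p q)
    then obtain P Q where "pfam n P" "pfam n Q"
      "\<forall>x\<in>Rn n. \<forall>t. p (x @ [t]) = poly (P x) t" "\<forall>x\<in>Rn n. \<forall>t. q (x @ [t]) = poly (Q x) t" by blast
    then show ?case by (intro exI[of _ "\<lambda>x. P x + Q x"]) (auto intro: pfam_add)
  next
    case (mult p q)
    then obtain P Q where "pfam n P" "pfam n Q"
      "\<forall>x\<in>Rn n. \<forall>t. p (x @ [t]) = poly (P x) t" "\<forall>x\<in>Rn n. \<forall>t. q (x @ [t]) = poly (Q x) t" by blast
    then show ?case by (intro exI[of _ "\<lambda>x. P x * Q x"]) (auto intro: pfam_mult)
qed

section \<open>The Euclidean algorithm with parameters, on coefficient lists\<close>

definition coeff_fam :: "(real list \<Rightarrow> real) list \<Rightarrow> real list \<Rightarrow> real poly" where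
  "coeff_fam cs x = Poly (map (\<lambda>c. c x) cs)"

lemma pfam_coeff_fam:
  assumes "pfam n P"
  shows "\<exists>cs. (\<forall>c\<in>set cs. poly_fun n c) \<and> P = coeff_fam cs"
  using assms
proof induction
    case zero
    show ?case by (rule exI[of _ "[]"]) (auto simp: coeff_fam_def)
  next
    case (pCons c P)
    then obtain cs where "\<forall>c\<in>set cs. poly_fun n c" "P = coeff_fam cs" by blast
    with pCons.hyps show ?case
      by (intro exI[of _ "c # cs"]) (auto simp: coeff_fam_def)
qed

lemma coeff_coeff_fam: "coeff (coeff_fam cs x) i = (if i < length cs then (cs ! i) x else 0)"
  by (simp add: coeff_fam_def nth_default_def)

lemma coeff_fam_snoc_0: "c x = 0 \<Longrightarrow> coeff_fam (cs @ [c]) x = coeff_fam cs x"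
  by (rule poly_eqI) (auto simp: coeff_coeff_fam nth_append)

lemma coeff_fam_snoc:
  assumes "c x \<noteq> 0"
  shows "degree (coeff_fam (cs @ [c]) x) = length cs" "lead_coeff (coeff_fam (cs @ [c]) x) = c x"
    "coeff_fam (cs @ [c]) x \<noteq> 0"
proof -
  show d: "degree (coeff_fam (cs @ [c]) x) = length cs"
    using assms by (intro antisym degree_le le_degree) (auto simp: coeff_coeff_fam nth_append)
  show l: "lead_coeff (coeff_fam (cs @ [c]) x) = c x"
    unfolding d by (simp add: coeff_coeff_fam)
  show "coeff_fam (cs @ [c]) x \<noteq> 0" using l assms by (metis coeff_0)
qed

lemma cfun_coeff_fam_eq_0:
  "(\<And>c. c \<in> set cs \<Longrightarrow> poly_fun n c) \<Longrightarrow> cfun n (\<lambda>x. coeff_fam cs x = 0)"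
proof (induction cs)
  case (Cons c cs)
  have "cfun n (\<lambda>x. sgn (c x) = 0 \<and> coeff_fam cs x = 0)"
    using Cons by (intro cfun_conj[OF cfun_eq[OF cfun_sgn cfun_const]]) auto
  then show ?case by (rule cfun_cong) (auto simp: coeff_fam_def sgn_eq_0_iff)
qed (simp add: coeff_fam_def cfun_const)

text \<open>The algorithm branches on whether the formal leading coefficients, the last list
  entries, vanish at \<open>x\<close>. A vanishing one is dropped; otherwise reciprocity or one
  division step applies. The signs tested on the way are signs of polynomial functions of
  \<open>x\<close>, which keeps the result in the class.\<close>

lemma cfun_index_coeff_fam:
  assumes "\<And>c. c \<in> set cs \<Longrightarrow> poly_fun n c" "\<And>d. d \<in> set ds \<Longrightarrow> poly_fun n d"
  shows "cfun n (\<lambda>x. index (coeff_fam cs x) (coeff_fam ds x))"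
  using assms
\<comment> \<open>Swapping the arguments keeps the total length, so a longer first list costs one
  extra unit; every other step shortens a list.\<close>
proof (induction "2 * (length cs + length ds) + (if length cs > length ds then 1 else 0)"
    arbitrary: cs ds rule: less_induct)
  case less
  show ?case
  proof (cases "cs = [] \<or> ds = []")
    case True
    then show ?thesis by (auto simp: coeff_fam_def index_def cfun_const)
  next
    case False
    then obtain cs' c ds' d where snoc: "cs = cs' @ [c]" "ds = ds' @ [d]"
      by (metis rev_exhaust)
    have pf: "poly_fun n c" "poly_fun n d" using less.prems snoc by auto
    \<comment> \<open>\<open>G\<close> is the index where \<open>c x\<close> and \<open>d x\<close>
      are both nonzero. In the division step the multiplier of the second list is the square of
      \<open>c x\<close>, hence positive, and the subtracted monomial multiple of the first list
      cancels the top term.\<close>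
    define G where "G x = (if length cs > length ds
        then (sgn (c x) * sgn (d x) - (- 1) ^ length cs' * sgn (c x) * ((- 1) ^ length ds' * sgn (d x))) / 2
             - index (coeff_fam ds x) (coeff_fam cs x)
        else index (coeff_fam cs x) (smult (c x * c x) (coeff_fam ds x)
          - (monom (c x * d x) (length ds' - length cs')) * coeff_fam cs x))" for x
    have G: "index (coeff_fam cs x) (coeff_fam ds x) = G x" if "c x \<noteq> 0" "d x \<noteq> 0" for x
    proof (cases "length cs > length ds")
      case True
      note * = coeff_fam_snoc[of c x cs', OF that(1), folded snoc]
        coeff_fam_snoc[of d x ds', OF that(2), folded snoc]
      have "index (coeff_fam cs x) (coeff_fam ds x) + index (coeff_fam ds x) (coeff_fam cs x) =
         (sgn (c x) * sgn (d x) - (- 1) ^ length cs' * sgn (c x) * ((- 1) ^ length ds' * sgn (d x))) / 2"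
        using index_add_swap[OF *(3,6)] * by (simp add: sgn_top_def sgn_bot_def)
      then show ?thesis using True by (simp only: G_def if_True eq_diff_eq)
    next
      case False
      moreover have "c x * c x > 0" using that(1) by (metis not_real_square_gt_zero)
      ultimately show ?thesis by (simp add: G_def index_euclid)
    qed
    have "cfun n G"
    proof (cases "length cs > length ds")
      case True
      have "cfun n (\<lambda>x. index (coeff_fam ds x) (coeff_fam cs x))"
        using True less.prems by (intro less.hyps) auto
      then have "cfun n (\<lambda>x. (sgn (c x) * sgn (d x) - (- 1) ^ length cs' * sgn (c x)
          * ((- 1) ^ length ds' * sgn (d x))) * (1 / 2) - index (coeff_fam ds x) (coeff_fam cs x))"
        using pf by (intro cfun_diff cfun_mult cfun_sgn cfun_const)
      then show ?thesis using True by (simp add: G_def[abs_def])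
    next
      case False
      define k where "k = length ds' - length cs'"
      have k: "length ds' = length cs' + k" using False by (simp add: k_def snoc)
      \<comment> \<open>The coefficients of the remainder. The one of index
        \<open>length ds'\<close> cancels and is left out, so this list is shorter than
        \<open>ds\<close>.\<close>
      define es where "es = map (\<lambda>i x. c x * c x * (ds ! i) x
          - (if i < k then 0 else c x * d x * (cs ! (i - k)) x)) [0..<length ds']"
      have es: "poly_fun n e" if "e \<in> set es" for e
      proof -
        from that obtain i where i: "i < length ds'" "e = (\<lambda>x. c x * c x * (ds ! i) x
          - (if i < k then 0 else c x * d x * (cs ! (i - k)) x))" by (auto simp: es_def)
        have "poly_fun n (ds ! i)"
          using i by (intro less.prems nth_mem) (simp add: snoc)
        moreover have "poly_fun n (cs ! (i - k))" if "\<not> i < k"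
          using i less.prems k that by (intro less.prems nth_mem) (simp add: snoc)
        ultimately show ?thesis unfolding i(2) using pf
          by (cases "i < k") (auto intro!: poly_fun_diff poly_fun.intros)
      qed
      have "smult (c x * c x) (coeff_fam ds x) - monom (c x * d x) k * coeff_fam cs x = coeff_fam es x" for x
      proof (rule poly_eqI)
        fix i
        show "coeff (smult (c x * c x) (coeff_fam ds x) - monom (c x * d x) k * coeff_fam cs x) i =
            coeff (coeff_fam es x) i"
          using k by (auto simp: coeff_coeff_fam coeff_monom_mult es_def snoc nth_append)
      qed
      moreover have "cfun n (\<lambda>x. index (coeff_fam cs x) (coeff_fam es x))"
        using False less.prems es by (intro less.hyps) (auto simp: es_def snoc)
      ultimately show ?thesis using False by (simp add: G_def[abs_def] k_def[symmetric])
    qed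
    moreover have "cfun n (\<lambda>x. index (coeff_fam cs' x) (coeff_fam ds x))"
      using less.prems by (intro less.hyps) (auto simp: snoc)
    moreover have "cfun n (\<lambda>x. index (coeff_fam cs x) (coeff_fam ds' x))"
      using less.prems by (intro less.hyps) (auto simp: snoc)
    ultimately have "cfun n (\<lambda>x. if sgn (c x) = 0 then index (coeff_fam cs' x) (coeff_fam ds x)
        else if sgn (d x) = 0 then index (coeff_fam cs x) (coeff_fam ds' x) else G x)"
      using pf by (intro cfun_if cfun_eq cfun_sgn cfun_const)
    then show ?thesis
    proof (rule cfun_cong)
      fix x
      show "(if sgn (c x) = 0 then index (coeff_fam cs' x) (coeff_fam ds x)
          else if sgn (d x) = 0 then index (coeff_fam cs x) (coeff_fam ds' x) else G x)
        = index (coeff_fam cs x) (coeff_fam ds x)"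
        unfolding sgn_eq_0_iff
        by (cases "c x = 0"; cases "d x = 0")
          (simp_all only: if_True if_False G not_False_eq_True simp_thms,
           simp_all only: snoc coeff_fam_snoc_0)
    qed
  qed
qed

lemma cfun_index:
  assumes "pfam n P" "pfam n Q" shows "cfun n (\<lambda>x. index (P x) (Q x))"
proof -
  obtain cs where cs: "\<forall>c\<in>set cs. poly_fun n c" "P = coeff_fam cs"
    using pfam_coeff_fam[OF assms(1)] by blast
  obtain ds where ds: "\<forall>c\<in>set ds. poly_fun n c" "Q = coeff_fam ds"
    using pfam_coeff_fam[OF assms(2)] by blast
  show ?thesis unfolding cs(2) ds(2) using cs(1) ds(1) by (intro cfun_index_coeff_fam) auto
qed

lemma cfun_pfam_eq_0:
  assumes "pfam n P" shows "cfun n (\<lambda>x. P x = 0)"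
proof -
  obtain cs where cs: "\<forall>c\<in>set cs. poly_fun n c" "P = coeff_fam cs"
    using pfam_coeff_fam[OF assms] by blast
  show ?thesis unfolding cs(2) using cs(1) by (intro cfun_coeff_fam_eq_0) auto
qed

lemma cfun_sgn_top: "pfam n P \<Longrightarrow> cfun n (\<lambda>x. sgn_top (P x))"
proof (induction P rule: pfam.induct)
  case (pCons c P)
  then have "cfun n (\<lambda>x. if P x = 0 then sgn (c x) else sgn_top (P x))"
    by (intro cfun_if cfun_pfam_eq_0 cfun_sgn)
  then show ?case by (rule cfun_cong) (simp add: sgn_top_def)
qed (simp add: sgn_top_def cfun_const)

lemma cfun_sgn_bot: "pfam n P \<Longrightarrow> cfun n (\<lambda>x. sgn_bot (P x))"
proof (induction P rule: pfam.induct)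
  case (pCons c P)
  then have "cfun n (\<lambda>x. if P x = 0 then sgn (c x) else 0 - sgn_bot (P x))"
    by (intro cfun_if cfun_pfam_eq_0 cfun_sgn cfun_diff cfun_const)
  then show ?case by (rule cfun_cong) (simp add: sgn_bot_def)
qed (simp add: sgn_bot_def cfun_const)

text \<open>After writing \<open>f\<close> as a combination of signs, each sum over roots is a
  Cauchy index. The value 0 replaces the sum where \<open>G x\<close> is the zero polynomial and
  every real is a root.\<close>

lemma cfun_sum_roots:
  fixes f :: "real list \<Rightarrow> real"
  assumes "pfam n G" "cfun (Suc n) f"
  shows "cfun n (\<lambda>x. if G x = 0 then 0 else \<Sum>t | poly (G x) t = 0. f (x @ [t]))"
proof -
  obtain L where L: "\<forall>(c, q)\<in>set L. poly_fun (Suc n) q"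
    "\<forall>x\<in>Rn (Suc n). f x = (\<Sum>(c, q)\<leftarrow>L. c * sgn (q x))"
    using cfun_real_representation[OF assms(2)] by blast
  have one: "cfun n (\<lambda>x. if G x = 0 then 0 else \<Sum>t | poly (G x) t = 0. sgn (q (x @ [t])))"
    if q: "poly_fun (Suc n) q" for q
  proof -
    obtain Q where Q: "pfam n Q" "\<forall>x\<in>Rn n. \<forall>t. q (x @ [t]) = poly (Q x) t"
      using poly_fun_pfam[OF q] by blast
    have "cfun n (\<lambda>x. if G x = 0 then 0 else index (G x) (pderiv (G x) * Q x))"
      using assms(1) Q(1)
      by (intro cfun_if cfun_index cfun_pfam_eq_0 cfun_const pfam_mult pfam_pderiv)
    then show ?thesis by (rule cfun_cong) (auto simp: Q(2) sum_sgn_roots)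
  qed
  have "cfun n (\<lambda>x. if G x = 0 then 0 else \<Sum>t | poly (G x) t = 0. \<Sum>(c, q)\<leftarrow>L. c * sgn (q (x @ [t])))"
    using L(1)
  proof (induction L)
    case (Cons a L)
    obtain c q where a: "a = (c, q)" by fastforce
    have "cfun n (\<lambda>x. c * (if G x = 0 then 0 else \<Sum>t | poly (G x) t = 0. sgn (q (x @ [t])))
      + (if G x = 0 then 0 else \<Sum>t | poly (G x) t = 0. \<Sum>(c, q)\<leftarrow>L. c * sgn (q (x @ [t]))))"
      using Cons a by (intro cfun_add cfun_mult cfun_const one) auto
    then show ?case by (rule cfun_cong) (auto simp: a sum.distrib sum_distrib_left)
  next
    case Nil
    show ?case using cfun_const[of n "0 :: real"] by (simp cong: if_cong)
  qed
  then show ?thesis by (rule cfun_cong) (auto simp: L(2) Rn_def)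
qed

text \<open>Such a root exists exactly when the number of such roots, a sum over roots of an
  indicator, is nonzero.\<close>

lemma cfun_ex_root:
  assumes "pfam n G" "cfun (Suc n) P"
  shows "cfun n (\<lambda>x. G x \<noteq> 0 \<and> (\<exists>t. poly (G x) t = 0 \<and> P (x @ [t])))"
proof -
  have "cfun (Suc n) (\<lambda>x. of_bool (P x) :: real)" using assms(2) by (rule cfun_map)
  from cfun_sum_roots[OF assms(1) this]
  have "cfun n (\<lambda>x. (if G x = 0 then 0 else \<Sum>t | poly (G x) t = 0. of_bool (P (x @ [t])) :: real) \<noteq> 0)"
    by (rule cfun_map)
  then show ?thesis
  proof (rule cfun_cong)
    fix x
    have "(\<Sum>t | poly (G x) t = 0. of_bool (P (x @ [t])) :: real) = 0 \<longleftrightarrow>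
        (\<forall>t\<in>{t. poly (G x) t = 0}. of_bool (P (x @ [t])) = (0 :: real))" if "G x \<noteq> 0"
      using poly_roots_finite[OF that] by (intro sum_nonneg_eq_0_iff) auto
    then show "((if G x = 0 then 0 else \<Sum>t | poly (G x) t = 0. of_bool (P (x @ [t])) :: real) \<noteq> 0) =
        (G x \<noteq> 0 \<and> (\<exists>t. poly (G x) t = 0 \<and> P (x @ [t])))" by auto
  qed
qed

subsection \<open>Projections of semi-algebraic sets\<close>

text \<open>Quantifier elimination by sample points. The truth of \<open>P\<close> depends only on
  the signs of the polynomials, hence is constant between neighbouring roots. The unbounded pieces
  are decided by the signs at infinity. A bounded gap between a root of \<open>p\<close> and a root
  of \<open>q\<close> contains a critical point of p * q by Rolle's theorem.\<close>

lemma ex_iff_sample: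
  fixes P :: "real \<Rightarrow> bool" and ps :: "real poly list"
  assumes P: "\<And>u v. (\<And>p. p \<in> set ps \<Longrightarrow> sgn (poly p u) = sgn (poly p v)) \<Longrightarrow> P u = P v"
    and top: "\<And>u. (\<And>p. p \<in> set ps \<Longrightarrow> sgn (poly p u) = sgn_top p) \<Longrightarrow> P u = Pt"
    and bot: "\<And>u. (\<And>p. p \<in> set ps \<Longrightarrow> sgn (poly p u) = sgn_bot p) \<Longrightarrow> P u = Pb"
  shows "(\<exists>t. P t) \<longleftrightarrow> Pt \<or> Pb \<or> (\<exists>p\<in>set ps. p \<noteq> 0 \<and> (\<exists>t. poly p t = 0 \<and> P t)) \<or>
    (\<exists>p\<in>set ps. \<exists>q\<in>set ps. pderiv (p * q) \<noteq> 0 \<and> (\<exists>t. poly (pderiv (p * q)) t = 0 \<and> P t))"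
    (is "?L \<longleftrightarrow> ?R")
proof -
  define Z where "Z = (\<Union>p\<in>{p \<in> set ps. p \<noteq> 0}. {t. poly p t = 0})"
  have fin: "finite Z" unfolding Z_def by (auto intro: poly_roots_finite)
  have Z: "poly p t \<noteq> 0" if "p \<in> set ps" "p \<noteq> 0" "t \<notin> Z" for p t
    using that by (auto simp: Z_def)
  have far_top: "P u = Pt" if "\<forall>t\<in>Z. t < u" for u
  proof (rule top)
    fix p assume p: "p \<in> set ps"
    show "sgn (poly p u) = sgn_top p"
    proof (cases "p = 0")
      case False
      then have "poly p t \<noteq> 0" if "u \<le> t" for t
        using Z[OF p False, of t] that \<open>\<forall>t\<in>Z. t < u\<close> by force
      then show ?thesis by (rule sgn_poly_eq_sgn_top)
    qed (simp add: sgn_top_def)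
  qed
  have far_bot: "P u = Pb" if "\<forall>t\<in>Z. u < t" for u
  proof (rule bot)
    fix p assume p: "p \<in> set ps"
    show "sgn (poly p u) = sgn_bot p"
    proof (cases "p = 0")
      case False
      then have "poly p t \<noteq> 0" if "t \<le> u" for t
        using Z[OF p False, of t] that \<open>\<forall>t\<in>Z. u < t\<close> by force
      then show ?thesis by (rule sgn_poly_eq_sgn_bot)
    qed (simp add: sgn_bot_def)
  qed
  have ends: ?L if "Pt \<or> Pb"
  proof -
    \<comment> \<open>Inserting 0 covers the case without any roots.\<close>
    have "\<forall>t\<in>Z. t < Max (insert 0 Z) + 1" "\<forall>t\<in>Z. Min (insert 0 Z) - 1 < t"
      using fin Max_ge[of "insert 0 Z"] Min_le[of "insert 0 Z"]
      by (auto intro!: le_less_trans[OF _ less_add_one] simp: diff_less_eq)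
    then have "P (Max (insert 0 Z) + 1) = Pt" "P (Min (insert 0 Z) - 1) = Pb"
      using far_top far_bot by blast+
    then show ?L using that by blast
  qed
  have fwd: "?R" if t: "P t" for t
  proof (cases "t \<in> Z")
    case True
    then show ?thesis using t by (auto simp: Z_def)
  next
    case False
    show ?thesis
    proof (cases "(\<forall>u\<in>Z. u < t) \<or> (\<forall>u\<in>Z. t < u)")
      case True
      then have "Pt \<or> Pb" using t far_top[of t] far_bot[of t] by auto
      then show ?thesis by (elim disjE) simp_all
    next
      case mid: False
      define a where "a = Max {u\<in>Z. u < t}"
      define b where "b = Min {u\<in>Z. t < u}"
      have ne: "{u\<in>Z. u < t} \<noteq> {}" "{u\<in>Z. t < u} \<noteq> {}"
      proof -
        obtain u v where uv: "u \<in> Z" "\<not> u < t" "v \<in> Z" "\<not> t < v" using mid by auto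
        then have "u \<noteq> t" "v \<noteq> t" using \<open>t \<notin> Z\<close> by auto
        with uv have "t < u" "v < t" by auto
        with uv show "{u\<in>Z. u < t} \<noteq> {}" "{u\<in>Z. t < u} \<noteq> {}" by auto
      qed
      have "a \<in> {u\<in>Z. u < t}" unfolding a_def using fin ne by (intro Max_in) auto
      then have a: "a \<in> Z" "a < t" by auto
      have "b \<in> {u\<in>Z. t < u}" unfolding b_def using fin ne by (intro Min_in) auto
      then have b: "b \<in> Z" "t < b" by auto
      have gap: "u \<notin> Z" if "a < u" "u < b" for u
      proof
        assume u: "u \<in> Z"
        then have "u \<noteq> t" using \<open>t \<notin> Z\<close> by auto
        then consider "u < t" | "t < u" by linarith
        then show False
        proof cases
          case 1
          then have "u \<le> a" unfolding a_def using fin u by (intro Max_ge) auto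
          with that show False by simp
        next
          case 2
          then have "b \<le> u" unfolding b_def using fin u by (intro Min_le) auto
          with that show False by simp
        qed
      qed
      obtain p q where pq: "p \<in> set ps" "q \<in> set ps" "p \<noteq> 0" "q \<noteq> 0" "poly p a = 0" "poly q b = 0"
        using a(1) b(1) by (auto simp: Z_def)
      \<comment> \<open>The product vanishes at both ends of the gap, even if the two roots belong
        to different polynomials.\<close>
      obtain z where z: "a < z" "z < b" "poly (pderiv (p * q)) z = 0"
        using poly_MVT[of a b "p * q"] a(2) b(2) pq by auto
      have "pderiv (p * q) \<noteq> 0"
      proof
        assume "pderiv (p * q) = 0"
        then have "degree (p * q) = 0" by (simp add: pderiv_eq_0_iff)
        then obtain c where "p * q = [:c:]" by (rule degree_eq_zeroE)
        moreover have "poly (p * q) a = 0" using pq by simp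
        ultimately have "p * q = 0" by simp
        then show False using pq by simp
      qed
      moreover have "P z = P t"
      proof (rule P)
        fix r assume r: "r \<in> set ps"
        show "sgn (poly r z) = sgn (poly r t)"
        proof (cases "r = 0")
          case False
          have nz: "poly r s \<noteq> 0" if "a < s" "s < b" for s
            using Z[OF r False gap[OF that]] .
          show ?thesis
          proof (cases "z \<le> t")
            case True
            then show ?thesis using nz z a b by (intro sgn_poly_const_on) auto
          next
            case False
            then have "sgn (poly r t) = sgn (poly r z)" using nz z a b by (intro sgn_poly_const_on) auto
            then show ?thesis by simp
          qed
        qed simp
      qed
      ultimately show ?thesis using pq z t by blast
    qed
  qed
  show ?thesis
  proof
    assume ?L
    then obtain t where "P t" ..
    then show ?R by (rule fwd)
  next
    assume ?R
    then show ?L by (elim disjE bexE conjE exE) (use ends in auto)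
  qed
qed

text \<open>The Tarski-Seidenberg theorem. In the last variable, \<open>P\<close> is a function of
  the signs of finitely many polynomials; all sample points of \<open>ex_iff_sample\<close> other
  than those at infinity are roots of polynomial families, and these are handled by
  \<open>cfun_ex_root\<close>.\<close>

lemma cfun_ex_last:
  assumes "cfun (Suc n) P"
  shows "cfun n (\<lambda>x. \<exists>t. P (x @ [t]))"
proof -
  have "cfun (Suc n) (\<lambda>x. of_bool (P x) :: real)" using assms by (rule cfun_map)
  from cfun_real_representation[OF this] obtain L where L: "\<forall>(c, q)\<in>set L. poly_fun (Suc n) q"
    "\<forall>x\<in>Rn (Suc n). (of_bool (P x) :: real) = (\<Sum>(c, q)\<leftarrow>L. c * sgn (q x))"
    by blast
  define F where "F q = (SOME Q. pfam n Q \<and> (\<forall>x\<in>Rn n. \<forall>t. q (x @ [t]) = poly (Q x) t))" for q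
  have F: "pfam n (F q) \<and> (\<forall>x\<in>Rn n. \<forall>t. q (x @ [t]) = poly (F q x) t)" if q: "poly_fun (Suc n) q" for q
    unfolding F_def by (rule someI_ex[OF poly_fun_pfam[OF q]])
  define K where "K = map (\<lambda>(c, q). (c, F q)) L"
  have K: "pfam n Q" if "(c, Q) \<in> set K" for c Q
    using that F L(1) by (auto simp: K_def)
  have KP: "of_bool (P (x @ [t])) = (\<Sum>(c, Q)\<leftarrow>K. c * sgn (poly (Q x) t))" if "x \<in> Rn n" for x t
  proof -
    have "x @ [t] \<in> Rn (Suc n)" using that by (simp add: Rn_def)
    then have "of_bool (P (x @ [t])) = (\<Sum>(c, q)\<leftarrow>L. c * sgn (q (x @ [t])))" using L(2) by blast
    also have "\<dots> = (\<Sum>(c, Q)\<leftarrow>K. c * sgn (poly (Q x) t))"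
      unfolding K_def map_map using F L(1) that
      by (intro arg_cong[of _ _ sum_list] map_cong) auto
    finally show ?thesis .
  qed
  \<comment> \<open>The combination of signs takes the values 0 and 1 of the indicator of
    \<open>P\<close>; substituting the signs at infinity gives the truth value of \<open>P\<close>
    far out.\<close>
  define Pt where "Pt x \<longleftrightarrow> (\<Sum>(c, Q)\<leftarrow>K. c * sgn_top (Q x)) = 1" for x
  define Pb where "Pb x \<longleftrightarrow> (\<Sum>(c, Q)\<leftarrow>K. c * sgn_bot (Q x)) = 1" for x
  have iff: "(\<exists>t. P (x @ [t])) \<longleftrightarrow> Pt x \<or> Pb x \<or>
      (\<exists>i\<in>set K. snd i x \<noteq> 0 \<and> (\<exists>t. poly (snd i x) t = 0 \<and> P (x @ [t]))) \<or>
      (\<exists>i\<in>set K. \<exists>j\<in>set K. pderiv (snd i x * snd j x) \<noteq> 0 \<and>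
        (\<exists>t. poly (pderiv (snd i x * snd j x)) t = 0 \<and> P (x @ [t])))"
    if x: "x \<in> Rn n" for x
  proof -
    let ?ps = "map (\<lambda>i. snd i x) K"
    have eq: "(of_bool (P (x @ [t])) :: real) = (\<Sum>(c, Q)\<leftarrow>K. c * g (Q x))"
      if *: "\<And>p. p \<in> set ?ps \<Longrightarrow> sgn (poly p t) = g p" for t g
    proof -
      have "(case i of (c, Q) \<Rightarrow> c * sgn (poly (Q x) t)) = (case i of (c, Q) \<Rightarrow> c * g (Q x))"
        if i: "i \<in> set K" for i
      proof -
        have "snd i x \<in> set ?ps" using i by simp
        then have "sgn (poly (snd i x) t) = g (snd i x)" by (rule *)
        then show ?thesis by (simp add: case_prod_unfold)
      qed
      then show ?thesis unfolding KP[OF x] by (intro arg_cong[of _ _ sum_list] map_cong refl)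
    qed
    have "(\<exists>t. P (x @ [t])) \<longleftrightarrow> Pt x \<or> Pb x \<or>
      (\<exists>p\<in>set ?ps. p \<noteq> 0 \<and> (\<exists>t. poly p t = 0 \<and> P (x @ [t]))) \<or>
      (\<exists>p\<in>set ?ps. \<exists>q\<in>set ?ps. pderiv (p * q) \<noteq> 0 \<and> (\<exists>t. poly (pderiv (p * q)) t = 0 \<and> P (x @ [t])))"
    proof (rule ex_iff_sample)
      fix u v assume "\<And>p. p \<in> set ?ps \<Longrightarrow> sgn (poly p u) = sgn (poly p v)"
      from eq[of u "\<lambda>p. sgn (poly p v)", OF this] have "(of_bool (P (x @ [u])) :: real) = of_bool (P (x @ [v]))"
        unfolding KP[OF x] .
      then show "P (x @ [u]) = P (x @ [v])" by (simp add: of_bool_eq_iff)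
    next
      fix u assume "\<And>p. p \<in> set ?ps \<Longrightarrow> sgn (poly p u) = sgn_top p"
      from eq[of u sgn_top, OF this] show "P (x @ [u]) = Pt x" unfolding Pt_def by (cases "P (x @ [u])") auto
    next
      fix u assume "\<And>p. p \<in> set ?ps \<Longrightarrow> sgn (poly p u) = sgn_bot p"
      from eq[of u sgn_bot, OF this] show "P (x @ [u]) = Pb x" unfolding Pb_def by (cases "P (x @ [u])") auto
    qed
    then show ?thesis by simp
  qed
  have snd: "pfam n (snd i)" if "i \<in> set K" for i using K that by (cases i) auto
  have "cfun n Pt" unfolding Pt_def
    by (intro cfun_eq cfun_const cfun_sum_list) (auto intro!: cfun_mult cfun_const cfun_sgn_top K)
  moreover have "cfun n Pb" unfolding Pb_def
    by (intro cfun_eq cfun_const cfun_sum_list) (auto intro!: cfun_mult cfun_const cfun_sgn_bot K)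
  moreover have "cfun n (\<lambda>x. \<exists>i\<in>set K. snd i x \<noteq> 0 \<and> (\<exists>t. poly (snd i x) t = 0 \<and> P (x @ [t])))"
    by (intro cfun_Bex cfun_ex_root snd assms) auto
  moreover have "cfun n (\<lambda>x. \<exists>i\<in>set K. \<exists>j\<in>set K. pderiv (snd i x * snd j x) \<noteq> 0 \<and>
        (\<exists>t. poly (pderiv (snd i x * snd j x)) t = 0 \<and> P (x @ [t])))"
    by (intro cfun_Bex cfun_ex_root[OF pfam_pderiv[OF pfam_mult]] snd assms) auto
  ultimately have "cfun n (\<lambda>x. Pt x \<or> Pb x \<or>
      (\<exists>i\<in>set K. snd i x \<noteq> 0 \<and> (\<exists>t. poly (snd i x) t = 0 \<and> P (x @ [t]))) \<or>
      (\<exists>i\<in>set K. \<exists>j\<in>set K. pderiv (snd i x * snd j x) \<noteq> 0 \<and>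
        (\<exists>t. poly (pderiv (snd i x * snd j x)) t = 0 \<and> P (x @ [t]))))"
    by (intro cfun_disj)
  then show ?thesis by (rule cfun_cong) (simp only: iff)
qed

subsection \<open>Piecewise constant functions and their Schanuel integrals\<close>

text \<open>Two points are compared only if the closed interval between them misses
  \<open>S\<close>. This avoids naming the components of the complement and leaves the values on
  \<open>S\<close> free.\<close>

definition pwc :: "(real \<Rightarrow> 'a) \<Rightarrow> bool" where
  "pwc f \<longleftrightarrow> (\<exists>S. finite S \<and> (\<forall>u v. u \<le> v \<longrightarrow> {u..v} \<inter> S = {} \<longrightarrow> f u = f v))"

lemma pwc_const: "pwc (\<lambda>t. c)"
  by (auto simp: pwc_def)

lemma pwc_map2: 
  assumes "pwc f" "pwc g" shows "pwc (\<lambda>t. F (f t) (g t))"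
proof -
  from assms obtain S T where "finite S" "\<forall>u v. u \<le> v \<longrightarrow> {u..v} \<inter> S = {} \<longrightarrow> f u = f v"
    "finite T" "\<forall>u v. u \<le> v \<longrightarrow> {u..v} \<inter> T = {} \<longrightarrow> g u = g v" unfolding pwc_def by blast
  then show ?thesis unfolding pwc_def
    by (intro exI[of _ "S \<union> T"]) (auto simp: Int_Un_distrib)
qed

lemma pwc_map: "pwc f \<Longrightarrow> pwc (\<lambda>t. F (f t))"
  using pwc_map2[of f f "\<lambda>a b. F a"] .

lemma pwc_sgn_poly: "pwc (\<lambda>t. sgn (poly p t))"
proof (cases "p = 0")
  case False
  show ?thesis unfolding pwc_def
  proof (intro exI[of _ "{t. poly p t = 0}"] conjI allI impI)
    show "finite {t. poly p t = 0}" using False by (rule poly_roots_finite)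
    fix u v assume "u \<le> v" "{u..v} \<inter> {t. poly p t = 0} = {}"
    then show "sgn (poly p u) = sgn (poly p v)" by (intro sgn_poly_const_on) auto
  qed
qed (simp add: pwc_const)

lemma pwc_eventually_right:
  assumes "pwc f" shows "\<exists>c. \<forall>\<^sub>F t in at_right a. f t = c"
proof -
  obtain S where S: "finite S" "\<And>u v. u \<le> v \<Longrightarrow> {u..v} \<inter> S = {} \<Longrightarrow> f u = f v"
    using assms unfolding pwc_def by blast
  have "\<forall>\<^sub>F t in at_right a. \<not> (a < s \<and> s \<le> t)" for s
    by (cases "a < s") (auto simp: eventually_at_right_field not_le)
  then have "\<forall>\<^sub>F t in at_right a. \<forall>s\<in>S. \<not> (a < s \<and> s \<le> t)"
    using S(1) by (simp add: eventually_ball_finite_distrib)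
  then obtain b where b: "b > a" "\<And>t s. a < t \<Longrightarrow> t < b \<Longrightarrow> s \<in> S \<Longrightarrow> \<not> (a < s \<and> s \<le> t)"
    unfolding eventually_at_right_field by blast
  have eq: "f u = f v" if "a < u" "u \<le> v" "v < b" for u v
    using that b(2)[of v] by (intro S(2)) auto
  obtain m where m: "a < m" "m < b" using b(1) dense by blast
  have "f t = f m" if "a < t" "t < b" for t
  proof (cases "t \<le> m")
    case True
    then show ?thesis using eq[of t m] that m by simp
  next
    case False
    then show ?thesis using eq[of m t] that m by simp
  qed
  then show ?thesis unfolding eventually_at_right_field using b(1) by blast
qed

text \<open>The reflection transfers results on right neighbourhoods and +infinity to left
  neighbourhoods and -infinity.\<close>

lemma pwc_uminus: assumes "pwc f" shows "pwc (\<lambda>t. f (- t))"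
proof -
  obtain S where S: "finite S" "\<And>u v. u \<le> v \<Longrightarrow> {u..v} \<inter> S = {} \<Longrightarrow> f u = f v"
    using assms unfolding pwc_def by blast
  show ?thesis unfolding pwc_def
  proof (intro exI[of _ "uminus ` S"] conjI allI impI)
    fix u v :: real assume "u \<le> v" "{u..v} \<inter> uminus ` S = {}"
    then have "{-v..-u} \<inter> S = {}" by (auto simp: disjoint_iff image_iff) (metis add.inverse_inverse minus_le_iff neg_le_iff_le)
    with \<open>u \<le> v\<close> S(2)[of "-v" "-u"] show "f (- u) = f (- v)" by simp
  qed (use S(1) in simp)
qed

lemma pwc_eventually_left:
  assumes "pwc f" shows "\<exists>c. \<forall>\<^sub>F t in at_left a. f t = c"
  using pwc_eventually_right[OF pwc_uminus[OF assms], of "- a"]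
  by (simp add: at_left_minus[of a] eventually_filtermap)

lemma pwc_eventually_top:
  assumes "pwc f" shows "\<exists>c. \<forall>\<^sub>F t in at_top. f t = c"
proof -
  obtain S where S: "finite S" "\<And>u v. u \<le> v \<Longrightarrow> {u..v} \<inter> S = {} \<Longrightarrow> f u = f v"
    using assms unfolding pwc_def by blast
  obtain M where M: "\<And>s. s \<in> S \<Longrightarrow> s < M"
    using S(1) by (metis bdd_above_finite bdd_above_def gt_ex le_less_trans)
  have "f t = f M" if "t \<ge> M" for t
    using M that by (intro S(2)[symmetric]) fastforce+
  then show ?thesis unfolding eventually_at_top_linorder by blast
qed

lemma pwc_eventually_bot:
  assumes "pwc f" shows "\<exists>c. \<forall>\<^sub>F t in at_bot. f t = c"
  using pwc_eventually_top[OF pwc_uminus[OF assms]]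
  by (simp add: at_bot_mirror eventually_filtermap)

section \<open>The Schanuel integral of piecewise constant functions of one variable\<close>

lemma Lim_eventually_eq:
  fixes f :: "'a \<Rightarrow> 'b::t2_space"
  shows "F \<noteq> bot \<Longrightarrow> \<forall>\<^sub>F t in F. f t = c \<Longrightarrow> Lim F f = c"
  by (intro tendsto_Lim tendsto_eventually)

definition sch_term :: "(real \<Rightarrow> real) \<Rightarrow> real \<Rightarrow> real" where
  "sch_term f x = f x - 1/2 * Lim (at_left x) f - 1/2 * Lim (at_right x) f"

lemma schanuel_integral1_eq:
  "schanuel_integral1 f = Sum_any (sch_term f) - 1/2 * Lim at_top f - 1/2 * Lim at_bot f"
  by (simp add: schanuel_integral1_def sch_term_def[abs_def])

lemma pwc_Lim_right: "pwc f \<Longrightarrow> \<forall>\<^sub>F t in at_right a. f t = Lim (at_right a) f" for f :: "real \<Rightarrow> real"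
  using pwc_eventually_right[of f a] Lim_eventually_eq[of "at_right a" f] by auto

lemma pwc_Lim_left: "pwc f \<Longrightarrow> \<forall>\<^sub>F t in at_left a. f t = Lim (at_left a) f" for f :: "real \<Rightarrow> real"
  using pwc_eventually_left[of f a] Lim_eventually_eq[of "at_left a" f] by auto

lemma pwc_Lim_top: "pwc f \<Longrightarrow> \<forall>\<^sub>F t in at_top. f t = Lim at_top f" for f :: "real \<Rightarrow> real"
  using pwc_eventually_top[of f] Lim_eventually_eq[of "at_top" f] by auto

lemma pwc_Lim_bot: "pwc f \<Longrightarrow> \<forall>\<^sub>F t in at_bot. f t = Lim at_bot f" for f :: "real \<Rightarrow> real"
  using pwc_eventually_bot[of f] Lim_eventually_eq[of "at_bot" f] by auto

lemma sch_term_eq_0: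
  assumes "\<forall>\<^sub>F t in at a. f t = f a" shows "sch_term f a = 0"
proof -
  have "Lim (at_left a) f = f a" "Lim (at_right a) f = f a"
    using assms by (auto intro!: Lim_eventually_eq simp: eventually_at_split)
  then show ?thesis by (simp add: sch_term_def)
qed

lemma pwc_finite_sch_term:
  assumes "pwc f" shows "finite {a. sch_term f a \<noteq> 0}"
proof -
  obtain S where S: "finite S" "\<And>u v. u \<le> v \<Longrightarrow> {u..v} \<inter> S = {} \<Longrightarrow> f u = f v"
    using assms unfolding pwc_def by blast
  have "sch_term f a = 0" if "a \<notin> S" for a
  proof (rule sch_term_eq_0)
    obtain d where d: "d > 0" "\<forall>s\<in>S. s \<noteq> a \<longrightarrow> d \<le> dist a s"
      using finite_set_avoid[OF S(1)] by metis
    have "f t = f a" if "dist t a < d" for t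
    proof (cases "t \<le> a")
      case True
      then show ?thesis using that d(2) \<open>a \<notin> S\<close> by (intro S(2)) (fastforce simp: dist_real_def)+
    next
      case False
      then show ?thesis using that d(2) \<open>a \<notin> S\<close> by (intro S(2)[symmetric]) (fastforce simp: dist_real_def)+
    qed
    then show "\<forall>\<^sub>F t in at a. f t = f a" unfolding eventually_at using d(1) by blast
  qed
  then have "{a. sch_term f a \<noteq> 0} \<subseteq> S" by auto
  then show ?thesis using S(1) finite_subset by blast
qed

text \<open>These limits are values that are eventually attained, so they commute with an arbitrary
  \<open>F\<close>.\<close>

lemma Lim_pwc_map2:
  fixes f g :: "real \<Rightarrow> real"
  assumes "pwc f" "pwc g"
  shows "Lim (at_right a) (\<lambda>t. F (f t) (g t) :: real) = F (Lim (at_right a) f) (Lim (at_right a) g)"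
    "Lim (at_left a) (\<lambda>t. F (f t) (g t) :: real) = F (Lim (at_left a) f) (Lim (at_left a) g)"
    "Lim at_top (\<lambda>t. F (f t) (g t) :: real) = F (Lim at_top f) (Lim at_top g)"
    "Lim at_bot (\<lambda>t. F (f t) (g t) :: real) = F (Lim at_bot f) (Lim at_bot g)"
  using eventually_conj[OF pwc_Lim_right[OF assms(1), of a] pwc_Lim_right[OF assms(2), of a]]
    eventually_conj[OF pwc_Lim_left[OF assms(1), of a] pwc_Lim_left[OF assms(2), of a]]
    eventually_conj[OF pwc_Lim_top[OF assms(1)] pwc_Lim_top[OF assms(2)]]
    eventually_conj[OF pwc_Lim_bot[OF assms(1)] pwc_Lim_bot[OF assms(2)]]
  by (auto intro!: Lim_eventually_eq elim!: eventually_mono)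

lemma schanuel_integral1_add:
  assumes "pwc f" "pwc g"
  shows "schanuel_integral1 (\<lambda>t. f t + g t) = schanuel_integral1 f + schanuel_integral1 g"
proof -
  have "sch_term (\<lambda>t. f t + g t) = (\<lambda>a. sch_term f a + sch_term g a)"
    by (rule ext) (simp add: sch_term_def Lim_pwc_map2(1,2)[OF assms, of _ "(+)"] field_simps)
  then show ?thesis
    by (simp add: schanuel_integral1_eq Lim_pwc_map2(3,4)[OF assms, of "(+)"] field_simps
        Sum_any.distrib[OF pwc_finite_sch_term[OF assms(1)] pwc_finite_sch_term[OF assms(2)]])
qed

lemma schanuel_integral1_cmult:
  assumes "pwc f"
  shows "schanuel_integral1 (\<lambda>t. c * f t) = c * schanuel_integral1 f"
proof -
  have "sch_term (\<lambda>t. c * f t) = (\<lambda>a. c * sch_term f a)"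
    by (rule ext) (simp add: sch_term_def Lim_pwc_map2(1,2)[OF assms assms, of _ "\<lambda>a b. c * a"] field_simps)
  then show ?thesis
    by (simp add: schanuel_integral1_eq Lim_pwc_map2(3,4)[OF assms assms, of "\<lambda>a b. c * a"] algebra_simps
        Sum_any_right_distrib[OF pwc_finite_sch_term[OF assms]])
qed

lemma schanuel_integral1_diff:
  assumes "pwc f" "pwc g"
  shows "schanuel_integral1 (\<lambda>t. f t - g t) = schanuel_integral1 f - schanuel_integral1 g"
  using schanuel_integral1_add[OF assms(1) pwc_map[OF assms(2), of "\<lambda>c. - 1 * c"]]
    schanuel_integral1_cmult[OF assms(2), of "- 1"] by simp

lemma schanuel_integral1_const: "schanuel_integral1 (\<lambda>t. c) = - c"
proof -
  have "Lim (at_right a) (\<lambda>t. c) = c" "Lim (at_left a) (\<lambda>t. c) = c" "Lim at_top (\<lambda>t::real. c) = c"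
    "Lim at_bot (\<lambda>t::real. c) = c" for a :: real by (auto intro!: Lim_eventually_eq)
  then show ?thesis by (simp add: schanuel_integral1_eq sch_term_def)
qed

text \<open>Only \<open>a\<close> contributes to the sum, with f a - l/2 - r/2, and the values at
  infinity subtract l/2 and r/2 once more.\<close>

lemma schanuel_integral1_single_break:
  assumes "\<And>t. t < a \<Longrightarrow> f t = l" "\<And>t. a < t \<Longrightarrow> f t = r"
  shows "pwc f" "schanuel_integral1 f = f a - l - r"
proof -
  show "pwc f" unfolding pwc_def
    by (rule exI[of _ "{a}"]) (use assms in \<open>force simp: not_le\<close>)
  have L: "Lim (at_left a) f = l" "Lim (at_right a) f = r" "Lim at_top f = r" "Lim at_bot f = l"
    using eventually_mono[OF eventually_gt_at_top[of a], of "\<lambda>t. f t = r"]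
      eventually_mono[OF eventually_gt_at_bot[of a], of "\<lambda>t. f t = l"] assms
    by (auto intro!: Lim_eventually_eq simp: eventually_at_filter)
  have "sch_term f t = 0" if "t \<noteq> a" for t
  proof (rule sch_term_eq_0)
    have "\<forall>\<^sub>F u in at t. dist u t < dist t a"
      using that by (auto simp: eventually_at intro!: exI[of _ "dist t a"])
    then show "\<forall>\<^sub>F u in at t. f u = f t"
    proof (rule eventually_mono)
      fix u assume "dist u t < dist t a"
      then show "f u = f t" using assms[of u] assms[of t] that
        by (cases "t < a") (auto simp: dist_real_def abs_if split: if_splits)
    qed
  qed
  then have "Sum_any (sch_term f) = sum (sch_term f) {a}"
    by (intro Sum_any.expand_superset) auto
  then show "schanuel_integral1 f = f a - l - r"
    by (simp add: schanuel_integral1_eq L) (simp add: sch_term_def L)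
qed

lemma schanuel_integral1_point: "schanuel_integral1 (\<lambda>t. of_bool (t = a)) = 1"
  using schanuel_integral1_single_break[of a "\<lambda>t. of_bool (t = a)" 0 0] by simp

section \<open>Integrals over open intervals\<close>

lemma open_real_no_extremum:
  fixes S :: "real set"
  assumes "open S" "x \<in> S"
  shows "\<exists>y\<in>S. x < y" "\<exists>y\<in>S. y < x"
proof -
  obtain e where "e > 0" "ball x e \<subseteq> S" using assms open_contains_ball by blast
  then have "x + e/2 \<in> S" "x - e/2 \<in> S" by (auto simp: dist_real_def subset_iff)
  with \<open>e > 0\<close> show "\<exists>y\<in>S. x < y" "\<exists>y\<in>S. y < x"
    by (auto intro: bexI[of _ "x + e/2"] bexI[of _ "x - e/2"])
qed

lemma open_interval_cases:
  fixes S :: "real set"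
  assumes "open S" "is_interval S"
  shows "S = {} \<or> S = UNIV \<or> (\<exists>b. S = {..<b}) \<or> (\<exists>a. S = {a<..}) \<or> (\<exists>a b. a < b \<and> S = {a<..<b})"
proof -
  have "x \<in> S" if "a \<in> S" "b \<in> S" "a \<le> x" "x \<le> b" for a b x
    using assms(2) that by (meson is_interval_1)
  then have "\<exists>a b. S = {} \<or> S = UNIV \<or> S = {..<b} \<or> S = {..b} \<or> S = {a<..} \<or> S = {a..} \<or>
     S = {a<..<b} \<or> S = {a<..b} \<or> S = {a..<b} \<or> S = {a..b}"
    by (rule interval_cases)
  then obtain a b where
    ab: "S = {} \<or> S = UNIV \<or> S = {..<b} \<or> S = {..b} \<or> S = {a<..} \<or> S = {a..} \<or>
     S = {a<..<b} \<or> S = {a<..b} \<or> S = {a..<b} \<or> S = {a..b}" by (elim exE)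
  note ext = open_real_no_extremum(1)[OF assms(1), of b] open_real_no_extremum(2)[OF assms(1), of a]
  from ab show ?thesis
  proof (elim disjE)
    assume "S = {a<..<b}"
    then show ?thesis by (cases "a < b") auto
  next
    assume S: "S = {a<..b}"
    then show ?thesis using ext(1) by (cases "a < b") auto
  next
    assume S: "S = {a..<b}"
    then show ?thesis using ext(2) by (cases "a < b") auto
  next
    assume S: "S = {a..b}"
    then show ?thesis using ext by (cases "a \<le> b") auto
  qed (use ext in auto)
qed

text \<open>The value is the same for bounded and unbounded intervals, so it survives monotone
  reparametrisation. A bounded interval is an open ray, of integral -1, minus a closed ray, of
  integral 0.\<close>

lemma schanuel_integral1_open_interval:
  assumes "open S" "is_interval S" "S \<noteq> {}"
  shows "schanuel_integral1 (\<lambda>t. of_bool (t \<in> S)) = - 1"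
proof -
  have lt: "pwc (\<lambda>t. of_bool (t < b) :: real)" "schanuel_integral1 (\<lambda>t. of_bool (t < b)) = - 1" for b
    using schanuel_integral1_single_break[of b "\<lambda>t. of_bool (t < b)" 1 0] by auto
  have le: "pwc (\<lambda>t. of_bool (t \<le> b) :: real)" "schanuel_integral1 (\<lambda>t. of_bool (t \<le> b)) = 0" for b
    using schanuel_integral1_single_break[of b "\<lambda>t. of_bool (t \<le> b)" 1 0] by auto
  have gt: "schanuel_integral1 (\<lambda>t. of_bool (b < t)) = - 1" for b
    using schanuel_integral1_single_break[of b "\<lambda>t. of_bool (b < t)" 0 1] by auto
  from open_interval_cases[OF assms(1,2)] consider "S = UNIV" | b where "S = {..<b}" | a where "S = {a<..}"
    | a b where "a < b" "S = {a<..<b}" using assms(3) by auto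
  then show ?thesis
  proof cases
    case (4 a b)
    then have "(\<lambda>t. of_bool (t \<in> S)) = (\<lambda>t. of_bool (t < b) - of_bool (t \<le> a) :: real)"
      by (auto simp: fun_eq_iff)
    then show ?thesis using schanuel_integral1_diff[OF lt(1)[of b] le(1)[of a]] lt le by simp
  qed (use lt gt schanuel_integral1_const[of 1] in auto)
qed

subsection \<open>Fibre integrals of functions with semi-algebraic level sets\<close>

lemma map_nth_upt_take: "n \<le> length z \<Longrightarrow> map ((!) z) [0..<n] = take n z"
  by (rule nth_equalityI) auto

lemma append_Rn: "x \<in> Rn n \<Longrightarrow> x @ [t] \<in> Rn (Suc n)"
  by (simp add: Rn_def)

lemma cfun_coords:
  assumes "cfun k f" "length is = k" "\<And>i. i \<in> set is \<Longrightarrow> i < m"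
  shows "cfun m (\<lambda>z. f (map ((!) z) is))"
  using cfun_preimage[of k f "map (\<lambda>i z. z ! i) is" m] assms
  by (auto simp: comp_def intro: poly_fun.coord)

lemma cfun_take_nth:
  assumes "cfun (Suc n) f" "n \<le> m" "i < m"
  shows "cfun m (\<lambda>z. f (take n z @ [z ! i]))"
proof -
  have "cfun m (\<lambda>z. f (map ((!) z) ([0..<n] @ [i])))"
    using assms by (intro cfun_coords) auto
  then show ?thesis
    by (rule cfun_cong) (use assms in \<open>simp add: map_nth_upt_take Rn_def\<close>)
qed

lemma cfun_ex:
  assumes "cfun (Suc n) (\<lambda>y. P (take n y) (y ! n))"
  shows "cfun n (\<lambda>x. \<exists>t. P x t)"
  using cfun_ex_last[OF assms] by (rule cfun_cong) (simp add: Rn_def nth_append)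

lemma cfun_all:
  assumes "cfun (Suc n) (\<lambda>y. P (take n y) (y ! n))"
  shows "cfun n (\<lambda>x. \<forall>t. P x t)"
  using cfun_not[OF cfun_ex[OF cfun_not[OF assms]]] by simp

lemma cfun_coord_less: "i < n \<Longrightarrow> j < n \<Longrightarrow> cfun n (\<lambda>x. x ! i < x ! j)"
  by (intro cfun_less poly_fun.coord)

text \<open>Unfolded, the eventuality is a bound \<open>d\<close> followed by a universal quantifier
  over points below it, and both quantifiers are eliminated by projection.\<close>

lemma cfun_eventually_right:
  assumes "cfun (Suc n) P"
  shows "cfun (Suc n) (\<lambda>y. \<forall>\<^sub>F u in at_right (y ! n). P (take n y @ [u]))"
proof -
  \<comment> \<open>The coordinates from \<open>n\<close> on are the base point, the bound
    \<open>d\<close> and the bound variable \<open>u\<close>.\<close>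
  have "cfun (Suc (Suc (Suc n))) (\<lambda>z. z ! n < z ! Suc (Suc n) \<longrightarrow> z ! Suc (Suc n) < z ! Suc n \<longrightarrow>
      P (take n z @ [z ! Suc (Suc n)]))"
    by (intro cfun_imp cfun_coord_less cfun_take_nth assms) auto
  then have "cfun (Suc (Suc n)) (\<lambda>z. \<forall>u. z ! n < u \<longrightarrow> u < z ! Suc n \<longrightarrow> P (take n z @ [u]))"
    by (intro cfun_all) simp
  then have "cfun (Suc (Suc n)) (\<lambda>z. z ! n < z ! Suc n \<and>
      (\<forall>u. z ! n < u \<longrightarrow> u < z ! Suc n \<longrightarrow> P (take n z @ [u])))"
    by (intro cfun_conj cfun_coord_less) auto
  then have "cfun (Suc n) (\<lambda>y. \<exists>d. y ! n < d \<and> (\<forall>u. y ! n < u \<longrightarrow> u < d \<longrightarrow> P (take n y @ [u])))"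
    by (intro cfun_ex) simp
  then show ?thesis by (simp add: eventually_at_right_field)
qed

lemma cfun_eventually_left:
  assumes "cfun (Suc n) P"
  shows "cfun (Suc n) (\<lambda>y. \<forall>\<^sub>F u in at_left (y ! n). P (take n y @ [u]))"
proof -
  have "cfun (Suc (Suc (Suc n))) (\<lambda>z. z ! Suc n < z ! Suc (Suc n) \<longrightarrow> z ! Suc (Suc n) < z ! n \<longrightarrow>
      P (take n z @ [z ! Suc (Suc n)]))"
    by (intro cfun_imp cfun_coord_less cfun_take_nth assms) auto
  then have "cfun (Suc (Suc n)) (\<lambda>z. \<forall>u. z ! Suc n < u \<longrightarrow> u < z ! n \<longrightarrow> P (take n z @ [u]))"
    by (intro cfun_all) simp
  then have "cfun (Suc (Suc n)) (\<lambda>z. z ! Suc n < z ! n \<and>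
      (\<forall>u. z ! Suc n < u \<longrightarrow> u < z ! n \<longrightarrow> P (take n z @ [u])))"
    by (intro cfun_conj cfun_coord_less) auto
  then have "cfun (Suc n) (\<lambda>y. \<exists>d. d < y ! n \<and> (\<forall>u. d < u \<longrightarrow> u < y ! n \<longrightarrow> P (take n y @ [u])))"
    by (intro cfun_ex) simp
  then show ?thesis by (simp add: eventually_at_left_field)
qed

lemma pwc_sum_list: "(\<And>i. i \<in> set xs \<Longrightarrow> pwc (f i)) \<Longrightarrow> pwc (\<lambda>t. \<Sum>i\<leftarrow>xs. f i t :: real)"
proof (induction xs)
  case (Cons i xs)
  then show ?case using pwc_map2[of "f i" "\<lambda>t. \<Sum>i\<leftarrow>xs. f i t" "(+)"] by simp
qed (simp add: pwc_const)

lemma pwc_fibre_sgn: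
  assumes "poly_fun (Suc n) q" "x \<in> Rn n"
  shows "pwc (\<lambda>t. sgn (q (x @ [t])))"
proof -
  obtain Q where "\<forall>x\<in>Rn n. \<forall>t. q (x @ [t]) = poly (Q x) t"
    using poly_fun_pfam[OF assms(1)] by blast
  then show ?thesis using assms(2) by (simp add: pwc_sgn_poly)
qed

lemma pwc_fibre_real:
  fixes f :: "real list \<Rightarrow> real"
  assumes "cfun (Suc n) f" "x \<in> Rn n"
  shows "pwc (\<lambda>t. f (x @ [t]))"
proof -
  obtain L where L: "\<forall>(c, q)\<in>set L. poly_fun (Suc n) q"
    "\<forall>x\<in>Rn (Suc n). f x = (\<Sum>(c, q)\<leftarrow>L. c * sgn (q x))"
    using cfun_real_representation[OF assms(1)] by blast
  have "pwc (\<lambda>t. \<Sum>i\<leftarrow>L. fst i * sgn (snd i (x @ [t])))"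
  proof (rule pwc_sum_list)
    fix i assume "i \<in> set L"
    then have "poly_fun (Suc n) (snd i)" using L(1) by auto
    from pwc_map[OF pwc_fibre_sgn[OF this assms(2)], of "\<lambda>v. fst i * v"]
    show "pwc (\<lambda>t. fst i * sgn (snd i (x @ [t])))" .
  qed
  then show ?thesis using L(2) append_Rn[OF assms(2)] by (simp add: case_prod_unfold)
qed

text \<open>The finitely many values are coded injectively by numbers, which reduces to the
  real-valued case; tuples of data are treated this way later.\<close>

lemma pwc_fibre:
  assumes "cfun (Suc n) f" "x \<in> Rn n"
  shows "pwc (\<lambda>t. f (x @ [t]))"
proof -
  have "finite (f ` Rn (Suc n))" using assms by (simp add: cfun_def)
  then obtain e :: "'a \<Rightarrow> nat" where e: "inj_on e (f ` Rn (Suc n))"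
    using finite_imp_inj_to_nat_seg by metis
  have "cfun (Suc n) (\<lambda>y. real (e (f y)))" using assms(1) by (rule cfun_map)
  from pwc_fibre_real[OF this assms(2)] obtain S where "finite S"
    "\<And>u v. u \<le> v \<Longrightarrow> {u..v} \<inter> S = {} \<Longrightarrow> e (f (x @ [u])) = e (f (x @ [v]))"
    unfolding pwc_def by auto
  moreover have "f (x @ [u]) = f (x @ [v])" if "e (f (x @ [u])) = e (f (x @ [v]))" for u v
    using e that append_Rn[OF assms(2)] by (auto dest: inj_onD)
  ultimately show ?thesis unfolding pwc_def by (intro exI[of _ S]) simp
qed

text \<open>On a fibre, a one-sided limit is a value attained on a whole one-sided neighbourhood. It
  therefore lies in the finite range of \<open>f\<close>, and having a given limit is an eventuality
  of the kind treated above.\<close>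

lemma cfun_Lim_fibre:
  fixes f :: "real list \<Rightarrow> real"
  assumes "cfun (Suc n) f"
  shows "cfun (Suc n) (\<lambda>y. Lim (at_right (y ! n)) (\<lambda>u. f (take n y @ [u])))" (is "cfun _ ?R")
    and "cfun (Suc n) (\<lambda>y. Lim (at_left (y ! n)) (\<lambda>u. f (take n y @ [u])))" (is "cfun _ ?L")
proof -
  have fin: "finite (f ` Rn (Suc n))" using assms by (simp add: cfun_def)
  have tk: "take n y \<in> Rn n" if "y \<in> Rn (Suc n)" for y :: "real list" using that by (simp add: Rn_def)
  have R: "\<forall>\<^sub>F u in at_right (y ! n). f (take n y @ [u]) = ?R y" if "y \<in> Rn (Suc n)" for y
    by (rule pwc_Lim_right[OF pwc_fibre_real[OF assms tk[OF that]]])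
  have L: "\<forall>\<^sub>F u in at_left (y ! n). f (take n y @ [u]) = ?L y" if "y \<in> Rn (Suc n)" for y
    by (rule pwc_Lim_left[OF pwc_fibre_real[OF assms tk[OF that]]])
  have "?R y \<in> f ` Rn (Suc n)" if y: "y \<in> Rn (Suc n)" for y
      proof -
    obtain u where "f (take n y @ [u]) = ?R y" using eventually_happens'[OF _ R[OF y]] by auto
    then show ?thesis using append_Rn[OF tk[OF y], of u] by (metis image_eqI)
  qed
  then have finR: "finite (?R ` Rn (Suc n))" by (intro finite_subset[OF image_subsetI fin])
  have "?L y \<in> f ` Rn (Suc n)" if y: "y \<in> Rn (Suc n)" for y
      proof -
    obtain u where "f (take n y @ [u]) = ?L y" using eventually_happens'[OF _ L[OF y]] by auto
    then show ?thesis using append_Rn[OF tk[OF y], of u] by (metis image_eqI)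
  qed
  then have finL: "finite (?L ` Rn (Suc n))" by (intro finite_subset[OF image_subsetI fin])
  have lR: "?R y = c \<longleftrightarrow> (\<forall>\<^sub>F u in at_right (y ! n). f (take n y @ [u]) = c)" if "y \<in> Rn (Suc n)" for y c
    using R[OF that] Lim_eventually_eq[of "at_right (y ! n)"] by auto
  have lL: "?L y = c \<longleftrightarrow> (\<forall>\<^sub>F u in at_left (y ! n). f (take n y @ [u]) = c)" if "y \<in> Rn (Suc n)" for y c
    using L[OF that] Lim_eventually_eq[of "at_left (y ! n)"] by auto
  have "cfun (Suc n) (\<lambda>y. ?R y = c)" for c
    by (rule cfun_cong[OF cfun_eventually_right[OF cfun_eq[OF assms cfun_const[of _ c]]]]) (simp only: lR)
  then show "cfun (Suc n) ?R" using finR by (simp add: cfun_def[of _ ?R] cfun_iff_pred)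
  have "cfun (Suc n) (\<lambda>y. ?L y = c)" for c
    by (rule cfun_cong[OF cfun_eventually_left[OF cfun_eq[OF assms cfun_const[of _ c]]]]) (simp only: lL)
  then show "cfun (Suc n) ?L" using finL by (simp add: cfun_def[of _ ?L] cfun_iff_pred)
qed

lemma cfun_sch_term:
  fixes f :: "real list \<Rightarrow> real"
  assumes "cfun (Suc n) f"
  shows "cfun (Suc n) (\<lambda>y. sch_term (\<lambda>u. f (take n y @ [u])) (y ! n))"
  unfolding sch_term_def
  by (intro cfun_diff cfun_mult cfun_const cfun_Lim_fibre assms cfun_take_nth) auto

text \<open>All jumps of the sign of \<open>q\<close> on a fibre lie at roots, so the sum over all
  reals in the integral is a sum over the roots, and the limits at infinity are
  \<open>sgn_top\<close> and \<open>sgn_bot\<close>. On a fibre where \<open>q\<close> vanishes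
  identically every term is 0.\<close>

lemma cfun_integral_sgn:
  assumes "poly_fun (Suc n) q"
  shows "cfun n (\<lambda>x. schanuel_integral1 (\<lambda>t. sgn (q (x @ [t]))))"
proof -
  obtain Q where Q: "pfam n Q" "\<forall>x\<in>Rn n. \<forall>t. q (x @ [t]) = poly (Q x) t"
    using poly_fun_pfam[OF assms] by blast
  define w where "w y = sch_term (\<lambda>u. sgn (q (take n y @ [u]))) (y ! n)" for y
  have w: "cfun (Suc n) w"
    unfolding w_def using cfun_sch_term[OF cfun_sgn[OF assms]] .
  have "cfun n (\<lambda>x. (if Q x = 0 then 0 else \<Sum>t | poly (Q x) t = 0. w (x @ [t]))
    - 1/2 * sgn_top (Q x) - 1/2 * sgn_bot (Q x))"
    by (intro cfun_diff cfun_mult cfun_const cfun_sum_roots cfun_sgn_top cfun_sgn_bot w Q(1))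
  then show ?thesis
  proof (rule cfun_cong)
    fix x assume x: "x \<in> Rn n"
    define p where "p = Q x"
    have q: "q (x @ [t]) = poly p t" for t using Q(2) x by (simp add: p_def)
    have wx: "w (x @ [t]) = sch_term (\<lambda>u. sgn (poly p u)) t" for t
      using x by (simp add: w_def q Rn_def nth_append)
    have top: "Lim at_top (\<lambda>u. sgn (poly p u)) = sgn_top p" and bot: "Lim at_bot (\<lambda>u. sgn (poly p u)) = sgn_bot p"
    proof -
      have "\<forall>\<^sub>F u in at_top. sgn (poly p u) = sgn_top p \<and> sgn (poly p (- u)) = sgn_bot p"
      proof (cases "p = 0")
        case False
        then have fin: "finite {t. poly p t = 0}" by (rule poly_roots_finite)
        \<comment> \<open>A bound for the absolute values of all roots; 0 is inserted for the case
          that there are none.\<close>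
        define M where "M = Max (insert 0 (abs ` {t. poly p t = 0}))"
        have M: "\<bar>t\<bar> \<le> M" if "poly p t = 0" for t
          using fin that unfolding M_def by (intro Max_ge) auto
        have "sgn (poly p u) = sgn_top p \<and> sgn (poly p (- u)) = sgn_bot p" if "u > M" for u
        proof
          show "sgn (poly p u) = sgn_top p"
            using M that by (intro sgn_poly_eq_sgn_top) force
          show "sgn (poly p (- u)) = sgn_bot p"
            using M that by (intro sgn_poly_eq_sgn_bot) force
        qed
        then show ?thesis unfolding eventually_at_top_dense by blast
      qed (simp add: sgn_top_def sgn_bot_def)
      then have ev: "\<forall>\<^sub>F u in at_top. sgn (poly p u) = sgn_top p"
        "\<forall>\<^sub>F u in at_top. sgn (poly p (- u)) = sgn_bot p" by (auto elim: eventually_mono)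
      from ev(2) have "\<forall>\<^sub>F u in at_bot. sgn (poly p u) = sgn_bot p"
        by (simp add: at_bot_mirror eventually_filtermap)
      with ev(1) show "Lim at_top (\<lambda>u. sgn (poly p u)) = sgn_top p" "Lim at_bot (\<lambda>u. sgn (poly p u)) = sgn_bot p"
        by (auto intro!: Lim_eventually_eq)
    qed
    have "Sum_any (sch_term (\<lambda>u. sgn (poly p u))) =
        (if p = 0 then 0 else \<Sum>t | poly p t = 0. sch_term (\<lambda>u. sgn (poly p u)) t)"
    proof (cases "p = 0")
      case True
      then show ?thesis by (simp add: sch_term_eq_0)
    next
      case False
      have "sch_term (\<lambda>u. sgn (poly p u)) a = 0" if "poly p a \<noteq> 0" for a
      proof (rule sch_term_eq_0)
        show "\<forall>\<^sub>F u in at a. sgn (poly p u) = sgn (poly p a)"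
        proof -
          have "isCont (poly p) a" by simp
          then have "(poly p \<longlongrightarrow> poly p a) (at a)" by (simp add: isCont_def)
          note lim = order_tendstoD[OF this, of 0]
          show ?thesis
          proof (cases "poly p a > 0")
            case True
            show ?thesis using lim(1)[OF True] by (rule eventually_mono) (use True in simp)
          next
            case False
            then have neg: "poly p a < 0" using that by simp
            show ?thesis using lim(2)[OF neg] by (rule eventually_mono) (use neg in simp)
          qed
        qed
      qed
      then show ?thesis using False poly_roots_finite[OF False]
        by (auto intro!: Sum_any.expand_superset)
    qed
    then show "(if Q x = 0 then 0 else \<Sum>t | poly (Q x) t = 0. w (x @ [t]))
        - 1/2 * sgn_top (Q x) - 1/2 * sgn_bot (Q x) = schanuel_integral1 (\<lambda>t. sgn (q (x @ [t])))"
      by (simp add: schanuel_integral1_eq wx q top bot flip: p_def)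
  qed
qed

lemma cfun_integral:
  fixes f :: "real list \<Rightarrow> real"
  assumes "cfun (Suc n) f"
  shows "cfun n (\<lambda>x. schanuel_integral1 (\<lambda>t. f (x @ [t])))"
proof -
  obtain L where L: "\<forall>(c, q)\<in>set L. poly_fun (Suc n) q"
    "\<forall>x\<in>Rn (Suc n). f x = (\<Sum>(c, q)\<leftarrow>L. c * sgn (q x))"
    using cfun_real_representation[OF assms] by blast
  have "cfun n (\<lambda>x. schanuel_integral1 (\<lambda>t. \<Sum>i\<leftarrow>L. fst i * sgn (snd i (x @ [t]))))"
    using L(1)
  proof (induction L)
    case (Cons i L)
    have q: "poly_fun (Suc n) (snd i)" and qs: "\<And>j. j \<in> set L \<Longrightarrow> poly_fun (Suc n) (snd j)"
      using Cons.prems by auto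
    have "cfun n (\<lambda>x. schanuel_integral1 (\<lambda>t. \<Sum>i\<leftarrow>L. fst i * sgn (snd i (x @ [t]))))"
      using Cons.IH Cons.prems by simp
    then have "cfun n (\<lambda>x. fst i * schanuel_integral1 (\<lambda>t. sgn (snd i (x @ [t])))
        + schanuel_integral1 (\<lambda>t. \<Sum>i\<leftarrow>L. fst i * sgn (snd i (x @ [t]))))"
      by (intro cfun_add cfun_mult cfun_const cfun_integral_sgn q)
    then show ?case
    proof (rule cfun_cong)
      fix x assume x: "x \<in> Rn n"
      have p: "pwc (\<lambda>t. c * sgn (r (x @ [t])))" if "poly_fun (Suc n) r" for c r
        using pwc_map[OF pwc_fibre_sgn[OF that x], of "\<lambda>v. c * v"] .
      show "fst i * schanuel_integral1 (\<lambda>t. sgn (snd i (x @ [t])))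
        + schanuel_integral1 (\<lambda>t. \<Sum>i\<leftarrow>L. fst i * sgn (snd i (x @ [t]))) =
        schanuel_integral1 (\<lambda>t. \<Sum>i\<leftarrow>i # L. fst i * sgn (snd i (x @ [t])))"
        using schanuel_integral1_add[OF p[OF q, of "fst i"] pwc_sum_list[of L, OF p[OF qs]]]
          schanuel_integral1_cmult[OF pwc_fibre_sgn[OF q x], of "fst i"] by simp
    qed
  qed (simp add: cfun_const)
  then show ?thesis
    by (rule cfun_cong) (use L(2) append_Rn in \<open>simp add: case_prod_unfold\<close>)
qed

subsection \<open>Locally monotone functions\<close>

lemma uncountable_open_real: "open S \<Longrightarrow> x \<in> S \<Longrightarrow> uncountable S" for S :: "real set"
proof -
  assume "open S" "x \<in> S"
  then obtain e where e: "e > 0" "ball x e \<subseteq> S" using open_contains_ball by blast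
  then have "uncountable (ball x e)" by (simp add: uncountable_ball)
  then show ?thesis using e(2) countable_subset by blast
qed

text \<open>Bisection of the compact interval turns a transitive relation that holds near every
  point into a global one. It will be used for =, < and >.\<close>

lemma locally_related_imp_related:
  fixes \<xi> :: "real \<Rightarrow> 'a"
  assumes R: "\<And>u v w. R u v \<Longrightarrow> R v w \<Longrightarrow> R u w"
    and right: "\<And>s. a \<le> s \<Longrightarrow> s \<le> b \<Longrightarrow> \<forall>\<^sub>F t in at_right s. R (\<xi> s) (\<xi> t)"
    and left: "\<And>s. a \<le> s \<Longrightarrow> s \<le> b \<Longrightarrow> \<forall>\<^sub>F t in at_left s. R (\<xi> t) (\<xi> s)"
    and "a < b"
  shows "R (\<xi> a) (\<xi> b)"
proof -
  \<comment> \<open>Bolzano's principle also asks for degenerate intervals, where a strict relation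
    fails; the reflexive closure admits them.\<close>
  define P where "P u v \<longleftrightarrow> u = v \<or> R (\<xi> u) (\<xi> v)" for u v
  have "a \<le> b" using \<open>a < b\<close> by simp
  then have "P a b"
  proof (induction rule: Bolzano)
    case (trans u v w)
    then show ?case using R[of "\<xi> u" "\<xi> v" "\<xi> w"] unfolding P_def by auto
  next
    case (local s)
    obtain r where r: "r > s" "\<And>t. s < t \<Longrightarrow> t < r \<Longrightarrow> R (\<xi> s) (\<xi> t)"
      using right[OF local] unfolding eventually_at_right_field by auto
    obtain l where l: "l < s" "\<And>t. l < t \<Longrightarrow> t < s \<Longrightarrow> R (\<xi> t) (\<xi> s)"
      using left[OF local] unfolding eventually_at_left_field by auto
    define d where "d = min (r - s) (s - l)"
    have "P u v" if "u \<le> s" "s \<le> v" "v - u < d" for u v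
    proof -
      have "u = s \<or> R (\<xi> u) (\<xi> s)"
        using l(2)[of u] that by (cases "u = s") (auto simp: d_def)
      moreover have "v = s \<or> R (\<xi> s) (\<xi> v)"
        using r(2)[of v] that by (cases "v = s") (auto simp: d_def)
      ultimately show ?thesis using R[of "\<xi> u" "\<xi> s" "\<xi> v"] unfolding P_def by auto
    qed
    then show ?case using r(1) l(1) by (intro exI[of _ d]) (auto simp: d_def)
  qed
  with \<open>a < b\<close> show ?thesis unfolding P_def by simp
qed

text \<open>Each such point is the strict maximum on some interval with rational ends around it. Two
  points with the same interval would each have the larger value, so the choice of interval is
  injective.\<close>

lemma countable_strict_local_max:
  fixes \<xi> :: "real \<Rightarrow> real"
  shows "countable {s. (\<forall>\<^sub>F t in at_left s. \<xi> t < \<xi> s) \<and> (\<forall>\<^sub>F t in at_right s. \<xi> t < \<xi> s)}" (is "countable ?M")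
proof -
  have "\<exists>p q :: rat. of_rat p < s \<and> s < of_rat q \<and> (\<forall>t. of_rat p < t \<longrightarrow> t < of_rat q \<longrightarrow> t \<noteq> s \<longrightarrow> \<xi> t < \<xi> s)"
    if "s \<in> ?M" for s
  proof -
    from that have ev: "\<forall>\<^sub>F t in at_left s. \<xi> t < \<xi> s" "\<forall>\<^sub>F t in at_right s. \<xi> t < \<xi> s" by auto
    obtain l where l: "l < s" "\<And>t. l < t \<Longrightarrow> t < s \<Longrightarrow> \<xi> t < \<xi> s"
      using ev(1) unfolding eventually_at_left_field by auto
    obtain r where r: "s < r" "\<And>t. s < t \<Longrightarrow> t < r \<Longrightarrow> \<xi> t < \<xi> s"
      using ev(2) unfolding eventually_at_right_field by auto
    obtain p where p: "l < of_rat p" "of_rat p < s" using of_rat_dense[OF l(1)] by auto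
    obtain q where q: "s < of_rat q" "of_rat q < r" using of_rat_dense[OF r(1)] by auto
    have "\<xi> t < \<xi> s" if "of_rat p < t" "t < of_rat q" "t \<noteq> s" for t
      using l(2)[of t] r(2)[of t] that p q by (cases "t < s") auto
    with p q show ?thesis by (intro exI[of _ p] exI[of _ q]) auto
  qed
  then have "\<forall>s\<in>?M. \<exists>pq :: rat \<times> rat. of_rat (fst pq) < s \<and> s < of_rat (snd pq) \<and>
      (\<forall>t. of_rat (fst pq) < t \<longrightarrow> t < of_rat (snd pq) \<longrightarrow> t \<noteq> s \<longrightarrow> \<xi> t < \<xi> s)"
    by fastforce
  from bchoice[OF this] obtain g :: "real \<Rightarrow> rat \<times> rat" where
    g: "\<forall>s\<in>?M. of_rat (fst (g s)) < s \<and> s < of_rat (snd (g s)) \<and>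
      (\<forall>t. of_rat (fst (g s)) < t \<longrightarrow> t < of_rat (snd (g s)) \<longrightarrow> t \<noteq> s \<longrightarrow> \<xi> t < \<xi> s)" ..
  have "inj_on g ?M"
  proof (rule inj_onI, rule ccontr)
    fix s t assume st: "s \<in> ?M" "t \<in> ?M" "g s = g t" "s \<noteq> t"
    note gs = bspec[OF g st(1)] and gt = bspec[OF g st(2), folded st(3)]
    have "\<xi> t < \<xi> s" using conjunct2[OF conjunct2[OF gs], rule_format, of t] gt st(4) by simp
    moreover have "\<xi> s < \<xi> t" using conjunct2[OF conjunct2[OF gt], rule_format, of s] gs st(4) by simp
    ultimately show False by simp
  qed
  then show ?thesis by (rule countableI')
qed

definition const_or_mono :: "(real \<Rightarrow> real) \<Rightarrow> real set \<Rightarrow> bool" where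
  "const_or_mono \<xi> I \<longleftrightarrow> (\<forall>s\<in>I. \<forall>t\<in>I. \<xi> s = \<xi> t) \<or>
    continuous_on I \<xi> \<and> ((\<forall>s\<in>I. \<forall>t\<in>I. s < t \<longrightarrow> \<xi> s < \<xi> t) \<or> (\<forall>s\<in>I. \<forall>t\<in>I. s < t \<longrightarrow> \<xi> t < \<xi> s))"

text \<open>The germs are -1, 0 or 1. If just one of them were 0, a neighbouring point would have
  different germs; if both were 1 or both -1, every point of the uncountable \<open>I\<close> would
  be a strict local extremum. Three pairs remain.\<close>

lemma const_or_mono_if_germs_const:
  fixes \<xi> :: "real \<Rightarrow> real"
  assumes I: "open I" "is_interval I"
    and right: "\<And>s. s \<in> I \<Longrightarrow> \<forall>\<^sub>F t in at_right s. sgn (\<xi> t - \<xi> s) = r"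
    and left: "\<And>s. s \<in> I \<Longrightarrow> \<forall>\<^sub>F t in at_left s. sgn (\<xi> t - \<xi> s) = l"
    and cont: "(\<forall>s\<in>I. isCont \<xi> s) \<or> (\<forall>s\<in>I. \<not> isCont \<xi> s)"
  shows "const_or_mono \<xi> I"
proof (cases "I = {}")
  case True
  then show ?thesis by (simp add: const_or_mono_def)
next
  case False
  then obtain s where s: "s \<in> I" by auto
  have sub: "u \<in> I" if "a \<in> I" "b \<in> I" "a \<le> u" "u \<le> b" for a b u
    using I(2) that by (meson is_interval_1)
  have val: "c \<in> {-1, 0, 1}" if "\<forall>\<^sub>F t in F. sgn (\<xi> t - \<xi> s) = c" "F \<noteq> bot" for F c
    using eventually_happens'[OF that(2,1)] by (auto simp: sgn_if split: if_splits)
  have rv: "r \<in> {-1, 0, 1}" and lv: "l \<in> {-1, 0, 1}"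
    using val[OF right[OF s]] val[OF left[OF s]] by simp_all
  have opn: "\<forall>\<^sub>F u in at_right s. u \<in> I" "\<forall>\<^sub>F u in at_left s. u \<in> I"
    using eventually_at_topological I(1) s
    by (auto simp: eventually_at_topological)
  \<comment> \<open>Here the function is constant on a stretch to the right of \<open>s\<close>, and
    a point inside this stretch has left germ 0.\<close>
  have r0: "l = 0" if "r = 0"
  proof -
    have "\<forall>\<^sub>F t in at_right s. \<xi> t = \<xi> s \<and> t \<in> I"
      using eventually_conj[OF right[OF s] opn(1)] by (rule eventually_mono) (simp add: that sgn_eq_0_iff)
    then obtain b where b: "s < b" "\<And>t. s < t \<Longrightarrow> t < b \<Longrightarrow> \<xi> t = \<xi> s \<and> t \<in> I"
      unfolding eventually_at_right_field by auto
    obtain u where u: "s < u" "u < b" using dense[OF b(1)] by auto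
    have "\<forall>\<^sub>F t in at_left u. s < t \<and> t < u"
      using u unfolding eventually_at_left_field by (intro exI[of _ s]) auto
    with left[of u] b(2)[OF u] have "\<forall>\<^sub>F t in at_left u. sgn (\<xi> t - \<xi> u) = l \<and> s < t \<and> t < u"
      by (auto intro: eventually_conj)
    then obtain t where "sgn (\<xi> t - \<xi> u) = l" "s < t" "t < u"
      using eventually_happens'[of "at_left u"] by auto
    then show "l = 0" using b(2)[of t] b(2)[OF u] u by auto
  qed
  have l0: "r = 0" if "l = 0"
  proof -
    have "\<forall>\<^sub>F t in at_left s. \<xi> t = \<xi> s \<and> t \<in> I"
      using eventually_conj[OF left[OF s] opn(2)] by (rule eventually_mono) (simp add: that sgn_eq_0_iff)
    then obtain b where b: "b < s" "\<And>t. b < t \<Longrightarrow> t < s \<Longrightarrow> \<xi> t = \<xi> s \<and> t \<in> I"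
      unfolding eventually_at_left_field by auto
    obtain u where u: "b < u" "u < s" using dense[OF b(1)] by auto
    have "\<forall>\<^sub>F t in at_right u. u < t \<and> t < s"
      using u unfolding eventually_at_right_field by (intro exI[of _ s]) auto
    with right[of u] b(2)[OF u] have "\<forall>\<^sub>F t in at_right u. sgn (\<xi> t - \<xi> u) = r \<and> u < t \<and> t < s"
      by (auto intro: eventually_conj)
    then obtain t where "sgn (\<xi> t - \<xi> u) = r" "u < t" "t < s"
      using eventually_happens'[of "at_right u"] by auto
    then show "r = 0" using b(2)[of t] b(2)[OF u] u by auto
  qed
  have unc: "uncountable I" using uncountable_open_real I(1) s by blast
  have "\<not> (l = -1 \<and> r = -1)"
  proof
    assume lr: "l = -1 \<and> r = -1"
    have lt: "\<xi> t < \<xi> u" if "sgn (\<xi> t - \<xi> u) = -1" for t u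
      using that by (auto simp: sgn_if split: if_splits)
    have "I \<subseteq> {s. (\<forall>\<^sub>F t in at_left s. \<xi> t < \<xi> s) \<and> (\<forall>\<^sub>F t in at_right s. \<xi> t < \<xi> s)}"
    proof (intro subsetI CollectI conjI)
      fix u assume u: "u \<in> I"
      show "\<forall>\<^sub>F t in at_left u. \<xi> t < \<xi> u"
        using left[OF u] by (rule eventually_mono) (simp only: lr lt)
      show "\<forall>\<^sub>F t in at_right u. \<xi> t < \<xi> u"
        using right[OF u] by (rule eventually_mono) (simp only: lr lt)
    qed
    then show False using unc countable_strict_local_max[of \<xi>] countable_subset by blast
  qed
  moreover have "\<not> (l = 1 \<and> r = 1)"
  proof
    assume lr: "l = 1 \<and> r = 1"
    have lt: "- \<xi> t < - \<xi> u" if "sgn (\<xi> t - \<xi> u) = 1" for t u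
      using that by (auto simp: sgn_if split: if_splits)
    have "I \<subseteq> {s. (\<forall>\<^sub>F t in at_left s. - \<xi> t < - \<xi> s) \<and> (\<forall>\<^sub>F t in at_right s. - \<xi> t < - \<xi> s)}"
    proof (intro subsetI CollectI conjI)
      fix u assume u: "u \<in> I"
      show "\<forall>\<^sub>F t in at_left u. - \<xi> t < - \<xi> u"
        using left[OF u] by (rule eventually_mono) (simp only: lr lt)
      show "\<forall>\<^sub>F t in at_right u. - \<xi> t < - \<xi> u"
        using right[OF u] by (rule eventually_mono) (simp only: lr lt)
    qed
    then show False using unc countable_strict_local_max[of "\<lambda>t. - \<xi> t"] countable_subset by blast
  qed
  \<comment> \<open>\<open>l\<close> compares earlier values with the value at the point, so
    increasing functions have l = -1 and r = 1.\<close>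
  ultimately consider "l = 0" "r = 0" | "l = -1" "r = 1" | "l = 1" "r = -1"
    using rv lv r0 l0 by auto
  then show ?thesis
  proof cases
    case 1
    have eq: "\<xi> a = \<xi> b" if "a \<in> I" "b \<in> I" "a < b" for a b
    proof (rule locally_related_imp_related[where R = "(=)" and \<xi> = \<xi> and a = a and b = b])
      fix s assume "a \<le> s" "s \<le> b"
      then have "s \<in> I" using sub that by blast
      note ev = right[OF this] left[OF this]
      show "\<forall>\<^sub>F t in at_right s. \<xi> s = \<xi> t"
        using ev(1) by (rule eventually_mono) (use 1 in \<open>auto simp: sgn_if split: if_splits\<close>)
      show "\<forall>\<^sub>F t in at_left s. \<xi> t = \<xi> s"
        using ev(2) by (rule eventually_mono) (use 1 in \<open>auto simp: sgn_if split: if_splits\<close>)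
    qed (use that in auto)
    have "\<xi> a = \<xi> b" if "a \<in> I" "b \<in> I" for a b
    proof (cases a b rule: linorder_cases)
      case less
      then show ?thesis by (rule eq[OF that])
    next
      case greater
      then show ?thesis by (rule eq[OF that(2,1), symmetric])
    qed simp
    then show ?thesis unfolding const_or_mono_def by (intro disjI1) blast
  next
    case 2
    have inc: "\<xi> a < \<xi> b" if "a \<in> I" "b \<in> I" "a < b" for a b
    proof (rule locally_related_imp_related[where R = "(<)" and \<xi> = \<xi> and a = a and b = b])
      fix s assume "a \<le> s" "s \<le> b"
      then have "s \<in> I" using sub that by blast
      note ev = right[OF this] left[OF this]
      show "\<forall>\<^sub>F t in at_right s. \<xi> s < \<xi> t"
        using ev(1) by (rule eventually_mono) (use 2 in \<open>auto simp: sgn_if split: if_splits\<close>)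
      show "\<forall>\<^sub>F t in at_left s. \<xi> t < \<xi> s"
        using ev(2) by (rule eventually_mono) (use 2 in \<open>auto simp: sgn_if split: if_splits\<close>)
    qed (use that in auto)
    \<comment> \<open>Monotonicity leaves countably many discontinuities, while by
      \<open>cont\<close> they would be all of \<open>I\<close> or none.\<close>
    have "mono_on I \<xi>"
    proof (rule mono_onI)
      fix a b assume "a \<in> I" "b \<in> I" "a \<le> b"
      then show "\<xi> a \<le> \<xi> b" using inc[of a b] by (cases "a = b") auto
    qed
    from mono_on_ctble_discont_open[OF I(1) this] have c: "countable {a \<in> I. \<not> isCont \<xi> a}" .
    have "\<forall>s\<in>I. isCont \<xi> s"
    proof (rule ccontr)
      assume "\<not> ?thesis"
      then have "\<forall>s\<in>I. \<not> isCont \<xi> s" using cont by blast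
      then have "{a \<in> I. \<not> isCont \<xi> a} = I" by auto
      then show False using c unc by simp
    qed
    then show ?thesis using inc unfolding const_or_mono_def by (auto intro: continuous_at_imp_continuous_on)
  next
    case 3
    have dec: "\<xi> b < \<xi> a" if "a \<in> I" "b \<in> I" "a < b" for a b
    proof (rule locally_related_imp_related[where R = "(>)" and \<xi> = \<xi> and a = a and b = b])
      fix s assume "a \<le> s" "s \<le> b"
      then have "s \<in> I" using sub that by blast
      note ev = right[OF this] left[OF this]
      show "\<forall>\<^sub>F t in at_right s. \<xi> s > \<xi> t"
        using ev(1) by (rule eventually_mono) (use 3 in \<open>auto simp: sgn_if split: if_splits\<close>)
      show "\<forall>\<^sub>F t in at_left s. \<xi> t > \<xi> s"
        using ev(2) by (rule eventually_mono) (use 3 in \<open>auto simp: sgn_if split: if_splits\<close>)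
    qed (use that in auto)
    have "mono_on I (\<lambda>t. - \<xi> t)"
    proof (rule mono_onI)
      fix a b assume "a \<in> I" "b \<in> I" "a \<le> b"
      then show "- \<xi> a \<le> - \<xi> b" using dec[of a b] by (cases "a = b") auto
    qed
    from mono_on_ctble_discont_open[OF I(1) this] have c: "countable {a \<in> I. \<not> isCont (\<lambda>t. - \<xi> t) a}" .
    have "\<forall>s\<in>I. isCont \<xi> s"
    proof (rule ccontr)
      assume "\<not> ?thesis"
      with cont have nc: "\<not> isCont \<xi> s" if "s \<in> I" for s using that by blast
      have "\<not> isCont (\<lambda>t. - \<xi> t) s" if "s \<in> I" for s
        using nc[OF that] continuous_minus[of "at s" "\<lambda>t. - \<xi> t"] by auto
      then have "{a \<in> I. \<not> isCont (\<lambda>t. - \<xi> t) a} = I" by auto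
      then show False using c unc by simp
    qed
    then show ?thesis using dec unfolding const_or_mono_def by (auto intro: continuous_at_imp_continuous_on)
  qed
qed

text \<open>The image is connected, and it is open because \<open>I\<close> has points on both sides
  of every \<open>x\<close>, whose images lie on both sides of the image of
  \<open>x\<close>.\<close>

lemma open_interval_image:
  fixes \<xi> :: "real \<Rightarrow> real"
  assumes I: "open I" "is_interval I" and c: "continuous_on I \<xi>"
    and mono: "(\<forall>s\<in>I. \<forall>t\<in>I. s < t \<longrightarrow> \<xi> s < \<xi> t) \<or> (\<forall>s\<in>I. \<forall>t\<in>I. s < t \<longrightarrow> \<xi> t < \<xi> s)"
  shows "open (\<xi> ` I)" "is_interval (\<xi> ` I)"
proof -
  have "connected I" using I(2) by (simp add: is_interval_connected_1)
  then show iv: "is_interval (\<xi> ` I)"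
    using connected_continuous_image[OF c] by (simp add: is_interval_connected_1)
  show "open (\<xi> ` I)"
  proof (subst open_subopen, rule ballI)
    fix y assume "y \<in> \<xi> ` I"
    then obtain x where x: "x \<in> I" "y = \<xi> x" by auto
    obtain x1 x2 where x12: "x1 \<in> I" "x1 < x" "x2 \<in> I" "x < x2"
      using open_real_no_extremum[OF I(1) x(1)] by auto
    have "\<xi> x1 < y \<and> y < \<xi> x2 \<or> \<xi> x2 < y \<and> y < \<xi> x1" using mono x x12 by auto
    then obtain a b where ab: "a \<in> \<xi> ` I" "b \<in> \<xi> ` I" "a < y" "y < b" using x12 by auto
    have "{a<..<b} \<subseteq> \<xi> ` I" using iv ab(1,2) unfolding is_interval_1 by (auto intro: less_imp_le)
    then show "\<exists>T. open T \<and> y \<in> T \<and> T \<subseteq> \<xi> ` I"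
      using ab by (intro exI[of _ "{a<..<b}"]) auto
  qed
qed

lemma open_interval_superlevel:
  fixes \<xi> :: "real \<Rightarrow> real"
  assumes I: "open I" "is_interval I" and c: "continuous_on I \<xi>"
    and mono: "(\<forall>s\<in>I. \<forall>t\<in>I. s < t \<longrightarrow> \<xi> s < \<xi> t) \<or> (\<forall>s\<in>I. \<forall>t\<in>I. s < t \<longrightarrow> \<xi> t < \<xi> s)"
  shows "open {s \<in> I. y < \<xi> s}" "is_interval {s \<in> I. y < \<xi> s}"
proof -
  have "open (I \<inter> \<xi> -` {y<..})" by (rule continuous_open_preimage[OF c I(1)]) simp
  then show "open {s \<in> I. y < \<xi> s}" by (simp add: Int_def vimage_def)
  show "is_interval {s \<in> I. y < \<xi> s}" unfolding is_interval_1
  proof (intro ballI allI impI)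
    fix a b x assume ab: "a \<in> {s \<in> I. y < \<xi> s}" "b \<in> {s \<in> I. y < \<xi> s}" and x: "a \<le> x \<and> x \<le> b"
    have xI: "x \<in> I" using I(2) ab x unfolding is_interval_1 by blast
    have "x = a \<or> x = b \<or> a < x \<and> x < b" using x by auto
    then have "\<xi> a \<le> \<xi> x \<or> \<xi> b \<le> \<xi> x" using mono ab xI by (auto intro: less_imp_le)
    then show "x \<in> {s \<in> I. y < \<xi> s}" using ab xI by auto
  qed
qed

subsection \<open>Fubini's theorem in the plane\<close>

definition cfun1 :: "(real \<Rightarrow> 'a) \<Rightarrow> bool" where
  "cfun1 f \<longleftrightarrow> cfun (Suc 0) (\<lambda>x. f (x ! 0))"

definition cfun2 :: "(real \<Rightarrow> real \<Rightarrow> 'a) \<Rightarrow> bool" where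
  "cfun2 f \<longleftrightarrow> cfun (Suc (Suc 0)) (\<lambda>x. f (x ! 0) (x ! Suc 0))"

lemma cfun1_coord: "cfun1 f \<Longrightarrow> i < m \<Longrightarrow> cfun m (\<lambda>x. f (x ! i))"
  using cfun_coords[of "Suc 0" "\<lambda>x. f (x ! 0)" "[i]" m] by (simp add: cfun1_def)

lemma cfun2_coord: "cfun2 f \<Longrightarrow> i < m \<Longrightarrow> j < m \<Longrightarrow> cfun m (\<lambda>x. f (x ! i) (x ! j))"
  using cfun_coords[of "Suc (Suc 0)" "\<lambda>x. f (x ! 0) (x ! Suc 0)" "[i, j]" m] by (auto simp: cfun2_def)

lemma cfun2_swap: "cfun2 f \<Longrightarrow> cfun2 (\<lambda>s t. f t s)"
  unfolding cfun2_def[of "\<lambda>s t. f t s"] by (rule cfun2_coord) auto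

lemma cfun2_fst: "cfun1 f \<Longrightarrow> cfun2 (\<lambda>s t. f s)"
  and cfun2_snd: "cfun1 f \<Longrightarrow> cfun2 (\<lambda>s t. f t)"
  unfolding cfun2_def by (simp_all add: cfun1_coord)

lemma cfun2_diag: "cfun2 f \<Longrightarrow> cfun1 (\<lambda>s. f s s)"
  unfolding cfun1_def by (rule cfun2_coord) auto

lemma cfun1_map2: "cfun1 f \<Longrightarrow> cfun1 g \<Longrightarrow> cfun1 (\<lambda>s. F (f s) (g s))"
  unfolding cfun1_def by (rule cfun_map2)

lemma cfun2_map2: "cfun2 f \<Longrightarrow> cfun2 g \<Longrightarrow> cfun2 (\<lambda>s t. F (f s t) (g s t))"
  unfolding cfun2_def by (rule cfun_map2)

lemma cfun1_map: "cfun1 f \<Longrightarrow> cfun1 (\<lambda>s. F (f s))"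
  unfolding cfun1_def by (rule cfun_map)

lemma cfun2_map: "cfun2 f \<Longrightarrow> cfun2 (\<lambda>s t. F (f s t))"
  unfolding cfun2_def by (rule cfun_map)

lemma cfun1_const: "cfun1 (\<lambda>s. c)"
  unfolding cfun1_def by (rule cfun_const)

lemma cfun1_ex: "cfun2 P \<Longrightarrow> cfun1 (\<lambda>s. \<exists>t. P s t)"
  unfolding cfun1_def cfun2_def by (rule cfun_ex) simp

lemma cfun1_all: "cfun2 P \<Longrightarrow> cfun1 (\<lambda>s. \<forall>t. P s t)"
  unfolding cfun1_def cfun2_def by (rule cfun_all) simp

lemma cfun2_fibre: assumes "cfun2 f" shows "cfun1 (f s)"
  using cfun_preimage[of "Suc (Suc 0)" "\<lambda>x. f (x ! 0) (x ! Suc 0)" "[\<lambda>x. s, \<lambda>x. x ! 0]" "Suc 0"] assms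
  by (auto simp: cfun1_def cfun2_def intro: poly_fun.intros)

lemma cfun2_fibre': "cfun2 f \<Longrightarrow> cfun1 (\<lambda>s. f s t)"
  using cfun2_fibre[OF cfun2_swap] .

lemma cfun1_eq_const: "cfun1 (\<lambda>s. s = c)"
  and cfun1_less: "cfun1 (\<lambda>s. s < c)" and cfun1_greater: "cfun1 (\<lambda>s. c < s)"
proof -
  show "cfun1 (\<lambda>s. s < c)" "cfun1 (\<lambda>s. c < s)"
    unfolding cfun1_def by (intro cfun_less poly_fun.intros; simp)+
  then have "cfun1 (\<lambda>s. \<not> (s < c) \<and> \<not> (c < s))" by (rule cfun1_map2)
  moreover have "(\<not> (s < c) \<and> \<not> (c < s)) = (s = c)" for s by auto
  ultimately show "cfun1 (\<lambda>s. s = c)" by simp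
qed

lemma cfun1_pwc: "cfun1 f \<Longrightarrow> pwc f"
  using pwc_fibre[of 0 "\<lambda>x. f (x ! 0)" "[]"] by (simp add: cfun1_def Rn_def)

lemma cfun2_pwc: "cfun2 f \<Longrightarrow> pwc (f s)" "cfun2 f \<Longrightarrow> pwc (\<lambda>s. f s t)"
  by (rule cfun1_pwc, erule cfun2_fibre) (rule cfun1_pwc, erule cfun2_fibre')

lemma take_1_append_nth: "y \<in> Rn (Suc (Suc 0)) \<Longrightarrow> (take (Suc 0) y @ [u]) ! 0 = y ! 0"
  "y \<in> Rn (Suc (Suc 0)) \<Longrightarrow> (take (Suc 0) y @ [u]) ! Suc 0 = u"
  by (auto simp: Rn_def nth_append)

lemma cfun1_integral: assumes "cfun2 f" shows "cfun1 (\<lambda>s. schanuel_integral1 (f s))"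
  unfolding cfun1_def using cfun_integral[OF assms[unfolded cfun2_def]]
  by (rule cfun_cong) (simp add: Rn_def nth_append)

lemma cfun2_Lim:
  fixes f :: "real \<Rightarrow> real \<Rightarrow> real"
  assumes "cfun2 f"
  shows "cfun2 (\<lambda>s a. Lim (at_right a) (f s))" "cfun2 (\<lambda>s a. Lim (at_left a) (f s))"
  unfolding cfun2_def
  by (rule cfun_cong[OF cfun_Lim_fibre(1)[OF assms[unfolded cfun2_def]]], simp only: take_1_append_nth)
    (rule cfun_cong[OF cfun_Lim_fibre(2)[OF assms[unfolded cfun2_def]]], simp only: take_1_append_nth)

lemma cfun2_eventually:
  assumes "cfun2 P"
  shows "cfun2 (\<lambda>s a. \<forall>\<^sub>F t in at_right a. P s t)" "cfun2 (\<lambda>s a. \<forall>\<^sub>F t in at_left a. P s t)"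
  unfolding cfun2_def
  by (rule cfun_cong[OF cfun_eventually_right[OF assms[unfolded cfun2_def]]], simp only: take_1_append_nth)
    (rule cfun_cong[OF cfun_eventually_left[OF assms[unfolded cfun2_def]]], simp only: take_1_append_nth)

text \<open>The function \<xi> need not be polynomial; only its graph is known to be semi-algebraic.
  Its value is therefore introduced as an extra coordinate \<open>u\<close>, tied to the graph and
  projected away.\<close>

lemma cfun_subst:
  assumes \<xi>: "cfun2 (\<lambda>s u. u = \<xi> s)" and Q: "cfun (Suc n) (\<lambda>y. Q (take n y) (y ! n))" and "i < n"
  shows "cfun n (\<lambda>x. Q x (\<xi> (x ! i)))"
proof -
  have im: "Q x (\<xi> (x ! i)) \<in> (\<lambda>y. Q (take n y) (y ! n)) ` Rn (Suc n)" if "x \<in> Rn n" for x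
    by (rule image_eqI[of _ _ "x @ [\<xi> (x ! i)]"]) (use that in \<open>auto simp: Rn_def nth_append\<close>)
  have "finite ((\<lambda>y. Q (take n y) (y ! n)) ` Rn (Suc n))" using Q by (simp add: cfun_def)
  then have fin: "finite ((\<lambda>x. Q x (\<xi> (x ! i))) ` Rn n)"
    by (rule finite_subset[rotated]) (rule image_subsetI, rule im)
  have "cfun n (\<lambda>x. \<exists>u. u = \<xi> (x ! i) \<and> Q x u = c)" for c
  proof (rule cfun_ex)
    have "cfun (Suc n) (\<lambda>y. y ! n = \<xi> (y ! i) \<and> Q (take n y) (y ! n) = c)"
      using \<open>i < n\<close> by (intro cfun_conj cfun_eq[OF Q cfun_const] cfun2_coord[OF \<xi>]) auto
    then show "cfun (Suc n) (\<lambda>y. y ! n = \<xi> (take n y ! i) \<and> Q (take n y) (y ! n) = c)"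
      using \<open>i < n\<close> by simp
  qed
  then have "cfun n (\<lambda>x. Q x (\<xi> (x ! i)) = c)" for c by simp
  then show ?thesis using fin by (simp add: cfun_def[of _ "\<lambda>x. Q x (\<xi> (x ! i))"] cfun_iff_pred)
qed

lemma cfun1_subst:
  assumes "cfun2 (\<lambda>s u. u = \<xi> s)" "cfun2 f"
  shows "cfun1 (\<lambda>s. f s (\<xi> s))"
  unfolding cfun1_def using assms
  by (intro cfun_subst[where Q = "\<lambda>x u. f (x ! 0) u"]) (simp_all add: cfun2_def)

lemma cfun2_subst_less:
  assumes "cfun2 (\<lambda>s u. u = \<xi> s)"
  shows "cfun2 (\<lambda>s t. t < \<xi> s)" "cfun2 (\<lambda>s t. \<xi> s < t)"
  unfolding cfun2_def using assms
  by (auto intro!: cfun_subst[where Q = "\<lambda>x u. x ! Suc 0 < u"] cfun_subst[where Q = "\<lambda>x u. u < x ! Suc 0"]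
      cfun_coord_less)

lemma cfun2_sgn_diff:
  assumes "cfun2 (\<lambda>s u. u = \<xi> s)"
  shows "cfun2 (\<lambda>s t. sgn (\<xi> t - \<xi> s))"
proof -
  let ?n = "Suc (Suc (Suc 0))"
  \<comment> \<open>Coordinates 0 and 1 are s and t; coordinates 2 and 3 stand for \<xi> s and \<xi>
    t, and are eliminated in the order 3, 2.\<close>
  have "cfun (Suc ?n) (\<lambda>y. sgn (y ! ?n - y ! Suc (Suc 0)))"
    by (intro cfun_sgn poly_fun_diff poly_fun.coord) auto
  then have "cfun ?n (\<lambda>x. sgn (\<xi> (x ! Suc 0) - x ! Suc (Suc 0)))"
    by (intro cfun_subst[OF assms, where Q = "\<lambda>x u. sgn (u - x ! Suc (Suc 0))"]) simp_all
  then show ?thesis unfolding cfun2_def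
    by (intro cfun_subst[OF assms, where Q = "\<lambda>x u. sgn (\<xi> (x ! Suc 0) - u)"]) simp_all
qed

text \<open>Continuity in terms of order comparisons alone, so that it becomes a quantified
  condition on the graph.\<close>

lemma isCont_iff_order:
  fixes \<xi> :: "real \<Rightarrow> real"
  shows "isCont \<xi> s \<longleftrightarrow> (\<forall>u. (u < \<xi> s \<longrightarrow> (\<forall>\<^sub>F t in at_right s. u < \<xi> t) \<and> (\<forall>\<^sub>F t in at_left s. u < \<xi> t))
    \<and> (\<xi> s < u \<longrightarrow> (\<forall>\<^sub>F t in at_right s. \<xi> t < u) \<and> (\<forall>\<^sub>F t in at_left s. \<xi> t < u)))"
  unfolding isCont_def order_tendsto_iff eventually_at_split by blast

lemma cfun1_isCont:
  assumes "cfun2 (\<lambda>s u. u = \<xi> s)"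
  shows "cfun1 (isCont \<xi>)"
proof -
  note lt = cfun2_subst_less[OF assms]
  note ev = cfun2_eventually[OF cfun2_swap[OF lt(1)]] cfun2_eventually[OF cfun2_swap[OF lt(2)]]
  have "cfun2 (\<lambda>s u. (u < \<xi> s \<longrightarrow> (\<forall>\<^sub>F t in at_right s. u < \<xi> t) \<and> (\<forall>\<^sub>F t in at_left s. u < \<xi> t))
    \<and> (\<xi> s < u \<longrightarrow> (\<forall>\<^sub>F t in at_right s. \<xi> t < u) \<and> (\<forall>\<^sub>F t in at_left s. \<xi> t < u)))"
    using lt ev[THEN cfun2_swap] unfolding cfun2_def by (intro cfun_conj cfun_imp)
  from cfun1_all[OF this] show ?thesis unfolding isCont_iff_order[abs_def] .
qed

text \<open>Coefficient, continuity and both germs are collected in one tuple with finitely many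
  values. Its breakpoints form \<open>S\<close>, and on an open interval that misses
  \<open>S\<close> all these data are constant.\<close>

lemma piecewise_const_or_mono:
  assumes \<xi>: "cfun2 (\<lambda>s u. u = \<xi> s)" and \<phi>: "cfun1 \<phi>"
  shows "\<exists>S. finite S \<and> (\<forall>I. open I \<longrightarrow> is_interval I \<longrightarrow> I \<inter> S = {} \<longrightarrow>
    (\<forall>s\<in>I. \<forall>t\<in>I. \<phi> s = \<phi> t) \<and> const_or_mono \<xi> I)"
proof -
  define \<rho> where "\<rho> s = Lim (at_right s) (\<lambda>t. sgn (\<xi> t - \<xi> s))" for s
  define \<sigma> where "\<sigma> s = Lim (at_left s) (\<lambda>t. sgn (\<xi> t - \<xi> s))" for s
  note sg = cfun2_sgn_diff[OF \<xi>]
  \<comment> \<open>Limits are first taken at a free point \<open>a\<close> of the fibre over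
    \<open>s\<close>; the germs are the diagonal a = s.\<close>
  have germ: "cfun1 \<rho>" "cfun1 \<sigma>"
    using cfun2_diag[OF cfun2_Lim(1)[OF sg]] cfun2_diag[OF cfun2_Lim(2)[OF sg]]
    by (simp_all add: \<rho>_def[abs_def] \<sigma>_def[abs_def])
  have "pwc (\<lambda>s. ((\<phi> s, isCont \<xi> s), (\<rho> s, \<sigma> s)))"
    by (intro cfun1_pwc cfun1_map2[where F = Pair] cfun1_isCont germ \<xi> \<phi>)
  then obtain S where S: "finite S" and eq: "\<And>u v. u \<le> v \<Longrightarrow> {u..v} \<inter> S = {} \<Longrightarrow>
      ((\<phi> u, isCont \<xi> u), (\<rho> u, \<sigma> u)) = ((\<phi> v, isCont \<xi> v), (\<rho> v, \<sigma> v))"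
    unfolding pwc_def by (elim exE conjE) blast
  have H: "(\<forall>s\<in>I. \<forall>t\<in>I. \<phi> s = \<phi> t) \<and> const_or_mono \<xi> I"
    if I: "open I" "is_interval I" and IS: "I \<inter> S = {}" for I
  proof (cases "I = {}")
    case True
    then show ?thesis by (simp add: const_or_mono_def)
  next
    case False
    then obtain a where a: "a \<in> I" by auto
    have eqI: "((\<phi> s, isCont \<xi> s), (\<rho> s, \<sigma> s)) = ((\<phi> a, isCont \<xi> a), (\<rho> a, \<sigma> a))" if s: "s \<in> I" for s
    proof -
      have sub: "{u..v} \<inter> S = {}" if "u \<in> I" "v \<in> I" for u v
      proof (rule equals0I)
        fix w assume w: "w \<in> {u..v} \<inter> S"
        then have "w \<in> I" using I(2)[unfolded is_interval_1, rule_format, OF that, of w] by simp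
        with w IS show False by auto
      qed
      show ?thesis
      proof (cases "s \<le> a")
        case True
        then show ?thesis by (rule eq[OF _ sub[OF s a]])
      next
        case False
        then have "a \<le> s" by simp
        then show ?thesis by (rule eq[OF _ sub[OF a s], symmetric])
      qed
    qed
    have "const_or_mono \<xi> I"
    proof (rule const_or_mono_if_germs_const[OF I])
      fix s assume s: "s \<in> I"
      have "\<rho> s = \<rho> a" "\<sigma> s = \<sigma> a" using eqI[OF s] by auto
      then show "\<forall>\<^sub>F t in at_right s. sgn (\<xi> t - \<xi> s) = \<rho> a" "\<forall>\<^sub>F t in at_left s. sgn (\<xi> t - \<xi> s) = \<sigma> a"
        using pwc_Lim_right[OF cfun2_pwc(1)[OF sg], of s s] pwc_Lim_left[OF cfun2_pwc(1)[OF sg], of s s]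
        by (simp_all add: \<rho>_def \<sigma>_def)
    next
      have "isCont \<xi> s = isCont \<xi> a" if "s \<in> I" for s using eqI[OF that] by simp
      then show "(\<forall>s\<in>I. isCont \<xi> s) \<or> (\<forall>s\<in>I. \<not> isCont \<xi> s)" by blast
    qed
    moreover have "\<phi> s = \<phi> t" if "s \<in> I" "t \<in> I" for s t
      using eqI[OF that(1)] eqI[OF that(2)] by simp
    ultimately show ?thesis by blast
  qed
  show ?thesis by (intro exI[of _ S] conjI[OF S] allI impI) (rule H)
qed

section \<open>Exchange of two one-variable integrals\<close>

definition fubini :: "(real \<Rightarrow> real \<Rightarrow> real) \<Rightarrow> bool" where
  "fubini f \<longleftrightarrow> schanuel_integral1 (\<lambda>s. schanuel_integral1 (\<lambda>t. f s t)) =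
     schanuel_integral1 (\<lambda>t. schanuel_integral1 (\<lambda>s. f s t))"

lemma pwc_integral:
  assumes "cfun2 f"
  shows "pwc (\<lambda>s. schanuel_integral1 (\<lambda>t. f s t))" "pwc (\<lambda>t. schanuel_integral1 (\<lambda>s. f s t))"
  using cfun1_pwc[OF cfun1_integral[OF assms]] cfun1_pwc[OF cfun1_integral[OF cfun2_swap[OF assms]]] by simp_all

lemma fubini_add:
  assumes "cfun2 f" "cfun2 g" "fubini f" "fubini g"
  shows "fubini (\<lambda>s t. f s t + g s t)"
  using assms(3,4) unfolding fubini_def
  by (simp add: schanuel_integral1_add cfun2_pwc assms(1,2) pwc_integral)

lemma fubini_cmult:
  assumes "cfun2 f" "fubini f"
  shows "fubini (\<lambda>s t. c * f s t)"
  using assms(2) unfolding fubini_def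
  by (simp add: schanuel_integral1_cmult cfun2_pwc assms(1) pwc_integral)

lemma fubini_product:
  assumes "cfun1 g" "cfun1 h"
  shows "fubini (\<lambda>s t. g s * h t)"
proof -
  have "schanuel_integral1 (\<lambda>t. g s * h t) = schanuel_integral1 h * g s" for s
    using schanuel_integral1_cmult[OF cfun1_pwc[OF assms(2)], of "g s"] by (simp add: mult.commute)
  moreover have "schanuel_integral1 (\<lambda>s. g s * h t) = schanuel_integral1 g * h t" for t
    using schanuel_integral1_cmult[OF cfun1_pwc[OF assms(1)], of "h t"] by (simp add: mult.commute)
  ultimately show ?thesis
    by (simp add: fubini_def schanuel_integral1_cmult cfun1_pwc assms mult.commute)
qed

lemma cfun2_mult:
  fixes f g :: "real \<Rightarrow> real \<Rightarrow> real"
  shows "cfun2 f \<Longrightarrow> cfun2 g \<Longrightarrow> cfun2 (\<lambda>s t. f s t * g s t)"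
  by (rule cfun2_map2)

text \<open>Cutting \<open>I\<close> at a point \<open>p\<close> of \<open>S\<close> leaves two open
  intervals with fewer points of \<open>S\<close> and the line over \<open>p\<close>, on which the
  integrand is a product of functions of one variable.\<close>

lemma fubini_split:
  assumes g: "cfun2 g" and S: "finite S"
    and iv: "\<And>I. open I \<Longrightarrow> is_interval I \<Longrightarrow> cfun1 (\<lambda>s. s \<in> I) \<Longrightarrow> I \<inter> S = {} \<Longrightarrow>
      fubini (\<lambda>s t. of_bool (s \<in> I) * g s t)"
  shows "fubini g"
proof -
  have "fubini (\<lambda>s t. of_bool (s \<in> I) * g s t)"
    if "open I" "is_interval I" "cfun1 (\<lambda>s. s \<in> I)" for I
    using that
  proof (induction "card (I \<inter> S)" arbitrary: I rule: less_induct)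
    case less
    show ?case
    proof (cases "I \<inter> S = {}")
      case True
      then show ?thesis using iv less.prems by blast
    next
      case False
      then obtain p where p: "p \<in> I" "p \<in> S" by auto
      define L where "L = I \<inter> {..<p}"
      define U where "U = I \<inter> {p<..}"
      have opn: "open L" "open U" unfolding L_def U_def using less.prems(1) by auto
      have iv: "is_interval L" "is_interval U"
        unfolding L_def U_def
        by (intro is_interval_Int less.prems(2), simp add: is_interval_convex_1)+
      have c: "cfun1 (\<lambda>s. s \<in> L)" "cfun1 (\<lambda>s. s \<in> U)"
        unfolding L_def U_def using cfun1_map2[OF less.prems(3) cfun1_less, of "(\<and>)"]
          cfun1_map2[OF less.prems(3) cfun1_greater, of "(\<and>)"] by simp_all
      have "p \<notin> L" "p \<notin> U" "L \<subseteq> I" "U \<subseteq> I" by (auto simp: L_def U_def)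
      then have "L \<inter> S \<subset> I \<inter> S" "U \<inter> S \<subset> I \<inter> S" using p by blast+
      then have card: "card (L \<inter> S) < card (I \<inter> S)" "card (U \<inter> S) < card (I \<inter> S)"
        using S by (auto intro!: psubset_card_mono)
      define gL where "gL = (\<lambda>s t. of_bool (s \<in> L) * g s t)"
      define gU where "gU = (\<lambda>s t. of_bool (s \<in> U) * g s t)"
      define gp where "gp = (\<lambda>s t. of_bool (s = p) * g p t)"
      have "cfun1 (g p)" by (rule cfun2_fibre[OF g])
      then have cf: "cfun2 gL" "cfun2 gU" "cfun2 gp"
        unfolding gL_def gU_def gp_def
        using cfun2_fst[OF cfun1_map[OF c(1), of of_bool]] cfun2_fst[OF cfun1_map[OF c(2), of of_bool]]
          cfun2_fst[OF cfun1_map[OF cfun1_eq_const, of of_bool]] cfun2_snd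
        by (auto intro!: cfun2_mult g)
      have "fubini gp" unfolding gp_def
        by (rule fubini_product[OF cfun1_map[OF cfun1_eq_const] \<open>cfun1 (g p)\<close>])
      moreover have "fubini gL" "fubini gU"
        unfolding gL_def gU_def using less.hyps[OF card(1) opn(1) iv(1) c(1)]
          less.hyps[OF card(2) opn(2) iv(2) c(2)] by simp_all
      ultimately have "fubini (\<lambda>s t. gL s t + (gU s t + gp s t))"
        using cf by (intro fubini_add cfun2_map2[where F = "(+)"])
      moreover have "gL s t + (gU s t + gp s t) = of_bool (s \<in> I) * g s t" for s t
        using p by (cases s p rule: linorder_cases) (auto simp: gL_def gU_def gp_def L_def U_def)
      ultimately show ?thesis by simp
    qed
  qed
  from this[of UNIV] show ?thesis by (simp add: cfun1_const is_interval_univ)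
qed

lemma pwc_open_interval:
  assumes "open S" "is_interval S"
  shows "pwc (\<lambda>t. of_bool (t \<in> S) :: real)"
proof -
  have lt: "pwc (\<lambda>t. t < b)" "pwc (\<lambda>t. b < t)" for b :: real
    by (rule cfun1_pwc cfun1_less cfun1_greater)+
  have bt: "pwc (\<lambda>t. a < t \<and> t < b)" for a b :: real
    using pwc_map2[OF lt(2) lt(1), of "(\<and>)"] .
  have "pwc (\<lambda>t. t \<in> S)"
    using open_interval_cases[OF assms] by (elim disjE exE conjE) (simp_all add: pwc_const lt bt)
  then show ?thesis by (rule pwc_map)
qed

text \<open>Both sides are computed. For the graph, the inner integrals are the indicators of
  \<open>I\<close> and of its image, both nonempty open intervals, so each iterated integral is -1.
  For the subgraph, the inner integrals are minus the indicators of \<open>I\<close> and of the set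
  of all t below some value of \<xi>, again an open interval, so each is 1.\<close>

lemma fubini_graph_mono:
  fixes \<xi> :: "real \<Rightarrow> real"
  assumes I: "open I" "is_interval I" "I \<noteq> {}" and c: "continuous_on I \<xi>"
    and mono: "(\<forall>s\<in>I. \<forall>t\<in>I. s < t \<longrightarrow> \<xi> s < \<xi> t) \<or> (\<forall>s\<in>I. \<forall>t\<in>I. s < t \<longrightarrow> \<xi> t < \<xi> s)"
  shows "fubini (\<lambda>s t. of_bool (s \<in> I) * of_bool (t = \<xi> s))"
    and "fubini (\<lambda>s t. of_bool (s \<in> I) * of_bool (t < \<xi> s))"
proof -
  have z: "schanuel_integral1 (\<lambda>t. 0) = 0" using schanuel_integral1_const[of 0] by simp
  have "schanuel_integral1 (\<lambda>t. of_bool (s \<in> I) * of_bool (t = \<xi> s)) = of_bool (s \<in> I)" for s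
    by (cases "s \<in> I") (simp_all add: schanuel_integral1_point z)
  then have 1: "schanuel_integral1 (\<lambda>s. schanuel_integral1 (\<lambda>t. of_bool (s \<in> I) * of_bool (t = \<xi> s))) = - 1"
    using schanuel_integral1_open_interval[OF I] by simp
  have "schanuel_integral1 (\<lambda>s. of_bool (s \<in> I) * of_bool (t = \<xi> s)) = of_bool (t \<in> \<xi> ` I)" for t
  proof (cases "t \<in> \<xi> ` I")
    case True
    then obtain s0 where s0: "s0 \<in> I" "t = \<xi> s0" by auto
    have ne: "\<xi> s \<noteq> \<xi> s0" if "s \<in> I" "s \<noteq> s0" for s
      using mono s0(1) that by (cases s s0 rule: linorder_cases) fastforce+
    have "(s \<in> I \<and> t = \<xi> s) = (s = s0)" for s using s0 ne[of s] by (cases "s = s0") auto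
    then have "(\<lambda>s. of_bool (s \<in> I) * of_bool (t = \<xi> s)) = (\<lambda>s. of_bool (s = s0) :: real)"
      by (simp flip: of_bool_conj)
    then show ?thesis using True by (simp add: schanuel_integral1_point)
  next
    case False
    then have "(\<lambda>s. of_bool (s \<in> I) * of_bool (t = \<xi> s)) = (\<lambda>s. 0 :: real)" by (auto simp: fun_eq_iff)
    then show ?thesis using False by (simp add: z)
  qed
  then have 2: "schanuel_integral1 (\<lambda>t. schanuel_integral1 (\<lambda>s. of_bool (s \<in> I) * of_bool (t = \<xi> s))) = - 1"
    using schanuel_integral1_open_interval[OF open_interval_image[OF I(1,2) c mono]] I(3) by simp
  from 1 2 show "fubini (\<lambda>s t. of_bool (s \<in> I) * of_bool (t = \<xi> s))" by (simp add: fubini_def)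
  have neg: "schanuel_integral1 (\<lambda>t. - 1 * of_bool (t \<in> J)) = 1"
    if "open J" "is_interval J" "J \<noteq> {}" for J
    using schanuel_integral1_cmult[OF pwc_open_interval[OF that(1,2)], of "- 1"]
      schanuel_integral1_open_interval[OF that] by simp
  have "schanuel_integral1 (\<lambda>t. of_bool (s \<in> I) * of_bool (t < \<xi> s)) = - 1 * of_bool (s \<in> I)" for s
  proof (cases "s \<in> I")
    case True
    have "schanuel_integral1 (\<lambda>t. of_bool (t \<in> {..<\<xi> s})) = - 1"
      by (rule schanuel_integral1_open_interval) (simp_all add: is_interval_convex_1)
    with True show ?thesis by simp
  qed (simp add: z)
  then have 3: "schanuel_integral1 (\<lambda>s. schanuel_integral1 (\<lambda>t. of_bool (s \<in> I) * of_bool (t < \<xi> s))) = 1"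
    using neg[OF I] by simp
  define U where "U = (\<Union>s\<in>I. {..<\<xi> s})"
  have "schanuel_integral1 (\<lambda>s. of_bool (s \<in> I) * of_bool (t < \<xi> s)) = - 1 * of_bool (t \<in> U)" for t
  proof -
    have eq: "(\<lambda>s. of_bool (s \<in> I) * of_bool (t < \<xi> s)) = (\<lambda>s. of_bool (s \<in> {s \<in> I. t < \<xi> s}) :: real)"
      by (auto simp: fun_eq_iff)
    show ?thesis
    proof (cases "t \<in> U")
      case True
      then have "{s \<in> I. t < \<xi> s} \<noteq> {}" by (auto simp: U_def)
      from schanuel_integral1_open_interval[OF open_interval_superlevel[OF I(1,2) c mono] this]
      show ?thesis unfolding eq using True by simp
    next
      case False
      then have "{s \<in> I. t < \<xi> s} = {}" by (auto simp: U_def)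
      then show ?thesis unfolding eq using False by (simp only: empty_iff) (simp add: z)
    qed
  qed
  moreover have "schanuel_integral1 (\<lambda>t. - 1 * of_bool (t \<in> U)) = 1"
  proof (rule neg)
    show "open U" "U \<noteq> {}" using I(3) by (auto simp: U_def)
    show "is_interval U" unfolding is_interval_1 U_def by (auto intro: le_less_trans)
  qed
  ultimately have 4: "schanuel_integral1 (\<lambda>t. schanuel_integral1 (\<lambda>s. of_bool (s \<in> I) * of_bool (t < \<xi> s))) = 1"
    by simp
  from 3 4 show "fubini (\<lambda>s t. of_bool (s \<in> I) * of_bool (t < \<xi> s))" by (simp add: fubini_def)
qed

lemma fubini_graph:
  fixes \<xi> \<phi> :: "real \<Rightarrow> real"
  assumes \<xi>: "cfun2 (\<lambda>s u. u = \<xi> s)" and \<phi>: "cfun1 \<phi>"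
  shows "fubini (\<lambda>s t. \<phi> s * of_bool (t = \<xi> s))" "fubini (\<lambda>s t. \<phi> s * of_bool (t < \<xi> s))"
proof -
  obtain S where S: "finite S" "\<forall>I. open I \<longrightarrow> is_interval I \<longrightarrow> I \<inter> S = {} \<longrightarrow>
      (\<forall>s\<in>I. \<forall>t\<in>I. \<phi> s = \<phi> t) \<and> const_or_mono \<xi> I"
    using piecewise_const_or_mono[OF \<xi> \<phi>] by (elim exE conjE)
  \<comment> \<open>\<open>R\<close> is = for the graph and < for the subgraph. Between the
    breakpoints the coefficient is a constant factor, and a constant \<xi> gives a product of
    functions of one variable.\<close>
  have main: "fubini (\<lambda>s t. \<phi> s * of_bool (R t (\<xi> s)))"
    if R: "cfun2 (\<lambda>s t. R t (\<xi> s))" "\<And>c. cfun1 (\<lambda>t. R t c)"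
      and mono: "\<And>I. open I \<Longrightarrow> is_interval I \<Longrightarrow> I \<noteq> {} \<Longrightarrow> continuous_on I \<xi> \<Longrightarrow>
        (\<forall>s\<in>I. \<forall>t\<in>I. s < t \<longrightarrow> \<xi> s < \<xi> t) \<or> (\<forall>s\<in>I. \<forall>t\<in>I. s < t \<longrightarrow> \<xi> t < \<xi> s) \<Longrightarrow>
        fubini (\<lambda>s t. of_bool (s \<in> I) * of_bool (R t (\<xi> s)))" for R :: "real \<Rightarrow> real \<Rightarrow> bool"
  proof (rule fubini_split[OF _ S(1)])
    show "cfun2 (\<lambda>s t. \<phi> s * of_bool (R t (\<xi> s)))"
      by (intro cfun2_mult cfun2_fst[OF \<phi>] cfun2_map[OF R(1)])
    fix I assume I: "open I" "is_interval I" "cfun1 (\<lambda>s. s \<in> I)" "I \<inter> S = {}"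
    show "fubini (\<lambda>s t. of_bool (s \<in> I) * (\<phi> s * of_bool (R t (\<xi> s))))"
    proof (cases "I = {}")
      case True
      then show ?thesis by (simp add: fubini_def)
    next
      case False
      then obtain a where a: "a \<in> I" by auto
      note * = S(2)[THEN spec, THEN mp, OF I(1), THEN mp, OF I(2), THEN mp, OF I(4)]
      have k: "\<phi> s = \<phi> a" if "s \<in> I" for s by (rule bspec[OF bspec[OF conjunct1[OF *] that] a])
      define h where "h = (\<lambda>s t. of_bool (s \<in> I) * of_bool (R t (\<xi> s)) :: real)"
      have h: "cfun2 h" unfolding h_def
        by (intro cfun2_mult cfun2_fst[OF cfun1_map[OF I(3)]] cfun2_map[OF R(1)])
      have "fubini h"
      proof (cases "\<forall>s\<in>I. \<forall>t\<in>I. \<xi> s = \<xi> t")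
        case True
        have "\<xi> s = \<xi> a" if "s \<in> I" for s by (rule bspec[OF bspec[OF True that] a])
        then have "h s t = of_bool (s \<in> I) * of_bool (R t (\<xi> a))" for s t
          by (cases "s \<in> I") (simp_all add: h_def)
        then have "h = (\<lambda>s t. of_bool (s \<in> I) * of_bool (R t (\<xi> a)))" by blast
        then show ?thesis using fubini_product[OF cfun1_map[OF I(3), of of_bool] cfun1_map[OF R(2), of of_bool]]
          by simp
      next
        case nc: False
        have "continuous_on I \<xi> \<and> ((\<forall>s\<in>I. \<forall>t\<in>I. s < t \<longrightarrow> \<xi> s < \<xi> t) \<or>
            (\<forall>s\<in>I. \<forall>t\<in>I. s < t \<longrightarrow> \<xi> t < \<xi> s))"
          using conjunct2[OF *, unfolded const_or_mono_def] nc by (rule disj_imp[THEN iffD1, THEN mp])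
        then show ?thesis unfolding h_def by (intro mono[OF I(1,2) False]) (erule conjunct1, erule conjunct2)
      qed
      then have "fubini (\<lambda>s t. \<phi> a * h s t)" by (rule fubini_cmult[OF h])
      moreover have "\<phi> a * h s t = of_bool (s \<in> I) * (\<phi> s * of_bool (R t (\<xi> s)))" for s t
        using k[of s] by (auto simp: h_def)
      ultimately show ?thesis by simp
    qed
  qed
  show "fubini (\<lambda>s t. \<phi> s * of_bool (t = \<xi> s))"
    by (rule main[of "(=)"]) (use \<xi> cfun1_eq_const fubini_graph_mono(1) in auto)
  show "fubini (\<lambda>s t. \<phi> s * of_bool (t < \<xi> s))"
    by (rule main[of "(<)"]) (use cfun2_subst_less[OF \<xi>] cfun1_less fubini_graph_mono(2) in auto)
qed

text \<open>
  Peeling off the lowest breakpoint \<open>\<xi> s\<close> of each fibre writes \<open>f\<close> as a function with fewer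
  breakpoints plus multiples of the indicators of the graph and of the subgraph of \<open>\<xi>\<close>.
\<close>

lemma fubini_breaks:
  fixes f :: "real \<Rightarrow> real \<Rightarrow> real"
  assumes "cfun2 f" "cfun2 (\<lambda>s t. t \<in> B s)" "\<And>s. finite (B s)" "\<And>s. card (B s) \<le> N"
    "\<And>s u v. u \<le> v \<Longrightarrow> {u..v} \<inter> B s = {} \<Longrightarrow> f s u = f s v"
  shows "fubini f"
  using assms
proof (induction N arbitrary: f B)
  case 0
  then have "B s = {}" for s by simp
  then have const: "f s u = f s 0" for s u
    using "0.prems"(5)[of u 0 s] "0.prems"(5)[of 0 u s] by (cases "u \<le> 0") simp_all
  have "fubini (\<lambda>s t. f s 0 * 1)"
    by (rule fubini_product[OF cfun2_fibre'[OF "0.prems"(1)] cfun1_const])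
  moreover have "(\<lambda>s t. f s 0 * 1) = f"
  proof (intro ext)
    show "f s 0 * 1 = f s t" for s t using const[of s t] by simp
  qed
  ultimately show ?case by (simp only:)
next
  case (Suc N)
  note f = Suc.prems(1) and B = Suc.prems(2) and fin = Suc.prems(3) and brk = Suc.prems(5)
  define D where "D s \<longleftrightarrow> (\<exists>t. t \<in> B s)" for s
  \<comment> \<open>The default 0 on fibres without breakpoints keeps \<xi> total with
    semi-algebraic graph; the coefficients \<open>a\<close> and \<open>b\<close> vanish
    there.\<close>
  define \<xi> where "\<xi> s = (if D s then Min (B s) else 0)" for s
  have \<xi>_in: "\<xi> s \<in> B s" and \<xi>_le: "\<And>t. t \<in> B s \<Longrightarrow> \<xi> s \<le> t" if "D s" for s
    using that Min_in[OF fin[of s]] Min_le[OF fin[of s]] by (auto simp: \<xi>_def D_def)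
  have D: "cfun1 D" unfolding D_def using cfun1_ex[OF B] .
  have \<xi>: "cfun2 (\<lambda>s u. u = \<xi> s)"
  proof -
    have ge: "cfun2 (\<lambda>s u. \<forall>v. v \<in> B s \<longrightarrow> \<not> v < u)"
    proof -
      have "cfun (Suc (Suc (Suc 0))) (\<lambda>x. x ! Suc (Suc 0) \<in> B (x ! 0) \<longrightarrow> \<not> x ! Suc (Suc 0) < x ! Suc 0)"
        by (intro cfun_imp cfun_not cfun_coord_less cfun2_coord[OF B]) auto
      then show ?thesis unfolding cfun2_def by (intro cfun_all) simp
    qed
    have "cfun2 (\<lambda>s u. if D s then u \<in> B s \<and> (\<forall>v. v \<in> B s \<longrightarrow> \<not> v < u) else u = 0)"
      using cfun2_fst[OF D] cfun2_map2[OF B ge, of "(\<and>)"] cfun2_snd[OF cfun1_eq_const[of 0]]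
      unfolding cfun2_def by (intro cfun_if)
    moreover have "(if D s then u \<in> B s \<and> (\<forall>v. v \<in> B s \<longrightarrow> \<not> v < u) else u = 0) = (u = \<xi> s)" for s u
    proof (cases "D s")
      case True
      have "u = \<xi> s" if "u \<in> B s" "\<forall>v. v \<in> B s \<longrightarrow> \<not> v < u"
        using \<xi>_le[OF True that(1)] that(2)[rule_format, OF \<xi>_in[OF True]] by simp
      then show ?thesis using True \<xi>_in[OF True] \<xi>_le[OF True] by (auto simp: not_less)
    qed (simp add: \<xi>_def)
    ultimately show ?thesis by simp
  qed
  note lt = cfun2_subst_less[OF \<xi>]
  define \<alpha> where "\<alpha> s = Lim (at_left (\<xi> s)) (f s)" for s
  define \<gamma> where "\<gamma> s = Lim (at_right (\<xi> s)) (f s)" for s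
  have coefs: "cfun1 \<alpha>" "cfun1 \<gamma>" "cfun1 (\<lambda>s. f s (\<xi> s))"
    unfolding \<alpha>_def[abs_def] \<gamma>_def[abs_def]
    using cfun1_subst[OF \<xi> cfun2_Lim(2)[OF f]] cfun1_subst[OF \<xi> cfun2_Lim(1)[OF f]] cfun1_subst[OF \<xi> f] .
  \<comment> \<open>Below the first breakpoint \<open>f\<close> equals \<alpha>, just above it
    \<gamma>. Since \<open>g\<close> continues \<gamma> downwards, \<open>a\<close> and
    \<open>b\<close> are the corrections below and on the graph.\<close>
  define a where "a s = (if D s then \<alpha> s - \<gamma> s else 0)" for s
  define b where "b s = (if D s then f s (\<xi> s) - \<gamma> s else 0)" for s
  have ab: "cfun1 a" "cfun1 b"
    using D coefs unfolding a_def[abs_def] b_def[abs_def] cfun1_def by (intro cfun_if cfun_diff cfun_const; simp)+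
  define g where "g s t = (if D s \<and> \<not> \<xi> s < t then \<gamma> s else f s t)" for s t
  define C where "C s = {t \<in> B s. \<xi> s < t}" for s
  have below: "f s t = \<alpha> s" if "D s" "t < \<xi> s" for s t
  proof -
    have "f s u = f s t" if "u < \<xi> s" for u
    proof -
      have disj: "{v..w} \<inter> B s = {}" if "w < \<xi> s" for v w using \<xi>_le[OF \<open>D s\<close>] that by force
      show ?thesis
      proof (cases "u \<le> t")
        case True
        then show ?thesis by (rule brk[OF _ disj[OF \<open>t < \<xi> s\<close>]])
      next
        case False
        then have "t \<le> u" by simp
        then show ?thesis by (rule brk[OF _ disj[OF that], symmetric])
      qed
    qed
    then have "\<forall>\<^sub>F u in at_left (\<xi> s). f s u = f s t"
      unfolding eventually_at_left_field by (intro exI[of _ "\<xi> s - 1"]) auto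
    then show ?thesis unfolding \<alpha>_def by (intro Lim_eventually_eq[symmetric]) simp_all
  qed
  have above: "f s t = \<gamma> s" if "D s" "\<xi> s < t" "{\<xi> s<..t} \<inter> B s = {}" for s t
  proof -
    have "f s u = f s t" if "\<xi> s < u" "u < t" for u
    proof (rule brk)
      have "{u..t} \<subseteq> {\<xi> s<..t}" using that by auto
      then show "{u..t} \<inter> B s = {}" using \<open>{\<xi> s<..t} \<inter> B s = {}\<close> by blast
    qed (use that in simp)
    then have "\<forall>\<^sub>F u in at_right (\<xi> s). f s u = f s t"
      unfolding eventually_at_right_field using that(2) by (intro exI[of _ t]) auto
    then show ?thesis unfolding \<gamma>_def by (intro Lim_eventually_eq[symmetric]) simp_all
  qed
  have g: "cfun2 g"
    using cfun2_fst[OF D] cfun2_map[OF lt(2), of Not] cfun2_fst[OF coefs(2)] f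
    unfolding g_def[abs_def] cfun2_def by (intro cfun_if cfun_conj)
  have "fubini g"
  proof (rule Suc.IH[of g C])
    show "cfun2 (\<lambda>s t. t \<in> C s)"
      using cfun2_map2[OF B lt(2), of "(\<and>)"] by (simp add: C_def)
    show "finite (C s)" for s using fin by (simp add: C_def)
    show "card (C s) \<le> N" for s
    proof (cases "D s")
      case True
      then have "C s \<subset> B s" using \<xi>_in by (auto simp: C_def)
      then have "card (C s) < card (B s)" using fin by (rule psubset_card_mono[rotated])
      then show ?thesis using Suc.prems(4)[of s] by simp
    next
      case False
      then have "C s = {}" by (auto simp: C_def D_def)
      then show ?thesis by simp
    qed
    show "g s u = g s v" if uv: "u \<le> v" "{u..v} \<inter> C s = {}" for s u v
    proof (cases "D s")
      case False
      then have "C s = B s" by (auto simp: C_def D_def)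
      then show ?thesis using False brk[of u v s] uv by (simp add: g_def)
    next
      case True
      consider "v \<le> \<xi> s" | "u \<le> \<xi> s" "\<xi> s < v" | "\<xi> s < u" using uv(1) by linarith
      then show ?thesis
      proof cases
        case 1
        then show ?thesis using True uv(1) by (simp add: g_def)
      next
        case 2
        have "{\<xi> s<..v} \<inter> B s \<subseteq> {u..v} \<inter> C s" using 2 by (auto simp: C_def)
        then have "f s v = \<gamma> s" using uv(2) 2 by (intro above[OF True]) auto
        then show ?thesis using True 2 by (simp add: g_def)
      next
        case 3
        then have "{u..v} \<inter> B s \<subseteq> {u..v} \<inter> C s" by (auto simp: C_def)
        then have "f s u = f s v" using uv by (intro brk) auto
        then show ?thesis using 3 uv(1) by (simp add: g_def)
      qed
    qed
  qed (rule g)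
  moreover have "fubini (\<lambda>s t. a s * of_bool (t < \<xi> s))" "fubini (\<lambda>s t. b s * of_bool (t = \<xi> s))"
    using fubini_graph[OF \<xi>] ab by auto
  moreover have "cfun2 (\<lambda>s t. a s * of_bool (t < \<xi> s))" "cfun2 (\<lambda>s t. b s * of_bool (t = \<xi> s))"
    using cfun2_fst[OF ab(1)] cfun2_fst[OF ab(2)] cfun2_map[OF lt(1), of of_bool] cfun2_map[OF \<xi>, of of_bool]
    by (auto intro: cfun2_mult)
  ultimately have "fubini (\<lambda>s t. g s t + (a s * of_bool (t < \<xi> s) + b s * of_bool (t = \<xi> s)))"
    using g by (intro fubini_add cfun2_map2[where F = "(+)"])
  moreover have "g s t + (a s * of_bool (t < \<xi> s) + b s * of_bool (t = \<xi> s)) = f s t" for s t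
  proof (cases "D s")
    case True
    then show ?thesis using below[OF True, of t]
      by (cases t "\<xi> s" rule: linorder_cases) (auto simp: g_def a_def b_def)
  qed (simp add: g_def a_def b_def)
  ultimately show ?case by simp
qed

text \<open>This bounds the number of roots on all fibres at once, as the induction in
  \<open>fubini_breaks\<close> demands.\<close>

lemma pfam_degree_bounded: "pfam n P \<Longrightarrow> \<exists>d. \<forall>x. degree (P x) \<le> d"
proof (induction rule: pfam.induct)
  case (pCons c P)
  then obtain d where d: "\<forall>x. degree (P x) \<le> d" by auto
  have "degree (pCons (c x) (P x)) \<le> Suc d" for x
    using d[rule_format, of x] degree_pCons_le[of "c x" "P x"] by simp
  then show ?case by blast
qed (rule exI[of _ 0], simp)

lemma fubini_sgn:
  assumes "poly_fun (Suc (Suc 0)) q"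
  shows "fubini (\<lambda>s t. sgn (q [s, t]))"
proof -
  obtain Q where Q: "pfam (Suc 0) Q" "\<forall>x\<in>Rn (Suc 0). \<forall>t. q (x @ [t]) = poly (Q x) t"
    using poly_fun_pfam[OF assms] by (elim exE conjE)
  have q: "q [s, t] = poly (Q [s]) t" for s t
    using Q(2)[rule_format, of "[s]" t] by (simp add: Rn_def)
  obtain d where d: "\<forall>x. degree (Q x) \<le> d" using pfam_degree_bounded[OF Q(1)] by (elim exE)
  \<comment> \<open>A fibre on which \<open>q\<close> vanishes identically has constant sign 0 and
    gets no breakpoints.\<close>
  define B where "B s = (if Q [s] = 0 then {} else {t. poly (Q [s]) t = 0})" for s
  have sq: "cfun2 (\<lambda>s t. sgn (q [s, t]))"
    unfolding cfun2_def using cfun_sgn[OF assms]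
    by (rule cfun_cong) (auto simp: Rn_def length_Suc_conv)
  have z: "cfun1 (\<lambda>s. Q [s] = 0)"
    unfolding cfun1_def using cfun_pfam_eq_0[OF Q(1)]
    by (rule cfun_cong) (auto simp: Rn_def length_Suc_conv)
  show ?thesis
  proof (rule fubini_breaks[OF sq, where B = B and N = d])
    have "cfun2 (\<lambda>s t. \<not> Q [s] = 0 \<and> sgn (q [s, t]) = 0)"
      using cfun2_map2[OF cfun2_fst[OF z] sq, of "\<lambda>b c. \<not> b \<and> c = 0"] .
    moreover have "(\<not> Q [s] = 0 \<and> sgn (q [s, t]) = 0) = (t \<in> B s)" for s t
      by (simp add: B_def q sgn_eq_0_iff)
    ultimately show "cfun2 (\<lambda>s t. t \<in> B s)" by simp
    show "finite (B s)" for s using poly_roots_finite[of "Q [s]"] by (simp add: B_def)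
    show "card (B s) \<le> d" for s
      using card_poly_roots_bound[of "Q [s]"] d[rule_format, of "[s]"] by (auto simp: B_def)
    show "sgn (q [s, u]) = sgn (q [s, v])" if "u \<le> v" "{u..v} \<inter> B s = {}" for s u v
    proof (cases "Q [s] = 0")
      case False
      then show ?thesis unfolding q using that
        by (intro sgn_poly_const_on) (auto simp: B_def)
    qed (simp add: q)
  qed
qed

lemma fubini_plane:
  fixes f :: "real \<Rightarrow> real \<Rightarrow> real"
  assumes "cfun2 f" shows "fubini f"
proof -
  obtain L where L: "\<forall>(c, q)\<in>set L. poly_fun (Suc (Suc 0)) q"
    "\<forall>x\<in>Rn (Suc (Suc 0)). f (x ! 0) (x ! Suc 0) = (\<Sum>(c, q)\<leftarrow>L. c * sgn (q x))"
    using cfun_real_representation[OF assms[unfolded cfun2_def]] by (elim exE conjE)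
  have "cfun2 (\<lambda>s t. \<Sum>i\<leftarrow>L. fst i * sgn (snd i [s, t])) \<and> fubini (\<lambda>s t. \<Sum>i\<leftarrow>L. fst i * sgn (snd i [s, t]))"
    using L(1)
  proof (induction L)
    case Nil
    have "fubini (\<lambda>s t. 0 * 0)" by (rule fubini_product[OF cfun1_const cfun1_const])
    then show ?case using cfun2_fst[OF cfun1_const[of "0 :: real"]] by simp
  next
    case (Cons i L)
    have q: "poly_fun (Suc (Suc 0)) (snd i)" using Cons.prems by auto
    have sq: "cfun2 (\<lambda>s t. sgn (snd i [s, t]))"
      unfolding cfun2_def using cfun_sgn[OF q]
      by (rule cfun_cong) (auto simp: Rn_def length_Suc_conv)
    have "cfun2 (\<lambda>s t. fst i * sgn (snd i [s, t]))" "fubini (\<lambda>s t. fst i * sgn (snd i [s, t]))"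
      using cfun2_map[OF sq] fubini_cmult[OF sq fubini_sgn[OF q]] .
    then show ?case using Cons
      by (auto intro: fubini_add cfun2_map2[where F = "(+)"])
  qed
  moreover have "f = (\<lambda>s t. \<Sum>i\<leftarrow>L. fst i * sgn (snd i [s, t]))"
  proof (intro ext)
    show "f s t = (\<Sum>i\<leftarrow>L. fst i * sgn (snd i [s, t]))" for s t
      using L(2)[rule_format, of "[s, t]"] by (simp add: Rn_def case_prod_unfold)
  qed
  ultimately show ?thesis by simp
qed

subsection \<open>Iterated integrals and graphs\<close>

lemma schanuel_integral_cong:
  "(\<And>x. x \<in> Rn n \<Longrightarrow> f x = g x) \<Longrightarrow> schanuel_integral n f = schanuel_integral n g"
proof (induction n arbitrary: f g)
  case (Suc n)
  have "schanuel_integral1 (\<lambda>t. f (a @ [t])) = schanuel_integral1 (\<lambda>t. g (a @ [t]))" if "a \<in> Rn n" for a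
    using Suc.prems append_Rn[OF that] by simp
  then show ?case unfolding schanuel_integral.simps by (rule Suc.IH)
qed (simp add: Rn_def)

text \<open>One variable moves past \<open>m\<close> others. The innermost pair is exchanged by
  Fubini in the plane with the remaining coordinates fixed; the others follow by induction for the
  function already integrated over the last variable.\<close>

lemma schanuel_integral_swap1:
  fixes f :: "real list \<Rightarrow> real"
  assumes "cfun (Suc m) f"
  shows "schanuel_integral1 (\<lambda>x. schanuel_integral m (\<lambda>b. f (x # b))) =
    schanuel_integral m (\<lambda>b. schanuel_integral1 (\<lambda>x. f (x # b)))"
  using assms
proof (induction m arbitrary: f)
  case (Suc m)
  have fub: "schanuel_integral1 (\<lambda>x. schanuel_integral1 (\<lambda>t. f (x # b @ [t]))) =
      schanuel_integral1 (\<lambda>t. schanuel_integral1 (\<lambda>x. f (x # b @ [t])))" if "b \<in> Rn m" for b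
  proof -
    \<comment> \<open>The coordinates in \<open>b\<close> are frozen by substituting constants,
      leaving a function of the first and the last variable.\<close>
    have "cfun (Suc (Suc 0)) (\<lambda>z. f (map (\<lambda>g. g z) ([\<lambda>z. z ! 0] @ map (\<lambda>c z. c) b @ [\<lambda>z. z ! Suc 0])))"
      using that by (intro cfun_preimage[OF Suc.prems]) (auto simp: Rn_def intro: poly_fun.intros)
    then have "cfun2 (\<lambda>x t. f (x # b @ [t]))" by (simp add: cfun2_def comp_def)
    from fubini_plane[OF this] show ?thesis by (simp add: fubini_def)
  qed
  have "schanuel_integral1 (\<lambda>x. schanuel_integral (Suc m) (\<lambda>b. f (x # b))) =
      schanuel_integral1 (\<lambda>x. schanuel_integral m (\<lambda>b. schanuel_integral1 (\<lambda>t. f ((x # b) @ [t]))))"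
    by simp
  also have "\<dots> = schanuel_integral m (\<lambda>b. schanuel_integral1 (\<lambda>x. schanuel_integral1 (\<lambda>t. f ((x # b) @ [t]))))"
    by (rule Suc.IH[OF cfun_integral[OF Suc.prems]])
  also have "\<dots> = schanuel_integral m (\<lambda>b. schanuel_integral1 (\<lambda>t. schanuel_integral1 (\<lambda>x. f (x # b @ [t]))))"
    by (rule schanuel_integral_cong) (simp add: fub)
  finally show ?case by simp
qed simp

text \<open>The last variable of the first block is moved past the second block; integrating it out
  leaves the function \<open>h\<close> of n + m variables, to which the induction hypothesis
  applies.\<close>

lemma schanuel_integral_swap:
  fixes f :: "real list \<Rightarrow> real"
  assumes "cfun (n + m) f"
  shows "schanuel_integral n (\<lambda>a. schanuel_integral m (\<lambda>b. f (a @ b))) =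
    schanuel_integral m (\<lambda>b. schanuel_integral n (\<lambda>a. f (a @ b)))"
  using assms
proof (induction n arbitrary: f)
  case (Suc n)
  define h where "h y = schanuel_integral1 (\<lambda>x. f (take n y @ x # drop n y))" for y
  have h_app: "h (a @ b) = schanuel_integral1 (\<lambda>x. f (a @ x # b))" if "a \<in> Rn n" for a b
    using that by (simp add: h_def Rn_def)
  \<comment> \<open>Integration acts on the last coordinate, so the coordinates are permuted to
    place the variable \<open>x\<close> between the blocks at the end.\<close>
  have "cfun (Suc (n + m)) (\<lambda>z. f (map ((!) z) ([0..<n] @ [n + m] @ [n..<n + m])))"
    using Suc.prems by (intro cfun_coords[of "Suc n + m"]) auto
  then have "cfun (n + m) (\<lambda>y. schanuel_integral1
      (\<lambda>t. f (map ((!) (y @ [t])) ([0..<n] @ [n + m] @ [n..<n + m]))))"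
    by (rule cfun_integral)
  then have "cfun (n + m) h"
  proof (rule cfun_cong)
    fix y :: "real list" assume y: "y \<in> Rn (n + m)"
    have "map ((!) (y @ [t])) ([0..<n] @ [n + m] @ [n..<n + m]) = take n y @ t # drop n y" for t
      using y by (intro nth_equalityI) (auto simp: Rn_def nth_append nth_Cons split: nat.splits)
    then show "schanuel_integral1 (\<lambda>t. f (map ((!) (y @ [t])) ([0..<n] @ [n + m] @ [n..<n + m]))) = h y"
      by (simp only: h_def)
  qed
  note IH = Suc.IH[OF this]
  have "schanuel_integral (Suc n) (\<lambda>a. schanuel_integral m (\<lambda>b. f (a @ b))) =
      schanuel_integral n (\<lambda>a. schanuel_integral1 (\<lambda>x. schanuel_integral m (\<lambda>b. f (a @ x # b))))"
    by simp
  also have "\<dots> = schanuel_integral n (\<lambda>a. schanuel_integral m (\<lambda>b. h (a @ b)))"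
  proof (rule schanuel_integral_cong)
    fix a :: "real list" assume a: "a \<in> Rn n"
    have "cfun (Suc m) (\<lambda>z. f (map (\<lambda>g. g z) (map (\<lambda>c z. c) a @ map (\<lambda>i z. z ! i) [0..<Suc m])))"
      using a by (intro cfun_preimage[OF Suc.prems]) (auto simp: Rn_def intro: poly_fun.intros)
    then have "cfun (Suc m) (\<lambda>z. f (a @ z))"
      by (rule cfun_cong) (simp add: Rn_def comp_def map_nth_upt_take del: upt_Suc)
    from schanuel_integral_swap1[OF this]
    show "schanuel_integral1 (\<lambda>x. schanuel_integral m (\<lambda>b. f (a @ x # b))) =
        schanuel_integral m (\<lambda>b. h (a @ b))"
      by (simp add: h_app[OF a])
  qed
  also have "\<dots> = schanuel_integral m (\<lambda>b. schanuel_integral n (\<lambda>a. h (a @ b)))" by (rule IH)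
  also have "\<dots> = schanuel_integral m (\<lambda>b. schanuel_integral (Suc n) (\<lambda>a. f (a @ b)))"
    by (simp add: h_app cong: schanuel_integral_cong)
  finally show ?case .
qed simp

lemma schanuel_integral_zero: "schanuel_integral n (\<lambda>x. 0) = 0"
  by (induction n) (simp_all add: schanuel_integral1_const)

lemma schanuel_integral_point: "c \<in> Rn n \<Longrightarrow> schanuel_integral n (\<lambda>x. of_bool (x = c)) = 1"
proof (induction n arbitrary: c)
  case (Suc n)
  then obtain c' d where c: "c = c' @ [d]" "c' \<in> Rn n"
    by (cases c rule: rev_exhaust) (auto simp: Rn_def)
  have "schanuel_integral1 (\<lambda>t. of_bool (a @ [t] = c)) = of_bool (a = c')" for a
    by (cases "a = c'") (simp_all add: c schanuel_integral1_point schanuel_integral1_const)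
  then show ?case using Suc.IH[OF c(2)] by simp
qed (simp add: Rn_def)

theorem proposition5p1:
  fixes n m :: nat and A B :: "real list set" and \<psi> :: "real list \<Rightarrow> real list"
  assumes "semialgebraic n A" and "semialgebraic m B"
    and "semialgebraic_iso n m A B \<psi>"
  shows "schanuel_euler n A = schanuel_euler m B"
proof -
  define G where "G = {x @ \<psi> x | x. x \<in> A}"
  have bij: "bij_betw \<psi> A B" and G: "semialgebraic (n + m) G"
    using assms(3) by (auto simp: semialgebraic_iso_def G_def)
  have A: "A \<subseteq> Rn n" and B: "B \<subseteq> Rn m" using assms(1,2) semialgebraic_subset by auto
  \<comment> \<open>The fixed length \<open>n\<close> makes the decomposition of a list in
    \<open>G\<close> unique.\<close>
  have fibre: "a @ b \<in> G \<longleftrightarrow> a \<in> A \<and> b = \<psi> a" if "a \<in> Rn n" for a b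
    using that A by (auto simp: G_def Rn_def)
  have "schanuel_euler n A = schanuel_integral n (\<lambda>a. schanuel_integral m (\<lambda>b. of_bool (a @ b \<in> G)))"
    unfolding schanuel_euler_def
  proof (rule schanuel_integral_cong)
    fix a assume a: "a \<in> Rn n"
    show "indicator A a = schanuel_integral m (\<lambda>b. of_bool (a @ b \<in> G))"
    proof (cases "a \<in> A")
      case True
      then have "\<psi> a \<in> Rn m" using bij B by (auto simp: bij_betw_def)
      then show ?thesis using True by (simp add: fibre[OF a] schanuel_integral_point)
    qed (simp add: fibre[OF a] schanuel_integral_zero)
  qed
  also have "\<dots> = schanuel_integral m (\<lambda>b. schanuel_integral n (\<lambda>a. of_bool (a @ b \<in> G)))"
    by (rule schanuel_integral_swap) (rule cfun_map[OF cfun_mem[OF G]])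
  also have "\<dots> = schanuel_euler m B"
    unfolding schanuel_euler_def
  proof (rule schanuel_integral_cong)
    fix b assume "b \<in> Rn m"
    show "schanuel_integral n (\<lambda>a. of_bool (a @ b \<in> G)) = indicator B b"
    proof (cases "b \<in> B")
      case True
      then obtain c where c: "c \<in> A" "b = \<psi> c" using bij by (auto simp: bij_betw_def)
      have "(a @ b \<in> G) = (a = c)" if "a \<in> Rn n" for a
        using fibre[OF that] c bij by (auto simp: bij_betw_def inj_on_def)
      then have "schanuel_integral n (\<lambda>a. of_bool (a @ b \<in> G)) = schanuel_integral n (\<lambda>a. of_bool (a = c))"
        by (intro schanuel_integral_cong) simp
      then show ?thesis using True A c(1) by (simp add: schanuel_integral_point subset_iff)
    next
      case False
      then have "\<not> a @ b \<in> G" if "a \<in> Rn n" for a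
        using fibre[OF that] bij by (auto simp: bij_betw_def)
      then have "schanuel_integral n (\<lambda>a. of_bool (a @ b \<in> G)) = schanuel_integral n (\<lambda>a. 0)"
        by (intro schanuel_integral_cong) simp
      then show ?thesis using False by (simp add: schanuel_integral_zero)
    qed
  qed
  finally show ?thesis .
qed

end
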